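(* Let $\mathcal{H}$ be a separable Hilbert function space on a non-empty set $X$, and suppose that the reproducing kernel of $\mathcal{H}$ is a complete Pick kernel which is normalized at a point $z_0\in X$. If $M^C(\mathcal{H})\subseteq M^R(\mathcal{H})$, then for every multiplier invariant subspace $\mathcal{M}$ of $\mathcal{H}$ there is a sequence $\{b_n\}$ of symbols of bounded Hankel operators (i.e. $b_n\in\operatorname{Han}(\mathcal{H})$) such that $$\mathcal{M}=\bigcap_n\ker H_{b_n}.$$
   Context: A Hilbert function space on a set $X$ is a Hilbert space $\mathcal{H}$ of complex-valued functions on $X$ with bounded point evaluations; $\operatorname{Mult}(\mathcal{H})=\{\varphi:X\to\mathbb{C}:\varphi\mathcal{H}\subseteq\mathcal{H}\}$. A multiplier invariant subspace of $\mathcal{H}$ is a closed subspace $\mathcal{M}$ with $\varphi\mathcal{M}\subseteq\mathcal{M}$ for all $\varphi\in\operatorname{Mult}(\mathcal{H})$. The reproducing kernel $k$ satisfies $f(w)=\langle f,k_w\rangle$, $k_w(z)=k(z,w)$. It is a complete Pick kernel normalized at $z_0\in X$ if $k_{z_0}=1$ and $k_w(z)=\frac1{1-u_w(z)}$ with $u_w(z)$ positive definite, i.e. $\sum_{i,j}a_i\overline{a_j}u_{z_j}(z_i)\ge0$ for all finite choices $z_i\in X$, $a_i\in\mathbb{C}$. For such a kernel $\operatorname{Mult}(\mathcal{H})$ is contained and dense in $\mathcal{H}$. A sequence $\Phi=\{\varphi_1,\varphi_2,\dots\}\subseteq\operatorname{Mult}(\mathcal{H})$ defines a column operator $\Phi^C:h\mapsto(\varphi_1h,\varphi_2h,\dots)^T$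 and a row operator $\Phi^R:(h_i)^T\mapsto\sum_i\varphi_ih_i$. $M^C(\mathcal{H})\subseteq M^R(\mathcal{H})$ means: whenever $\Phi^C$ is bounded $\mathcal{H}\to\bigoplus_{n=1}^\infty\mathcal{H}$, then $\Phi^R$ is bounded $\bigoplus_{n=1}^\infty\mathcal{H}\to\mathcal{H}$. Hankel operators: let $\overline{\mathcal{H}}=\{\overline f:f\in\mathcal{H}\}$ with inner product $\langle\overline f,\overline g\rangle=\langle g,f\rangle$. Let $(\ker\rho)^\perp$ be the set of bounded linear operators $T:\mathcal{H}\to\overline{\mathcal{H}}$ such that $\sum_n\langle g_n,\overline{Tf_n}\rangle=0$ whenever $f_n,g_n\in\mathcal{H}$, $\sum_n\|f_n\|\|g_n\|<\infty$ and $\sum_nf_n(z)g_n(z)=0$ for all $z\in X$. Since $\operatorname{Mult}(\mathcal{H})$ is densely contained in $\mathcal{H}$, each $T\in(\ker\rho)^\perp$ is determined by $T1$. Set $\operatorname{Han}(\mathcal{H})=\{\overline{T1}:T\in(\ker\rho)^\perp\}\subseteq\mathcal{H}$; for $b\in\operatorname{Han}(\mathcal{H})$ let $H_b:\mathcal{H}\to\overline{\mathcal{H}}$ be the unique operator in $(\ker\rho)^\perp$ with $H_b1=\overline b$. *)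

theory Defs
  imports "HOL-Analysis.Analysis" "HOL-Library.Function_Algebras"
begin

text \<open>
  A complex function on a set \<open>X :: 'x set\<close> is represented by a function on the type \<open>'x\<close> that
  vanishes off \<open>X\<close>.  Sums, differences and products of functions are pointwise; the
  constant function one on \<open>X\<close> is \<open>indicator X\<close>.
\<close>

definition vanishes_off :: "'x set \<Rightarrow> ('x \<Rightarrow> complex) \<Rightarrow> bool" where
  "vanishes_off X f \<longleftrightarrow> (\<forall>z. z \<notin> X \<longrightarrow> f z = 0)"

definition cscale :: "complex \<Rightarrow> ('x \<Rightarrow> complex) \<Rightarrow> 'x \<Rightarrow> complex" where
  "cscale c f = (\<lambda>z. c * f z)"

interpretation cfun: vector_space "cscale :: complex \<Rightarrow> ('x \<Rightarrow> complex) \<Rightarrow> 'x \<Rightarrow> complex"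
  by unfold_locales (auto simp: cscale_def plus_fun_def algebra_simps)

type_synonym 'x ip = "('x \<Rightarrow> complex) \<Rightarrow> ('x \<Rightarrow> complex) \<Rightarrow> complex"

definition hnorm :: "'x ip \<Rightarrow> ('x \<Rightarrow> complex) \<Rightarrow> real" where
  "hnorm ip f = sqrt (Re (ip f f))"

definition hlim :: "'x ip \<Rightarrow> (nat \<Rightarrow> 'x \<Rightarrow> complex) \<Rightarrow> ('x \<Rightarrow> complex) \<Rightarrow> bool" where
  "hlim ip F g \<longleftrightarrow> (\<lambda>n. hnorm ip (F n - g)) \<longlonglongrightarrow> 0"

definition hCauchy :: "'x ip \<Rightarrow> (nat \<Rightarrow> 'x \<Rightarrow> complex) \<Rightarrow> bool" where
  "hCauchy ip F \<longleftrightarrow> (\<forall>e>0. \<exists>N. \<forall>m\<ge>N. \<forall>n\<ge>N. hnorm ip (F m - F n) < e)"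

locale hilbert_function_space =
  fixes X :: "'x set" and H :: "('x \<Rightarrow> complex) set" and ip :: "'x ip"
  assumes subspace: "cfun.subspace H"
    and vanishes: "f \<in> H \<Longrightarrow> vanishes_off X f"
    and ip_add_left: "\<lbrakk>f \<in> H; g \<in> H; h \<in> H\<rbrakk> \<Longrightarrow> ip (f + g) h = ip f h + ip g h"
    and ip_scale_left: "\<lbrakk>f \<in> H; g \<in> H\<rbrakk> \<Longrightarrow> ip (cscale c f) g = c * ip f g"
    and ip_commute: "\<lbrakk>f \<in> H; g \<in> H\<rbrakk> \<Longrightarrow> ip g f = cnj (ip f g)"
    and ip_nonneg: "f \<in> H \<Longrightarrow> 0 \<le> Re (ip f f)"
    and ip_definite: "\<lbrakk>f \<in> H; ip f f = 0\<rbrakk> \<Longrightarrow> f = 0"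
    and complete: "\<lbrakk>\<And>n. F n \<in> H; hCauchy ip F\<rbrakk> \<Longrightarrow> \<exists>g\<in>H. hlim ip F g"
    and eval_bounded: "z \<in> X \<Longrightarrow> \<exists>C. \<forall>f\<in>H. cmod (f z) \<le> C * hnorm ip f"

definition hseparable :: "('x \<Rightarrow> complex) set \<Rightarrow> 'x ip \<Rightarrow> bool" where
  "hseparable H ip \<longleftrightarrow>
     (\<exists>D. countable D \<and> D \<subseteq> H \<and> (\<forall>f\<in>H. \<forall>e>0. \<exists>d\<in>D. hnorm ip (f - d) < e))"

definition hclosed :: "('x \<Rightarrow> complex) set \<Rightarrow> 'x ip \<Rightarrow> ('x \<Rightarrow> complex) set \<Rightarrow> bool" where
  "hclosed H ip M \<longleftrightarrow> (\<forall>F g. (\<forall>n. F n \<in> M) \<and> g \<in> H \<and> hlim ip F g \<longrightarrow> g \<in> M)"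

definition Mult :: "'x set \<Rightarrow> ('x \<Rightarrow> complex) set \<Rightarrow> ('x \<Rightarrow> complex) set" where
  "Mult X H = {\<phi>. vanishes_off X \<phi> \<and> (\<forall>f\<in>H. \<phi> * f \<in> H)}"

definition multiplier_invariant_subspace ::
    "'x set \<Rightarrow> ('x \<Rightarrow> complex) set \<Rightarrow> 'x ip \<Rightarrow> ('x \<Rightarrow> complex) set \<Rightarrow> bool" where
  "multiplier_invariant_subspace X H ip M \<longleftrightarrow>
     M \<subseteq> H \<and> cfun.subspace M \<and> hclosed H ip M \<and> (\<forall>\<phi>\<in>Mult X H. \<forall>f\<in>M. \<phi> * f \<in> M)"

text \<open>Kernels are written \<open>k z w\<close> for \<open>k\<^sub>w(z)\<close>; only their values on \<open>X \<times> X\<close> matter.\<close>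

definition reproducing_kernel ::
    "'x set \<Rightarrow> ('x \<Rightarrow> complex) set \<Rightarrow> 'x ip \<Rightarrow> ('x \<Rightarrow> 'x \<Rightarrow> complex) \<Rightarrow> bool" where
  "reproducing_kernel X H ip k \<longleftrightarrow>
     (\<forall>w\<in>X. (\<lambda>z. k z w) \<in> H \<and> (\<forall>f\<in>H. f w = ip f (\<lambda>z. k z w)))"

definition positive_definite_on :: "'x set \<Rightarrow> ('x \<Rightarrow> 'x \<Rightarrow> complex) \<Rightarrow> bool" where
  "positive_definite_on X u \<longleftrightarrow>
     (\<forall>(n::nat) z a. (\<forall>i<n. z i \<in> X) \<longrightarrow>
        (\<Sum>i<n. \<Sum>j<n. a i * cnj (a j) * u (z i) (z j)) \<in> \<real>\<^sub>\<ge>\<^sub>0)"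

text \<open>The condition \<open>u z w \<noteq> 1\<close> makes the quotient meaningful, since \<open>1 / 0 = 0\<close> in HOL.\<close>

definition complete_pick_normalized_at ::
    "'x set \<Rightarrow> ('x \<Rightarrow> 'x \<Rightarrow> complex) \<Rightarrow> 'x \<Rightarrow> bool" where
  "complete_pick_normalized_at X k z\<^sub>0 \<longleftrightarrow>
     z\<^sub>0 \<in> X \<and> (\<forall>z\<in>X. k z z\<^sub>0 = 1) \<and>
     (\<exists>u. positive_definite_on X u \<and>
          (\<forall>z\<in>X. \<forall>w\<in>X. u z w \<noteq> 1 \<and> k z w = 1 / (1 - u z w)))"

definition dsum :: "('x \<Rightarrow> complex) set \<Rightarrow> 'x ip \<Rightarrow> (nat \<Rightarrow> 'x \<Rightarrow> complex) set" where
  "dsum H ip = {h. (\<forall>n. h n \<in> H) \<and> summable (\<lambda>n. (hnorm ip (h n))\<^sup>2)}"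

definition dsum_norm :: "'x ip \<Rightarrow> (nat \<Rightarrow> 'x \<Rightarrow> complex) \<Rightarrow> real" where
  "dsum_norm ip h = sqrt (\<Sum>n. (hnorm ip (h n))\<^sup>2)"

definition column_op ::
    "(nat \<Rightarrow> 'x \<Rightarrow> complex) \<Rightarrow> ('x \<Rightarrow> complex) \<Rightarrow> nat \<Rightarrow> 'x \<Rightarrow> complex" where
  "column_op \<Phi> h = (\<lambda>n. \<Phi> n * h)"

definition M_C :: "'x set \<Rightarrow> ('x \<Rightarrow> complex) set \<Rightarrow> 'x ip \<Rightarrow> (nat \<Rightarrow> 'x \<Rightarrow> complex) set" where
  "M_C X H ip = {\<Phi>. (\<forall>n. \<Phi> n \<in> Mult X H) \<and> (\<forall>h\<in>H. column_op \<Phi> h \<in> dsum H ip) \<and>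
     (\<exists>C. \<forall>h\<in>H. dsum_norm ip (column_op \<Phi> h) \<le> C * hnorm ip h)}"

text \<open>The series defining the row operator is required to converge in the norm of \<open>H\<close>.\<close>

definition row_op_value ::
    "('x \<Rightarrow> complex) set \<Rightarrow> 'x ip \<Rightarrow> (nat \<Rightarrow> 'x \<Rightarrow> complex) \<Rightarrow> (nat \<Rightarrow> 'x \<Rightarrow> complex) \<Rightarrow>
      ('x \<Rightarrow> complex) \<Rightarrow> bool" where
  "row_op_value H ip \<Phi> h g \<longleftrightarrow> g \<in> H \<and> hlim ip (\<lambda>N. \<Sum>i<N. \<Phi> i * h i) g"

definition M_R :: "'x set \<Rightarrow> ('x \<Rightarrow> complex) set \<Rightarrow> 'x ip \<Rightarrow> (nat \<Rightarrow> 'x \<Rightarrow> complex) set" where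
  "M_R X H ip = {\<Phi>. (\<forall>n. \<Phi> n \<in> Mult X H) \<and>
     (\<exists>C. \<forall>h\<in>dsum H ip. \<exists>g. row_op_value H ip \<Phi> h g \<and> hnorm ip g \<le> C * dsum_norm ip h)}"

definition conj_space :: "('x \<Rightarrow> complex) set \<Rightarrow> ('x \<Rightarrow> complex) set" where
  "conj_space H = (\<lambda>f. cnj \<circ> f) ` H"

definition conj_ip :: "'x ip \<Rightarrow> 'x ip" where
  "conj_ip ip F G = ip (cnj \<circ> G) (cnj \<circ> F)"

text \<open>
  Operators are extensional on \<open>H\<close>, so that two operators that agree on \<open>H\<close> are equal.
\<close>

definition bounded_ops_to_conj ::
    "('x \<Rightarrow> complex) set \<Rightarrow> 'x ip \<Rightarrow> (('x \<Rightarrow> complex) \<Rightarrow> 'x \<Rightarrow> complex) set" where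
  "bounded_ops_to_conj H ip = {T \<in> H \<rightarrow>\<^sub>E conj_space H.
     (\<forall>f\<in>H. \<forall>g\<in>H. T (f + g) = T f + T g) \<and>
     (\<forall>c. \<forall>f\<in>H. T (cscale c f) = cscale c (T f)) \<and>
     (\<exists>C. \<forall>f\<in>H. hnorm (conj_ip ip) (T f) \<le> C * hnorm ip f)}"

definition ker_rho_perp ::
    "'x set \<Rightarrow> ('x \<Rightarrow> complex) set \<Rightarrow> 'x ip \<Rightarrow> (('x \<Rightarrow> complex) \<Rightarrow> 'x \<Rightarrow> complex) set" where
  "ker_rho_perp X H ip = {T \<in> bounded_ops_to_conj H ip.
     \<forall>f g. (\<forall>n::nat. f n \<in> H \<and> g n \<in> H) \<and>
       summable (\<lambda>n. hnorm ip (f n) * hnorm ip (g n)) \<and>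
       (\<forall>z\<in>X. (\<lambda>n. f n z * g n z) sums 0) \<longrightarrow>
       (\<lambda>n. ip (g n) (cnj \<circ> T (f n))) sums 0}"

definition Han :: "'x set \<Rightarrow> ('x \<Rightarrow> complex) set \<Rightarrow> 'x ip \<Rightarrow> ('x \<Rightarrow> complex) set" where
  "Han X H ip = {cnj \<circ> T (indicator X) | T. T \<in> ker_rho_perp X H ip}"

definition hankel ::
    "'x set \<Rightarrow> ('x \<Rightarrow> complex) set \<Rightarrow> 'x ip \<Rightarrow> ('x \<Rightarrow> complex) \<Rightarrow> ('x \<Rightarrow> complex) \<Rightarrow> 'x \<Rightarrow> complex"
  where
  "hankel X H ip b = (THE T. T \<in> ker_rho_perp X H ip \<and> T (indicator X) = cnj \<circ> b)"

definition hankel_ker ::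
    "'x set \<Rightarrow> ('x \<Rightarrow> complex) set \<Rightarrow> 'x ip \<Rightarrow> ('x \<Rightarrow> complex) \<Rightarrow> ('x \<Rightarrow> complex) set" where
  "hankel_ker X H ip b = {f \<in> H. hankel X H ip b f = 0}"

end

theory Submission
  imports Defs
begin

text \<open>
  The dual of the weak product \<open>H \<odot> H\<close> consists of the Hankel operators, so by Hahn-Banach it suffices
  that every \<open>f \<in> H\<close> in the closure of \<open>M \<odot> H\<close> inside \<open>H \<odot> H\<close> already lies in \<open>M\<close>. Suppose
  \<open>f = \<Sum>n. a n * b n\<close>, where the terms with \<open>b n \<notin> M\<close> have small total cost, balanced so that the
  column \<open>a\<close> has small norm. The complete Pick property yields a multiplier \<open>\<theta>\<close> close to \<open>1\<close> for
  which \<open>\<theta> * a n\<close> is a contractive column of multipliers. By \<open>M_C \<subseteq> M_R\<close> it is a bounded row, hence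
  \<open>\<theta> * f = \<Sum>n. (\<theta> * a n) * b n\<close> is close to \<open>M\<close>; and \<open>\<theta> * f\<close> tends weakly to \<open>f\<close>.
\<close>

section \<open>Hilbert spaces of functions\<close>

text \<open>The obstacle is that the single products \<open>a n * b n\<close> need not lie in
  \<open>H\<close>, so the invariance of \<open>M\<close> cannot be applied to a representation of
  \<open>f\<close> term by term. The factor \<open>\<theta>\<close> removes it:
  \<open>\<theta> * a n\<close> is a multiplier, hence \<open>\<theta> * a n * b n\<close> lies in
  \<open>M\<close> whenever \<open>b n\<close> does. A row bound is what is required because the
  products are summed; it involves only the square sum of the second factors, so the few costly
  terms outside \<open>M\<close> contribute little. Smallness of the column \<open>a\<close> pushes
  \<open>\<theta>\<close> to 1, and rescaling the pairs achieves it at the price of large second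
  factors inside \<open>M\<close>, which do no harm. Sarason functions are handled as multipliers
  for finite combinations of kernels, so the \<open>a n\<close> are replaced by such combinations
  and the series is truncated; the resulting error is controlled weakly, not in norm. Separability
  makes the family of symbols countable: a functional norming one vector \<open>d\<close> for the
  quotient seminorm also controls the vectors near \<open>d\<close>, so a countable dense set of
  \<open>d\<close> suffices.\<close>

context hilbert_function_space
begin

section \<open>Algebra of the inner product and the norm\<close>

lemma mem_closed [simp, intro]:
  "0 \<in> H"
  "f \<in> H \<Longrightarrow> g \<in> H \<Longrightarrow> f + g \<in> H"
  "f \<in> H \<Longrightarrow> g \<in> H \<Longrightarrow> f - g \<in> H"
  "f \<in> H \<Longrightarrow> cscale c f \<in> H"
  "f \<in> H \<Longrightarrow> - f \<in> H"
  using subspace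
  by (simp_all add: cfun.subspace_0 cfun.subspace_add cfun.subspace_diff cfun.subspace_scale
      cfun.subspace_neg)

lemma sum_mem [simp, intro]: "(\<And>i. i \<in> A \<Longrightarrow> f i \<in> H) \<Longrightarrow> sum f A \<in> H"
  by (rule cfun.subspace_sum[OF subspace])

lemma ip_zero_left [simp]: "g \<in> H \<Longrightarrow> ip 0 g = 0"
  using ip_add_left[of 0 0 g] by simp

lemma ip_diff_left: "\<lbrakk>f \<in> H; g \<in> H; h \<in> H\<rbrakk> \<Longrightarrow> ip (f - g) h = ip f h - ip g h"
  using ip_add_left[of "f - g" g h] by simp

lemma ip_sum_left:
  assumes "\<And>i. i \<in> A \<Longrightarrow> f i \<in> H" "g \<in> H"
  shows "ip (sum f A) g = (\<Sum>i\<in>A. ip (f i) g)"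
  using assms(1) by (induction A rule: infinite_finite_induct) (simp_all add: assms(2) ip_add_left)

lemma ip_add_right: "\<lbrakk>f \<in> H; g \<in> H; h \<in> H\<rbrakk> \<Longrightarrow> ip h (f + g) = ip h f + ip h g"
  using ip_commute[of "f + g" h] ip_commute[of f h] ip_commute[of g h] ip_add_left[of f g h]
  by simp

lemma ip_diff_right: "\<lbrakk>f \<in> H; g \<in> H; h \<in> H\<rbrakk> \<Longrightarrow> ip h (f - g) = ip h f - ip h g"
  using ip_commute[of "f - g" h] ip_commute[of f h] ip_commute[of g h] ip_diff_left[of f g h]
  by simp

lemma ip_scale_right: "\<lbrakk>f \<in> H; g \<in> H\<rbrakk> \<Longrightarrow> ip f (cscale c g) = cnj c * ip f g"
  using ip_commute[of "cscale c g" f] ip_commute[of g f] ip_scale_left[of g f c] by simp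

lemma ip_zero_right [simp]: "g \<in> H \<Longrightarrow> ip g 0 = 0"
  using ip_commute[of 0 g] by simp

lemma ip_sum_right:
  assumes "\<And>i. i \<in> A \<Longrightarrow> f i \<in> H" "g \<in> H"
  shows "ip g (sum f A) = (\<Sum>i\<in>A. ip g (f i))"
  using assms(1) by (induction A rule: infinite_finite_induct) (simp_all add: assms(2) ip_add_right)

lemma hnorm_nonneg [simp]: "f \<in> H \<Longrightarrow> 0 \<le> hnorm ip f"
  by (simp add: hnorm_def ip_nonneg)

lemma hnorm_sq: "f \<in> H \<Longrightarrow> (hnorm ip f)\<^sup>2 = Re (ip f f)"
  by (simp add: hnorm_def ip_nonneg)

lemma ip_self: "f \<in> H \<Longrightarrow> ip f f = of_real ((hnorm ip f)\<^sup>2)"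
  using ip_commute[of f f] by (simp add: hnorm_sq complex_eq_iff)

lemma hnorm_zero [simp]: "hnorm ip 0 = 0"
  by (simp add: hnorm_def)

lemma hnorm_eq_0: "f \<in> H \<Longrightarrow> hnorm ip f = 0 \<longleftrightarrow> f = 0"
  using ip_self[of f] ip_definite[of f] by auto

lemma hnorm_scale [simp]: "f \<in> H \<Longrightarrow> hnorm ip (cscale c f) = cmod c * hnorm ip f"
proof -
  assume f: "f \<in> H"
  have "ip (cscale c f) (cscale c f) = c * cnj c * ip f f"
    using f by (simp add: ip_scale_left ip_scale_right)
  also have "\<dots> = of_real ((cmod c)\<^sup>2 * (hnorm ip f)\<^sup>2)"
    by (simp only: ip_self[OF f] of_real_mult complex_norm_square)
  finally have "(hnorm ip (cscale c f))\<^sup>2 = (cmod c * hnorm ip f)\<^sup>2"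
    using f by (simp only: hnorm_sq mem_closed Re_complex_of_real power_mult_distrib)
  then show ?thesis using f by (simp add: power2_eq_iff_nonneg)
qed

lemma hnorm_add_sq:
  "\<lbrakk>f \<in> H; g \<in> H\<rbrakk> \<Longrightarrow> (hnorm ip (f + g))\<^sup>2 = (hnorm ip f)\<^sup>2 + (hnorm ip g)\<^sup>2 + 2 * Re (ip f g)"
  using ip_commute[of f g] by (simp add: hnorm_sq ip_add_left ip_add_right)

lemma hnorm_diff_sq:
  "\<lbrakk>f \<in> H; g \<in> H\<rbrakk> \<Longrightarrow> (hnorm ip (f - g))\<^sup>2 = (hnorm ip f)\<^sup>2 + (hnorm ip g)\<^sup>2 - 2 * Re (ip f g)"
  using ip_commute[of f g] by (simp add: hnorm_sq ip_diff_left ip_diff_right)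

lemma cauchy_schwarz:
  assumes f: "f \<in> H" and g: "g \<in> H"
  shows "cmod (ip f g) \<le> hnorm ip f * hnorm ip g"
proof (cases "g = 0")
  case True
  then show ?thesis using f by simp
next
  case False
  define N where "N = (hnorm ip g)\<^sup>2"
  have N: "N > 0" using False g hnorm_eq_0 N_def by auto
  define c where "c = ip f g / of_real N"
  have "0 \<le> (hnorm ip (f - cscale c g))\<^sup>2" by simp
  also have "\<dots> = (hnorm ip f)\<^sup>2 + (cmod c)\<^sup>2 * N - 2 * Re (cnj c * ip f g)"
    using f g by (simp add: hnorm_diff_sq ip_scale_right N_def power_mult_distrib)
  also have "cnj c * ip f g = of_real ((cmod (ip f g))\<^sup>2 / N)"
    by (simp only: of_real_divide complex_norm_square) (simp add: c_def)
  also have "(cmod c)\<^sup>2 * N = (cmod (ip f g))\<^sup>2 / N"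
    using N by (simp add: c_def norm_divide power_divide power2_eq_square field_simps)
  finally have "(cmod (ip f g))\<^sup>2 / N \<le> (hnorm ip f)\<^sup>2" by simp
  then have "(cmod (ip f g))\<^sup>2 \<le> (hnorm ip f * hnorm ip g)\<^sup>2"
    using N by (simp add: field_simps N_def power_mult_distrib)
  then show ?thesis using f g by (simp add: power2_le_iff_abs_le)
qed

lemma Re_ip_le: "\<lbrakk>f \<in> H; g \<in> H\<rbrakk> \<Longrightarrow> Re (ip f g) \<le> hnorm ip f * hnorm ip g"
  using cauchy_schwarz complex_Re_le_cmod order_trans by blast

lemma hnorm_triangle:
  assumes f: "f \<in> H" and g: "g \<in> H"
  shows "hnorm ip (f + g) \<le> hnorm ip f + hnorm ip g"
proof -
  have "(hnorm ip (f + g))\<^sup>2 \<le> (hnorm ip f + hnorm ip g)\<^sup>2"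
    using Re_ip_le[OF f g] f g by (simp add: hnorm_add_sq power2_sum)
  then show ?thesis using f g by (simp add: power2_le_iff_abs_le)
qed

lemma hnorm_minus [simp]: "f \<in> H \<Longrightarrow> hnorm ip (- f) = hnorm ip f"
  using hnorm_scale[of f "-1"] by (simp add: cscale_def fun_Compl_def)

lemma hnorm_minus_commute: "\<lbrakk>f \<in> H; g \<in> H\<rbrakk> \<Longrightarrow> hnorm ip (f - g) = hnorm ip (g - f)"
  using hnorm_minus[of "f - g"] by simp

lemma hnorm_triangle_diff:
  "\<lbrakk>f \<in> H; g \<in> H\<rbrakk> \<Longrightarrow> hnorm ip (f - g) \<le> hnorm ip f + hnorm ip g"
  using hnorm_triangle[of f "- g"] by simp

lemma hnorm_reverse_triangle:
  assumes "f \<in> H" "g \<in> H"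
  shows "\<bar>hnorm ip f - hnorm ip g\<bar> \<le> hnorm ip (f - g)"
  using hnorm_triangle[of "f - g" g] hnorm_triangle[of "g - f" f] hnorm_minus_commute[of f g] assms
  by simp

section \<open>Norm limits and vectors representing bounded functionals\<close>

lemma hlim_ip:
  assumes "\<And>n. F n \<in> H" "y \<in> H" "hlim ip F y" "x \<in> H"
  shows "(\<lambda>n. ip (F n) x) \<longlonglongrightarrow> ip y x"
proof -
  have "(\<lambda>n. hnorm ip (F n - y) * hnorm ip x) \<longlonglongrightarrow> 0"
    using assms(3) tendsto_mult_left_zero unfolding hlim_def by blast
  then have "(\<lambda>n. ip (F n) x - ip y x) \<longlonglongrightarrow> 0"
    by (rule Lim_null_comparison[rotated])
      (use assms cauchy_schwarz in \<open>auto simp flip: ip_diff_left\<close>)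
  then show ?thesis by (simp add: LIM_zero_iff)
qed

lemma hlim_hnorm:
  assumes "\<And>n. F n \<in> H" "y \<in> H" "hlim ip F y"
  shows "(\<lambda>n. hnorm ip (F n)) \<longlonglongrightarrow> hnorm ip y"
proof -
  have "(\<lambda>n. hnorm ip (F n) - hnorm ip y) \<longlonglongrightarrow> 0"
    by (rule Lim_null_comparison[OF _ assms(3)[unfolded hlim_def]])
      (use assms hnorm_reverse_triangle in auto)
  then show ?thesis by (simp add: LIM_zero_iff)
qed

text \<open>
  The functional is given by its graph, on a subspace that need not be closed; the representing
  vector minimises \<open>\<parallel>x\<parallel>\<^sup>2 - 2 Re v\<close> over the graph. Taking \<open>v = ip x f\<close> yields orthogonal
  projections as well.
\<close>

lemma riesz_graph:
  assumes dom: "\<And>x v. (x, v) \<in> G \<Longrightarrow> x \<in> H"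
    and zero: "(0, 0) \<in> G"
    and add: "\<And>x v y w. \<lbrakk>(x, v) \<in> G; (y, w) \<in> G\<rbrakk> \<Longrightarrow> (x + y, v + w) \<in> G"
    and scale: "\<And>x v c. (x, v) \<in> G \<Longrightarrow> (cscale c x, c * v) \<in> G"
    and bound: "\<And>x v. (x, v) \<in> G \<Longrightarrow> cmod v \<le> C * hnorm ip x"
    and C: "0 \<le> C"
  obtains y F where "y \<in> H" "\<And>n. F n \<in> fst ` G" "hlim ip F y"
    "\<And>x v. (x, v) \<in> G \<Longrightarrow> v = ip x y" "hnorm ip y \<le> C"
proof -
  \<comment> \<open>If \<open>v = ip x y\<close>, this is the squared distance from \<open>x\<close>
    to \<open>y\<close> minus the squared norm of \<open>y\<close>, so minimising sequences converge
    to the representing vector.\<close>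
  define J where "J = (\<lambda>(x, v). (hnorm ip x)\<^sup>2 - 2 * Re v)"
  have J_ge: "- (C\<^sup>2) \<le> J q" if "q \<in> G" for q
  proof -
    obtain x v where q: "q = (x, v)" by force
    have "Re v \<le> C * hnorm ip x"
      using bound that q complex_Re_le_cmod order_trans by blast
    moreover have "0 \<le> (hnorm ip x - C)\<^sup>2" by simp
    ultimately show ?thesis by (simp add: J_def q power2_diff algebra_simps)
  qed
  define m where "m = Inf (J ` G)"
  have bdd: "bdd_below (J ` G)" using J_ge by (auto intro!: bdd_belowI)
  have m_le: "m \<le> J q" if "q \<in> G" for q
    unfolding m_def by (rule cInf_lower) (use bdd that in auto)
  have "\<exists>q\<in>G. J q < m + 1 / (real n + 1)" for n :: nat
  proof -
    have "\<exists>r\<in>J ` G. r < m + 1 / (real n + 1)"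
      by (rule cInf_lessD) (use zero in \<open>auto simp: m_def\<close>)
    then show ?thesis by auto
  qed
  then obtain P where P: "\<And>n. P n \<in> G" "\<And>n. J (P n) < m + 1 / (real n + 1)" by metis
  define F where "F n = fst (P n)" for n
  define V where "V n = snd (P n)" for n
  have FV: "(F n, V n) \<in> G" for n using P(1)[of n] by (simp add: F_def V_def)
  have JF: "(hnorm ip (F n))\<^sup>2 - 2 * Re (V n) < m + 1 / (real n + 1)" for n
    using P(2)[of n] by (simp add: J_def F_def V_def case_prod_unfold)
  have FH [simp]: "F n \<in> H" for n using FV dom by blast
  have close: "(hnorm ip (F i - F j))\<^sup>2 \<le> 2 / (real i + 1) + 2 / (real j + 1)" for i j
  proof -
    \<comment> \<open>The midpoint lies on the graph again; comparing its value with the infimum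
      through the parallelogram law makes the minimising sequence Cauchy.\<close>
    have "m \<le> J (cscale (1/2) (F i + F j), (1/2) * (V i + V j))"
      by (intro m_le scale add FV)
    then have "m \<le> (hnorm ip (F i + F j))\<^sup>2 / 4 - (Re (V i) + Re (V j))"
      by (simp add: J_def power_divide add_divide_distrib)
    moreover have "(hnorm ip (F i + F j))\<^sup>2 + (hnorm ip (F i - F j))\<^sup>2
        = 2 * (hnorm ip (F i))\<^sup>2 + 2 * (hnorm ip (F j))\<^sup>2"
      by (simp add: hnorm_add_sq hnorm_diff_sq)
    ultimately have "(hnorm ip (F i - F j))\<^sup>2 \<le> 2 * (1 / (real i + 1)) + 2 * (1 / (real j + 1))"
      using JF[of i] JF[of j] by linarith
    then show ?thesis by simp
  qed
  have "hCauchy ip F"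
    unfolding hCauchy_def
  proof (intro allI impI)
    fix e :: real assume e: "e > 0"
    obtain N :: nat where N: "4 / e\<^sup>2 < real N" using reals_Archimedean2 by blast
    have "hnorm ip (F i - F j) < e" if "i \<ge> N" "j \<ge> N" for i j
    proof -
      have "4 < e\<^sup>2 * real N" using N e by (simp add: pos_divide_less_eq mult.commute)
      also have "\<dots> \<le> e\<^sup>2 * (real N + 1)" by (intro mult_left_mono) auto
      finally have "4 / (real N + 1) < e\<^sup>2" by (simp add: pos_divide_less_eq)
      moreover have "2 / (real i + 1) \<le> 2 / (real N + 1)" "2 / (real j + 1) \<le> 2 / (real N + 1)"
        using that by (auto intro!: divide_left_mono)
      ultimately have "(hnorm ip (F i - F j))\<^sup>2 < e\<^sup>2" using close[of i j] by linarith
      then show ?thesis using e power_less_imp_less_base less_imp_le by blast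
    qed
    then show "\<exists>N. \<forall>m\<ge>N. \<forall>n\<ge>N. hnorm ip (F m - F n) < e" by blast
  qed
  then obtain y where y: "y \<in> H" "hlim ip F y" using complete FH by blast
  have Re_eq: "Re v = Re (ip x y)" if G: "(x, v) \<in> G" for x v
  proof -
    have x: "x \<in> H" using G dom by blast
    define d where "d = Re (ip x y) - Re v"
    define q where "q = (hnorm ip x)\<^sup>2"
    have ineq: "0 \<le> 2 * t * d + t\<^sup>2 * q" for t :: real
    proof -
      \<comment> \<open>First variation at the minimum. As \<open>y\<close> may lie outside the
        domain of the graph, the members of the minimising sequence are varied and the limit is
        taken afterwards.\<close>
      have "m \<le> J (F n + cscale (of_real t) x, V n + of_real t * v)" for n
        by (intro m_le scale add FV G)
      then have *: "m \<le> (hnorm ip (F n))\<^sup>2 + t\<^sup>2 * q + 2 * (t * Re (ip (F n) x)) - 2 * (Re (V n) + t * Re v)"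
        for n
        using x by (simp add: J_def hnorm_add_sq ip_scale_right q_def power_mult_distrib)
      have "0 \<le> 1 / (real n + 1) + (t\<^sup>2 * q + 2 * t * (Re (ip (F n) x) - Re v))" for n
        using JF[of n] *[of n] by (simp add: right_diff_distrib mult.assoc)
      moreover have "(\<lambda>n. 1 / (real n + 1) + (t\<^sup>2 * q + 2 * t * (Re (ip (F n) x) - Re v)))
          \<longlonglongrightarrow> 0 + (t\<^sup>2 * q + 2 * t * (Re (ip y x) - Re v))"
        by (intro tendsto_intros hlim_ip x y FH)
          (use LIMSEQ_inverse_real_of_nat in \<open>simp add: inverse_eq_divide add.commute\<close>)
      ultimately have "0 \<le> 0 + (t\<^sup>2 * q + 2 * t * (Re (ip y x) - Re v))"
        by (intro LIMSEQ_le_const) auto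
      then show ?thesis using ip_commute[of x y] x y by (simp add: d_def)
    qed
    have q: "q \<ge> 0" by (simp add: q_def)
    \<comment> \<open>The choice \<open>t = - r\<close> gives
      \<open>- (r * r) * (q + 2) \<ge> 0\<close>; the summand 1 keeps the denominator positive when
      \<open>x\<close> is zero.\<close>
    define r where "r = d / (q + 1)"
    have d: "d = r * (q + 1)" using q by (simp add: r_def)
    have "r\<^sup>2 * (q + 2) \<le> 0"
      using ineq[of "- r"] by (simp add: d algebra_simps power2_eq_square)
    then have "d = 0" using q d by (auto simp: mult_le_0_iff)
    then show ?thesis by (simp add: d_def)
  qed
  have eq: "v = ip x y" if G: "(x, v) \<in> G" for x v
  proof (rule complex_eqI)
    show "Re v = Re (ip x y)" using Re_eq G .
    have "x \<in> H" using G dom by blast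
    then show "Im v = Im (ip x y)" using Re_eq[OF scale[OF G, of \<i>]] y by (simp add: ip_scale_left)
  qed
  have "hnorm ip y \<le> C"
  proof -
    have "cmod (ip (F n) y) \<le> C * hnorm ip (F n)" for n
      using bound[OF FV] eq[OF FV] by simp
    moreover have "(\<lambda>n. cmod (ip (F n) y)) \<longlonglongrightarrow> cmod (ip y y)"
      by (intro tendsto_norm hlim_ip y FH)
    moreover have "(\<lambda>n. C * hnorm ip (F n)) \<longlonglongrightarrow> C * hnorm ip y"
      by (intro tendsto_mult tendsto_const hlim_hnorm y FH)
    ultimately have "cmod (ip y y) \<le> C * hnorm ip y"
      by (meson LIMSEQ_le)
    then have "hnorm ip y * hnorm ip y \<le> C * hnorm ip y"
      using y by (simp add: ip_self power2_eq_square norm_mult)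
    then show ?thesis using y C by (cases "hnorm ip y = 0") (auto simp: mult_le_cancel_right)
  qed
  moreover have "F n \<in> fst ` G" for n using FV[of n] by force
  ultimately show ?thesis using that y eq by blast
qed

text \<open>The minimising sequence delivered by \<open>riesz_graph\<close> stays in the domain
  \<open>S\<close>, so closedness of \<open>S\<close> catches its limit.\<close>

lemma orthogonal_projection:
  assumes S: "cfun.subspace S" "S \<subseteq> H" "hclosed H ip S" and f: "f \<in> H"
  obtains y where "y \<in> S" "\<And>x. x \<in> S \<Longrightarrow> ip x (f - y) = 0"
proof -
  define G where "G = (\<lambda>x. (x, ip x f)) ` S"
  have G: "(x, v) \<in> G \<longleftrightarrow> x \<in> S \<and> v = ip x f" for x v by (auto simp: G_def)
  obtain y F where "y \<in> H" "\<And>n. F n \<in> fst ` G" "hlim ip F y"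
    "\<And>x v. (x, v) \<in> G \<Longrightarrow> v = ip x y"
  proof (rule riesz_graph[of G "hnorm ip f"])
    show "cmod v \<le> hnorm ip f * hnorm ip x" if "(x, v) \<in> G" for x v
      using cauchy_schwarz[of x f] that S f by (auto simp: G mult.commute)
  qed (use S f in \<open>auto simp: G cfun.subspace_0 cfun.subspace_add cfun.subspace_scale
        ip_add_left ip_scale_left subset_iff\<close>)
  moreover have "fst ` G = S" by (force simp: G_def)
  ultimately obtain y F where y: "y \<in> H" "\<And>n. F n \<in> S" "hlim ip F y" "\<And>x. x \<in> S \<Longrightarrow> ip x f = ip x y"
 using G
    by metis
  then have "y \<in> S" using S(3) unfolding hclosed_def by blast
  then show ?thesis using that y S f by (auto simp: ip_diff_right subset_iff)
qed

end

section \<open>Positive semidefinite kernels\<close>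

text \<open>The minimum over \<open>t\<close> is attained at \<open>t = - \<beta> / b\<close>; this
  is the Schur complement inequality for a pivot \<open>b\<close>. For \<open>b = 0\<close> an
  expression affine in \<open>t\<close> stays nonnegative only if its linear term vanishes.\<close>

lemma scaled_square_minimum:
  fixes \<beta> :: complex and b S :: real
  assumes "\<And>t. 0 \<le> S + 2 * Re (t * cnj \<beta>) + (cmod t)\<^sup>2 * b"
  shows "(cmod \<beta>)\<^sup>2 / b \<le> S" "b = 0 \<Longrightarrow> \<beta> = 0"
proof -
  have sq: "\<beta> * cnj \<beta> = of_real ((cmod \<beta>)\<^sup>2)"
    by (simp only: complex_norm_square)
  have t: "0 \<le> S + 2 * (r * (cmod \<beta>)\<^sup>2) + r\<^sup>2 * (cmod \<beta>)\<^sup>2 * b" for r :: real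
  proof -
    have "of_real r * \<beta> * cnj \<beta> = of_real (r * (cmod \<beta>)\<^sup>2)"
      by (simp only: mult.assoc sq of_real_mult)
    then show ?thesis
      using assms[of "of_real r * \<beta>"]
      by (simp only: Re_complex_of_real norm_mult norm_of_real power_mult_distrib power2_abs)
  qed
  show *: "\<beta> = 0" if "b = 0"
  proof (rule ccontr)
    assume "\<beta> \<noteq> 0"
    \<comment> \<open>This real multiple of \<open>\<beta>\<close> gives the value
      \<open>S - 2 * (\<bar>S\<bar> + 1)\<close>, which is negative.\<close>
    then show False using t[of "- (\<bar>S\<bar> + 1) / (cmod \<beta>)\<^sup>2"] that by simp
  qed
  show "(cmod \<beta>)\<^sup>2 / b \<le> S"
  proof (cases "b = 0")
    case False
    then have "(- 1 / b)\<^sup>2 * (cmod \<beta>)\<^sup>2 * b = (cmod \<beta>)\<^sup>2 / b"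
      by (simp add: power2_eq_square)
    then show ?thesis using t[of "- 1 / b"] by simp
  qed (use t[of 0] in simp)
qed

text \<open>A Cholesky factorisation; a vanishing pivot is harmless because its row vanishes too.\<close>

lemma psd_decomposition:
  fixes B :: "'i \<Rightarrow> 'i \<Rightarrow> complex"
  assumes "finite A"
    and "\<And>z w. \<lbrakk>z \<in> A; w \<in> A\<rbrakk> \<Longrightarrow> B w z = cnj (B z w)"
    and "\<And>c. 0 \<le> Re (\<Sum>z\<in>A. \<Sum>w\<in>A. c z * cnj (c w) * B z w)"
  shows "\<exists>(n::nat) v. \<forall>z\<in>A. \<forall>w\<in>A. B z w = (\<Sum>r<n. v r z * cnj (v r w))"
  using assms
proof (induction A arbitrary: B rule: finite_induct)
  case empty
  then show ?case by simp
next
  case (insert x A)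
  note herm = insert.prems(1)
  define b where "b = Re (B x x)"
  have bx: "B x x = of_real b"
    using herm[of x x] by (simp add: b_def complex_eq_iff)
  have expand: "0 \<le> Re (\<Sum>z\<in>A. \<Sum>w\<in>A. c z * cnj (c w) * B z w)
      + 2 * Re (t * cnj (\<Sum>z\<in>A. c z * B z x)) + (cmod t)\<^sup>2 * b" for c t
  proof -
    let ?c = "c(x := t)"
    let ?\<beta> = "\<Sum>z\<in>A. c z * B z x"
    have row: "(\<Sum>w\<in>A. cnj (c w) * B x w) = cnj ?\<beta>"
      unfolding cnj_sum
    proof (rule sum.cong)
      fix w assume "w \<in> A"
      then have "B x w = cnj (B w x)" by (intro herm) auto
      then show "cnj (c w) * B x w = cnj (c w * B w x)" by (simp only: complex_cnj_mult)
    qed simp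
    have "(\<Sum>z\<in>insert x A. \<Sum>w\<in>insert x A. ?c z * cnj (?c w) * B z w)
        = t * cnj t * B x x + (\<Sum>w\<in>A. t * cnj (?c w) * B x w)
          + (\<Sum>z\<in>A. ?c z * cnj t * B z x + (\<Sum>w\<in>A. ?c z * cnj (?c w) * B z w))"
      using insert.hyps by simp
    also have "(\<Sum>w\<in>A. t * cnj (?c w) * B x w) = t * cnj ?\<beta>"
      unfolding row[symmetric] sum_distrib_left using insert.hyps by (auto intro!: sum.cong)
    also have "(\<Sum>z\<in>A. ?c z * cnj t * B z x + (\<Sum>w\<in>A. ?c z * cnj (?c w) * B z w))
        = cnj t * ?\<beta> + (\<Sum>z\<in>A. \<Sum>w\<in>A. c z * cnj (c w) * B z w)"
      unfolding sum.distrib sum_distrib_left using insert.hyps by (auto intro!: sum.cong arg_cong2[of _ _ _ _ "(+)"])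
    also have "t * cnj t * B x x = of_real ((cmod t)\<^sup>2 * b)"
      unfolding bx by (simp only: complex_norm_square of_real_mult)
    finally have "Re (\<Sum>z\<in>insert x A. \<Sum>w\<in>insert x A. ?c z * cnj (?c w) * B z w)
        = (cmod t)\<^sup>2 * b + Re (t * cnj ?\<beta>)
          + (Re (cnj t * ?\<beta>) + Re (\<Sum>z\<in>A. \<Sum>w\<in>A. c z * cnj (c w) * B z w))"
      by (simp only: plus_complex.sel Re_complex_of_real)
    moreover have "Re (cnj t * ?\<beta>) = Re (t * cnj ?\<beta>)"
      by (simp only: times_complex.sel cnj.sel minus_mult_minus mult_minus_left mult_minus_right)
    ultimately show ?thesis using insert.prems(2)[of ?c] by linarith
  qed
  define s where "s z = B z x / of_real (sqrt b)" for z
  have "0 \<le> b" using expand[of "\<lambda>_. 0" 1] by simp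
  then have sb: "of_real (sqrt b) * of_real (sqrt b) = (of_real b :: complex)"
    by (simp flip: of_real_mult)
  have null: "B z x = 0" if "z \<in> A" "b = 0" for z
  proof -
    have "(\<Sum>y\<in>A. (if y = z then 1 else 0) * B y x) = 0"
      by (rule scaled_square_minimum(2)[OF expand \<open>b = 0\<close>])
    then show ?thesis using that insert.hyps by (simp add: if_distrib[of "\<lambda>a. a * _"] cong: if_cong)
  qed
  \<comment> \<open>The Schur complement: its quadratic form is the minimum of the form of
    \<open>B\<close> over the coefficient at \<open>x\<close>, hence still nonnegative.\<close>
  define B' where "B' z w = B z w - s z * cnj (s w)" for z w
  have ss: "s z * cnj (s w) = B z x * cnj (B w x) / of_real b" for z w
    by (simp add: s_def sb)
  have "\<exists>(n::nat) v. \<forall>z\<in>A. \<forall>w\<in>A. B' z w = (\<Sum>r<n. v r z * cnj (v r w))"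
  proof (rule insert.IH)
    show "B' w z = cnj (B' z w)" if "z \<in> A" "w \<in> A" for z w
      using herm[of z w] that by (simp add: B'_def mult.commute)
  next
    fix c
    let ?\<beta> = "\<Sum>z\<in>A. c z * B z x"
    have "(\<Sum>z\<in>A. \<Sum>w\<in>A. c z * cnj (c w) * (s z * cnj (s w))) = ?\<beta> * cnj ?\<beta> / of_real b"
      by (simp add: ss sum_product sum_divide_distrib cnj_sum mult_ac)
    also have "\<dots> = of_real ((cmod ?\<beta>)\<^sup>2 / b)"
      by (simp only: complex_norm_square of_real_divide)
    finally have "Re (\<Sum>z\<in>A. \<Sum>w\<in>A. c z * cnj (c w) * B' z w)
        = Re (\<Sum>z\<in>A. \<Sum>w\<in>A. c z * cnj (c w) * B z w) - (cmod ?\<beta>)\<^sup>2 / b"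
      by (simp only: B'_def right_diff_distrib sum_subtractf minus_complex.sel Re_complex_of_real)
    then show "0 \<le> Re (\<Sum>z\<in>A. \<Sum>w\<in>A. c z * cnj (c w) * B' z w)"
      using scaled_square_minimum(1)[OF expand, of c] by simp
  qed
  then obtain n :: nat and v where v: "\<And>z w. \<lbrakk>z \<in> A; w \<in> A\<rbrakk> \<Longrightarrow> B' z w = (\<Sum>r<n. v r z * cnj (v r w))"
    by blast
  \<comment> \<open>The old vectors are set to 0 at \<open>x\<close>, so that the row and column of
    \<open>x\<close> come from the new vector \<open>s\<close> alone.\<close>
  define v' where "v' r z = (if r = n then s z else if z = x then 0 else v r z)" for r z
  have sx: "s z * cnj (s x) = B z x" if "z \<in> insert x A" for z
    using that null bx by (cases "b = 0") (auto simp: ss)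
  have "B z w = (\<Sum>r<Suc n. v' r z * cnj (v' r w))" if zw: "z \<in> insert x A" "w \<in> insert x A" for z w
  proof -
    consider "w = x" | "z = x" | "z \<in> A" "w \<in> A" "z \<noteq> x" "w \<noteq> x" using zw insert.hyps by auto
    then show ?thesis
    proof cases
      case 1
      then show ?thesis using sx zw by (simp add: v'_def)
    next
      case 2
      have "s x * cnj (s w) = cnj (B w x)" using sx[OF zw(2)] by (metis complex_cnj_cnj complex_cnj_mult mult.commute)
      then show ?thesis using 2 herm[of w x] zw by (simp add: v'_def)
    next
      case 3
      then show ?thesis using v[of z w] by (simp add: v'_def B'_def diff_eq_eq)
    qed
  qed
  then show ?case by blast
qed

text \<open>Index sets of two kernel combinations may overlap. Adding the vectors and adding the
  values prescribed on them must lead to the same family of coefficients, so both use this one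
  formula.\<close>

lemma sum_union_combination:
  fixes g :: "'i \<Rightarrow> complex \<Rightarrow> 'b::comm_monoid_add"
  assumes "finite A" "finite B"
    and add: "\<And>i a b. g i (a + b) = g i a + g i b" and zero: "\<And>i. g i 0 = 0"
  shows "(\<Sum>i\<in>A. g i (c i)) + (\<Sum>i\<in>B. g i (d i))
    = (\<Sum>i\<in>A \<union> B. g i ((if i \<in> A then c i else 0) + (if i \<in> B then d i else 0)))"
proof -
  have "(\<Sum>i\<in>A. g i (c i)) = (\<Sum>i\<in>A \<union> B. g i (if i \<in> A then c i else 0))"
    by (rule sum.mono_neutral_cong_left) (use assms in auto)
  moreover have "(\<Sum>i\<in>B. g i (d i)) = (\<Sum>i\<in>A \<union> B. g i (if i \<in> B then d i else 0))"
    by (rule sum.mono_neutral_cong_left) (use assms in auto)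
  ultimately show ?thesis by (simp add: add sum.distrib)
qed

context hilbert_function_space
begin

text \<open>The left side is a squared norm in the tensor product of \<open>n\<close>-dimensional
  space with \<open>H\<close>. Coordinates of \<open>u\<close> are available only on finite sets,
  with \<open>n\<close> depending on the set; the right side no longer mentions them.\<close>

lemma gram_decomposition:
  assumes u: "\<And>z w. \<lbrakk>z \<in> A; w \<in> A\<rbrakk> \<Longrightarrow> u z w = (\<Sum>r<n. v r z * cnj (v r w))"
    and x: "\<And>w. w \<in> A \<Longrightarrow> x w \<in> H"
  shows "(\<Sum>r<n. ip (\<Sum>w\<in>A. cscale (cnj (v r w)) (x w)) (\<Sum>w\<in>A. cscale (cnj (v r w)) (x w)))
    = (\<Sum>w\<in>A. \<Sum>z\<in>A. u z w * ip (x w) (x z))"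
proof -
  have "ip (\<Sum>w\<in>A. cscale (cnj (v r w)) (x w)) (\<Sum>w\<in>A. cscale (cnj (v r w)) (x w))
      = (\<Sum>w\<in>A. \<Sum>z\<in>A. v r z * cnj (v r w) * ip (x w) (x z))" for r
    using x by (simp add: ip_sum_left ip_sum_right ip_scale_left ip_scale_right sum_distrib_left mult_ac)
      (rule sum.swap)
  then have "(\<Sum>r<n. ip (\<Sum>w\<in>A. cscale (cnj (v r w)) (x w)) (\<Sum>w\<in>A. cscale (cnj (v r w)) (x w)))
      = (\<Sum>w\<in>A. \<Sum>r<n. \<Sum>z\<in>A. v r z * cnj (v r w) * ip (x w) (x z))"
    by (simp only:) (rule sum.swap)
  also have "\<dots> = (\<Sum>w\<in>A. \<Sum>z\<in>A. (\<Sum>r<n. v r z * cnj (v r w)) * ip (x w) (x z))"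
    unfolding sum_distrib_right by (intro sum.cong refl sum.swap)
  also have "\<dots> = (\<Sum>w\<in>A. \<Sum>z\<in>A. u z w * ip (x w) (x z))"
    using u by (auto intro!: sum.cong)
  finally show ?thesis .
qed

end

section \<open>Complete Pick kernels\<close>

context hilbert_function_space
begin

lemma gram_decomposition_Re:
  assumes u: "\<And>z w. \<lbrakk>z \<in> A; w \<in> A\<rbrakk> \<Longrightarrow> u z w = (\<Sum>r<n. v r z * cnj (v r w))"
    and x: "\<And>w. w \<in> A \<Longrightarrow> x w \<in> H"
  shows "(\<Sum>r<n. (hnorm ip (\<Sum>w\<in>A. cscale (cnj (v r w)) (x w)))\<^sup>2)
    = Re (\<Sum>w\<in>A. \<Sum>z\<in>A. u z w * ip (x w) (x z))"
proof -
  have "(\<Sum>w\<in>A. cscale (cnj (v r w)) (x w)) \<in> H" for r using x by auto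
  then have "(\<Sum>r<n. (hnorm ip (\<Sum>w\<in>A. cscale (cnj (v r w)) (x w)))\<^sup>2)
      = Re (\<Sum>r<n. ip (\<Sum>w\<in>A. cscale (cnj (v r w)) (x w)) (\<Sum>w\<in>A. cscale (cnj (v r w)) (x w)))"
    by (simp only: Re_sum hnorm_sq)
  also have "(\<Sum>r<n. ip (\<Sum>w\<in>A. cscale (cnj (v r w)) (x w)) (\<Sum>w\<in>A. cscale (cnj (v r w)) (x w)))
      = (\<Sum>w\<in>A. \<Sum>z\<in>A. u z w * ip (x w) (x z))"
    by (rule gram_decomposition) (use u x in auto)
  finally show ?thesis .
qed

end

locale complete_pick_space = hilbert_function_space X H ip
  for X :: "'x set" and H :: "('x \<Rightarrow> complex) set" and ip :: "'x ip" +
  fixes k u :: "'x \<Rightarrow> 'x \<Rightarrow> complex" and z\<^sub>0 :: 'x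
  assumes kernel: "reproducing_kernel X H ip k"
    and base: "z\<^sub>0 \<in> X" "z \<in> X \<Longrightarrow> k z z\<^sub>0 = 1"
    and u_positive: "positive_definite_on X u"
    and u_neq_1: "\<lbrakk>z \<in> X; w \<in> X\<rbrakk> \<Longrightarrow> u z w \<noteq> 1"
    and kernel_eq: "\<lbrakk>z \<in> X; w \<in> X\<rbrakk> \<Longrightarrow> k z w = 1 / (1 - u z w)"
begin

section \<open>Identities for a normalized complete Pick kernel\<close>

abbreviation K :: "'x \<Rightarrow> 'x \<Rightarrow> complex" where
  "K w \<equiv> (\<lambda>z. k z w)"

lemma kernel_mem [simp]: "w \<in> X \<Longrightarrow> K w \<in> H"
  using kernel by (simp add: reproducing_kernel_def)

lemma reproducing: "\<lbrakk>f \<in> H; w \<in> X\<rbrakk> \<Longrightarrow> ip f (K w) = f w"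
  using kernel by (simp add: reproducing_kernel_def)

lemma off_X: "\<lbrakk>f \<in> H; z \<notin> X\<rbrakk> \<Longrightarrow> f z = 0"
  using vanishes by (auto simp: vanishes_off_def)

lemma eqI_on_X: "\<lbrakk>f \<in> H; g \<in> H; \<And>z. z \<in> X \<Longrightarrow> f z = g z\<rbrakk> \<Longrightarrow> f = g"
  using off_X by (metis ext)

lemma kernel_herm: "\<lbrakk>z \<in> X; w \<in> X\<rbrakk> \<Longrightarrow> k w z = cnj (k z w)"
  using ip_commute[of "K w" "K z"] by (simp add: reproducing)

text \<open>The normalisation turns the constant function 1 into a kernel function, which is how it
  gets into \<open>H\<close>.\<close>

lemma kernel_base: "K z\<^sub>0 = indicator X"
  using base off_X[of "K z\<^sub>0"] by (auto simp: indicator_def)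

lemma one_mem [simp]: "indicator X \<in> H"
  using kernel_mem[OF base(1)] by (simp add: kernel_base)

lemma hnorm_one [simp]: "hnorm ip (indicator X) = 1"
  using reproducing[of "K z\<^sub>0" z\<^sub>0] base by (simp add: hnorm_def kernel_base)

lemma kernel_nonzero: "\<lbrakk>z \<in> X; w \<in> X\<rbrakk> \<Longrightarrow> k z w \<noteq> 0"
  using kernel_eq u_neq_1 by simp

lemma u_mult_kernel: "\<lbrakk>z \<in> X; w \<in> X\<rbrakk> \<Longrightarrow> u z w * k z w = k z w - 1"
  using kernel_eq[of z w] u_neq_1[of z w] by (simp add: field_simps)

lemma u_eq: "\<lbrakk>z \<in> X; w \<in> X\<rbrakk> \<Longrightarrow> u z w = 1 - 1 / k z w"
  using kernel_eq[of z w] u_neq_1[of z w] by simp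

lemma u_herm: "\<lbrakk>z \<in> X; w \<in> X\<rbrakk> \<Longrightarrow> u w z = cnj (u z w)"
  using kernel_herm[of z w] by (simp add: u_eq)

lemma cmod_eval_le: "\<lbrakk>f \<in> H; z \<in> X\<rbrakk> \<Longrightarrow> cmod (f z) \<le> hnorm ip f * hnorm ip (K z)"
  using cauchy_schwarz[of f "K z"] by (simp add: reproducing)

lemma u_psd:
  assumes "finite A" "A \<subseteq> X"
  shows "0 \<le> Re (\<Sum>z\<in>A. \<Sum>w\<in>A. c z * cnj (c w) * u z w)"
proof -
  obtain h where h: "bij_betw h {0..<card A} A"
    using ex_bij_betw_nat_finite[OF assms(1)] by blast
  have "h i \<in> X" if "i < card A" for i using bij_betwE[OF h] assms(2) that by auto
  then have "(\<Sum>i<card A. \<Sum>j<card A. c (h i) * cnj (c (h j)) * u (h i) (h j)) \<in> \<real>\<^sub>\<ge>\<^sub>0"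
    using u_positive[unfolded positive_definite_on_def, rule_format, of "card A" h "\<lambda>i. c (h i)"]
    by blast
  also have "(\<Sum>i<card A. \<Sum>j<card A. c (h i) * cnj (c (h j)) * u (h i) (h j))
      = (\<Sum>z\<in>A. \<Sum>w\<in>A. c z * cnj (c w) * u z w)"
    unfolding lessThan_atLeast0 by (simp add: sum.reindex_bij_betw[OF h, symmetric])
  finally show ?thesis by (simp only: complex_nonneg_Reals_iff)
qed

lemma u_decomposition:
  assumes "finite A" "A \<subseteq> X"
  shows "\<exists>(n::nat) v. \<forall>z\<in>A. \<forall>w\<in>A. u z w = (\<Sum>r<n. v r z * cnj (v r w))"
  by (rule psd_decomposition[OF assms(1)]) (use assms u_herm u_psd in \<open>blast+\<close>)

section \<open>The linear span of the kernel functions\<close>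

definition kernel_comb :: "'x set \<Rightarrow> ('x \<Rightarrow> complex) \<Rightarrow> 'x \<Rightarrow> complex" where
  "kernel_comb A c = (\<Sum>w\<in>A. cscale (c w) (K w))"

definition kernel_span :: "('x \<Rightarrow> complex) set" where
  "kernel_span = {kernel_comb A c |A c. finite A \<and> A \<subseteq> X}"

lemma kernel_comb_mem [simp]: "A \<subseteq> X \<Longrightarrow> kernel_comb A c \<in> H"
  unfolding kernel_comb_def by (intro sum_mem mem_closed kernel_mem) auto

lemma kernel_comb_add:
  "\<lbrakk>finite A; finite B\<rbrakk> \<Longrightarrow> kernel_comb A c + kernel_comb B d
    = kernel_comb (A \<union> B) (\<lambda>i. (if i \<in> A then c i else 0) + (if i \<in> B then d i else 0))"
  unfolding kernel_comb_def
  by (rule sum_union_combination) (auto simp: cscale_def plus_fun_def algebra_simps)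

lemma kernel_comb_scale: "cscale a (kernel_comb A c) = kernel_comb A (\<lambda>w. a * c w)"
  unfolding kernel_comb_def cfun.scale_sum_right by (simp add: cscale_def mult.assoc)

lemma ip_kernel_comb:
  "\<lbrakk>f \<in> H; A \<subseteq> X\<rbrakk> \<Longrightarrow> ip f (kernel_comb A c) = (\<Sum>w\<in>A. cnj (c w) * f w)"
  unfolding kernel_comb_def
  by (subst ip_sum_right) (auto simp: ip_scale_right reproducing subset_iff intro!: sum.cong)

lemma kernel_span_subset: "kernel_span \<subseteq> H"
  by (auto simp: kernel_span_def)

lemma kernel_span_mem: "x \<in> kernel_span \<Longrightarrow> x \<in> H"
  using kernel_span_subset by blast

lemma kernel_in_span: "w \<in> X \<Longrightarrow> K w \<in> kernel_span"
  by (auto simp: kernel_span_def kernel_comb_def cscale_def intro!: exI[of _ "{w}"] exI[of _ "\<lambda>_. 1"])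

lemma kernel_span_scale: "x \<in> kernel_span \<Longrightarrow> cscale a x \<in> kernel_span"
  unfolding kernel_span_def using kernel_comb_scale by blast

lemma kernel_span_add: "\<lbrakk>x \<in> kernel_span; y \<in> kernel_span\<rbrakk> \<Longrightarrow> x + y \<in> kernel_span"
  unfolding kernel_span_def by (auto simp: kernel_comb_add) (metis Un_least finite_Un)

lemma kernel_span_zero: "0 \<in> kernel_span"
  by (auto simp: kernel_span_def kernel_comb_def intro!: exI[of _ "{}"])

text \<open>The vector representing \<open>x \<mapsto> ip x f\<close> on the span has the same
  values as \<open>f\<close>, since values are inner products with kernels. The minimising sequence
  of \<open>riesz_graph\<close> then approximates \<open>f\<close> itself.\<close>

lemma kernel_span_dense:
  assumes f: "f \<in> H"
  obtains F where "\<And>n. F n \<in> kernel_span" "hlim ip F f"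
proof -
  define G where "G = (\<lambda>x. (x, ip x f)) ` kernel_span"
  have G: "(x, v) \<in> G \<longleftrightarrow> x \<in> kernel_span \<and> v = ip x f" for x v by (auto simp: G_def)
  obtain y F where y: "y \<in> H" "\<And>n. F n \<in> fst ` G" "hlim ip F y"
    "\<And>x v. (x, v) \<in> G \<Longrightarrow> v = ip x y"
  proof (rule riesz_graph[of G "hnorm ip f"])
    show "cmod v \<le> hnorm ip f * hnorm ip x" if "(x, v) \<in> G" for x v
      using cauchy_schwarz[of x f] that f kernel_span_mem by (auto simp: G mult.commute)
  qed (use f in \<open>auto simp: G kernel_span_mem kernel_span_zero kernel_span_add kernel_span_scale
        ip_add_left ip_scale_left\<close>)
  have "f z = y z" if z: "z \<in> X" for z
    using y(4)[of "K z" "ip (K z) f"] ip_commute[of "K z" f] ip_commute[of "K z" y] z f y(1)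
    by (simp add: G kernel_in_span reproducing)
  then have "f = y" using f y eqI_on_X by blast
  moreover have "fst ` G = kernel_span" by (force simp: G_def)
  ultimately show ?thesis using that y by metis
qed

lemma kernel_span_approx:
  assumes f: "f \<in> H" and e: "0 < e"
  obtains x where "x \<in> kernel_span" "hnorm ip (x - f) < e"
proof -
  obtain F where F: "\<And>n. F n \<in> kernel_span" "hlim ip F f" using kernel_span_dense f by blast
  have "\<forall>\<^sub>F n in sequentially. hnorm ip (F n - f) < e"
    using F(2) e unfolding hlim_def by (rule order_tendstoD(2))
  then show ?thesis using that F(1) by (auto simp: eventually_sequentially)
qed

text \<open>A membership test by duality: \<open>F\<close> is recovered as the vector representing
  the functional that takes the value \<open>cnj (F w)\<close> on \<open>K w\<close>. A function may
  have several expansions in kernels, but the graph form of the Riesz lemma asks for no separate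
  proof that the functional is well defined.\<close>

lemma kernel_criterion:
  assumes F: "vanishes_off X F" and C: "0 \<le> C"
    and bound: "\<And>A c. \<lbrakk>finite A; A \<subseteq> X\<rbrakk> \<Longrightarrow>
      cmod (\<Sum>w\<in>A. c w * cnj (F w)) \<le> C * hnorm ip (kernel_comb A c)"
  shows "F \<in> H" "hnorm ip F \<le> C"
proof -
  define G where "G = {(kernel_comb A c, \<Sum>w\<in>A. c w * cnj (F w)) |A c. finite A \<and> A \<subseteq> X}"
  obtain y where y: "y \<in> H" "hnorm ip y \<le> C" "\<And>x v. (x, v) \<in> G \<Longrightarrow> v = ip x y"
  proof (rule riesz_graph[of G C])
    show "(0, 0) \<in> G"
      unfolding G_def by (rule CollectI, intro exI[of _ "{}"]) (simp add: kernel_comb_def)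
  next
    fix x v y w assume "(x, v) \<in> G" "(y, w) \<in> G"
    then obtain A c B d where *: "finite A" "A \<subseteq> X" "x = kernel_comb A c" "v = (\<Sum>w\<in>A. c w * cnj (F w))"
      "finite B" "B \<subseteq> X" "y = kernel_comb B d" "w = (\<Sum>w\<in>B. d w * cnj (F w))"
      by (auto simp: G_def)
    have "v + w = (\<Sum>i\<in>A \<union> B. ((if i \<in> A then c i else 0) + (if i \<in> B then d i else 0)) * cnj (F i))"
      unfolding * by (rule sum_union_combination) (use * in \<open>auto simp: algebra_simps\<close>)
    then show "(x + y, v + w) \<in> G"
      using * by (auto simp: G_def kernel_comb_add intro!: exI[of _ "A \<union> B"])
  next
    fix x v a assume "(x, v) \<in> G"
    then obtain A c where *: "finite A" "A \<subseteq> X" "x = kernel_comb A c" "v = (\<Sum>w\<in>A. c w * cnj (F w))"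
      by (auto simp: G_def)
    then have "a * v = (\<Sum>w\<in>A. (a * c w) * cnj (F w))" by (simp add: sum_distrib_left mult.assoc)
    then show "(cscale a x, a * v) \<in> G"
      unfolding G_def using * kernel_comb_scale by blast
  qed (use C bound in \<open>auto simp: G_def\<close>)
  have "F z = y z" if z: "z \<in> X" for z
  proof -
    have "(K z, cnj (F z)) \<in> G"
      using z by (auto simp: G_def kernel_comb_def cscale_def intro!: exI[of _ "{z}"] exI[of _ "\<lambda>_. 1"])
    then have "cnj (F z) = cnj (y z)"
      using y(1,3) z ip_commute[of y "K z"] by (simp add: reproducing)
    then show ?thesis by simp
  qed
  then have "F = y" using F y(1) off_X by (metis ext vanishes_off_def)
  then show "F \<in> H" "hnorm ip F \<le> C" using y by auto
qed

text \<open>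
  The row of the coordinate functions of \<open>u\<close> is contractive because
  \<open>k - u k = 1\<close> is positive.
\<close>

lemma row_contraction:
  assumes A: "finite A" "A \<subseteq> X" and x: "\<And>w. w \<in> A \<Longrightarrow> x w \<in> H"
  defines "F \<equiv> \<lambda>z. \<Sum>w\<in>A. u z w * x w z"
  shows "F \<in> H"
    and "(hnorm ip F)\<^sup>2 \<le> Re (\<Sum>w\<in>A. \<Sum>z\<in>A. u z w * ip (x w) (x z))"
proof -
  \<comment> \<open>\<open>Q\<close> is written without a factorisation of \<open>u\<close>, because
    each test set \<open>B\<close> below brings its own.\<close>
  define Q where "Q = Re (\<Sum>w\<in>A. \<Sum>z\<in>A. u z w * ip (x w) (x z))"
  have Q_eq: "Q = (\<Sum>r<n. (hnorm ip (\<Sum>w\<in>A. cscale (cnj (v r w)) (x w)))\<^sup>2)"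
    if "\<And>z w. \<lbrakk>z \<in> A; w \<in> A\<rbrakk> \<Longrightarrow> u z w = (\<Sum>r<n. v r z * cnj (v r w))" for n :: nat and v
    unfolding Q_def by (rule gram_decomposition_Re[symmetric]) (use that x in auto)
  have "0 \<le> Q"
  proof -
    obtain n :: nat and v where v: "\<And>z w. \<lbrakk>z \<in> A; w \<in> A\<rbrakk> \<Longrightarrow> u z w = (\<Sum>r<n. v r z * cnj (v r w))"
      using u_decomposition[OF A] by blast
    have "Q = (\<Sum>r<n. (hnorm ip (\<Sum>w\<in>A. cscale (cnj (v r w)) (x w)))\<^sup>2)"
      by (rule Q_eq) (rule v)
    then show ?thesis by (simp only:) (intro sum_nonneg zero_le_power2)
  qed
  have bound: "cmod (\<Sum>z\<in>B. c z * cnj (F z)) \<le> sqrt Q * hnorm ip (kernel_comb B c)"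
    if B: "finite B" "B \<subseteq> X" for B c
  proof -
    \<comment> \<open>One factorisation over both sets, so that the same coordinates
      \<open>v r\<close> act on the data over \<open>A\<close> and on the test combination over
      \<open>B\<close>.\<close>
    obtain n :: nat and v where v: "\<And>z w. \<lbrakk>z \<in> A \<union> B; w \<in> A \<union> B\<rbrakk> \<Longrightarrow> u z w = (\<Sum>r<n. v r z * cnj (v r w))"
      using u_decomposition[of "A \<union> B"] A B by (metis finite_Un le_sup_iff)
    define p where "p r = (\<Sum>w\<in>A. cscale (cnj (v r w)) (x w))" for r
    define y where "y z = cscale (c z) (K z)" for z
    \<comment> \<open>Formally the adjoint of multiplication by \<open>v r\<close>, applied to
      \<open>kernel_comb B c\<close>. The identity \<open>u k = k - 1\<close> bounds the total
      squared norm of these vectors by that of the combination.\<close>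
    define q where "q r = (\<Sum>z\<in>B. cscale (cnj (v r z)) (y z))" for r
    have yH: "y z \<in> H" if "z \<in> B" for z using that B by (auto simp: y_def)
    have pH: "p r \<in> H" for r unfolding p_def using x by auto
    have qH: "q r \<in> H" for r unfolding q_def using yH by auto
    have q_comb: "q r = kernel_comb B (\<lambda>z. cnj (v r z) * c z)" for r
      by (simp add: q_def kernel_comb_def y_def cscale_def mult.assoc)
    have p_apply: "p r z = (\<Sum>w\<in>A. cnj (v r w) * x w z)" for r z
      unfolding p_def using A(1) by (induction A) (auto simp: cscale_def)
    have "(\<Sum>r<n. ip (p r) (q r)) = (\<Sum>r<n. \<Sum>z\<in>B. \<Sum>w\<in>A. cnj (c z) * (v r z * cnj (v r w) * x w z))"
      using B pH by (simp add: q_comb ip_kernel_comb p_apply sum_distrib_left mult_ac)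
    also have "\<dots> = (\<Sum>z\<in>B. \<Sum>w\<in>A. \<Sum>r<n. cnj (c z) * (v r z * cnj (v r w) * x w z))"
      by (subst sum.swap) (intro sum.cong refl sum.swap)
    also have "\<dots> = (\<Sum>z\<in>B. cnj (c z) * F z)"
      by (simp add: F_def v sum_distrib_left sum_distrib_right)
    finally have ip_pq: "(\<Sum>r<n. ip (p r) (q r)) = cnj (\<Sum>z\<in>B. c z * cnj (F z))" by simp
    have "(\<Sum>r<n. (hnorm ip (q r))\<^sup>2) = Re (\<Sum>w\<in>B. \<Sum>z\<in>B. u z w * ip (y w) (y z))"
      unfolding q_def by (rule gram_decomposition_Re) (use v yH in auto)
    also have "(\<Sum>w\<in>B. \<Sum>z\<in>B. u z w * ip (y w) (y z)) = (\<Sum>w\<in>B. \<Sum>z\<in>B. ip (y w) (y z) - c w * cnj (c z))"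
    proof (intro sum.cong refl)
      fix w z assume "w \<in> B" "z \<in> B"
      then have z: "z \<in> X" "w \<in> X" using B by auto
      then have "ip (y w) (y z) = c w * cnj (c z) * k z w"
        by (simp add: y_def ip_scale_right reproducing) (simp add: cscale_def)
      moreover have "u z w * (c w * cnj (c z) * k z w) = c w * cnj (c z) * (u z w * k z w)" by simp
      ultimately show "u z w * ip (y w) (y z) = ip (y w) (y z) - c w * cnj (c z)"
        using z by (simp only: u_mult_kernel right_diff_distrib mult_1_right)
    qed
    also have "\<dots> = ip (kernel_comb B c) (kernel_comb B c) - (\<Sum>w\<in>B. c w) * cnj (\<Sum>w\<in>B. c w)"
    proof -
      have "ip (kernel_comb B c) (kernel_comb B c) = (\<Sum>w\<in>B. \<Sum>z\<in>B. ip (y w) (y z))"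
        unfolding kernel_comb_def y_def[symmetric] using yH by (simp add: ip_sum_left ip_sum_right)
          (rule sum.swap)
      then show ?thesis by (simp add: sum_subtractf sum_product cnj_sum)
    qed
    also have "\<dots> = of_real ((hnorm ip (kernel_comb B c))\<^sup>2 - (cmod (\<Sum>w\<in>B. c w))\<^sup>2)"
      by (simp only: ip_self[OF kernel_comb_mem[OF B(2)]] of_real_diff complex_norm_square)
    finally have "(\<Sum>r<n. (hnorm ip (q r))\<^sup>2) = (hnorm ip (kernel_comb B c))\<^sup>2 - (cmod (\<Sum>w\<in>B. c w))\<^sup>2"
      by (simp only: Re_complex_of_real)
    then have q_le: "(\<Sum>r<n. (hnorm ip (q r))\<^sup>2) \<le> (hnorm ip (kernel_comb B c))\<^sup>2" by simp
    have "cmod (\<Sum>r<n. ip (p r) (q r)) \<le> (\<Sum>r<n. \<bar>hnorm ip (p r)\<bar> * \<bar>hnorm ip (q r)\<bar>)"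
      using cauchy_schwarz pH qH by (intro order.trans[OF norm_sum] sum_mono) simp
    also have "\<dots> \<le> L2_set (\<lambda>r. hnorm ip (p r)) {..<n} * L2_set (\<lambda>r. hnorm ip (q r)) {..<n}"
      by (rule L2_set_mult_ineq)
    also have "\<dots> \<le> sqrt Q * hnorm ip (kernel_comb B c)"
    proof (intro mult_mono)
      show "L2_set (\<lambda>r. hnorm ip (p r)) {..<n} \<le> sqrt Q"
      proof -
        have "Q = (\<Sum>r<n. (hnorm ip (p r))\<^sup>2)" unfolding p_def by (rule Q_eq) (use v in auto)
        then show ?thesis by (simp only: L2_set_def order.refl)
      qed
      show "L2_set (\<lambda>r. hnorm ip (q r)) {..<n} \<le> hnorm ip (kernel_comb B c)"
        unfolding L2_set_def using q_le B by (intro real_le_lsqrt) (auto intro: sum_nonneg)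
    qed (auto simp: \<open>0 \<le> Q\<close>)
    finally show ?thesis unfolding ip_pq complex_mod_cnj .
  qed
  have F: "vanishes_off X F" using x off_X by (auto simp: F_def vanishes_off_def intro!: sum.neutral)
  show "F \<in> H" by (rule kernel_criterion(1)[OF F _ bound]) (use \<open>0 \<le> Q\<close> in auto)
  moreover have "hnorm ip F \<le> sqrt Q" by (rule kernel_criterion(2)[OF F _ bound]) (use \<open>0 \<le> Q\<close> in auto)
  ultimately have "(hnorm ip F)\<^sup>2 \<le> (sqrt Q)\<^sup>2" by (intro power_mono) auto
  then show "(hnorm ip F)\<^sup>2 \<le> Re (\<Sum>w\<in>A. \<Sum>z\<in>A. u z w * ip (x w) (x z))"
    using \<open>0 \<le> Q\<close> by (simp add: Q_def)
qed

end

lemma sum_fun_apply: "(\<Sum>i\<in>A. f i) x = (\<Sum>i\<in>A. f i x)"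
  for f :: "'i \<Rightarrow> 'x \<Rightarrow> 'b::comm_monoid_add"
  by (induction A rule: infinite_finite_induct) auto

lemma cscale_apply [simp]: "cscale c f z = c * f z"
  by (simp add: cscale_def)

lemma times_cscale: "f * cscale c g = cscale c (f * g)" "cscale c f * g = cscale c (f * g)"
  by (auto simp: fun_eq_iff)

context complete_pick_space
begin

section \<open>Accretive multiplication operators and bounded multipliers\<close>

lemma kernel_diag: "z \<in> X \<Longrightarrow> k z z = of_real ((hnorm ip (K z))\<^sup>2)"
  using ip_self[of "K z"] by (simp add: reproducing)

lemma hnorm_kernel_pos: "z \<in> X \<Longrightarrow> 0 < hnorm ip (K z)"
  using kernel_diag[of z] kernel_nonzero[of z z] hnorm_nonneg[of "K z"] by (simp add: less_le)

text \<open>Formally the adjoint of multiplication by \<open>W\<close> sends \<open>K w\<close> to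
  \<open>cnj (W w)\<close> times \<open>K w\<close>, and accretivity bounds it below by
  \<open>\<delta>\<close>. Tested on kernel combinations, this lower bound becomes an estimate for
  division by \<open>W\<close> via \<open>kernel_criterion\<close>.\<close>

lemma inverse_multiplier:
  assumes W: "\<And>g. g \<in> H \<Longrightarrow> W * g \<in> H"
    and acc: "\<And>g. g \<in> H \<Longrightarrow> \<delta> * (hnorm ip g)\<^sup>2 \<le> Re (ip (W * g) g)" and \<delta>: "0 < \<delta>"
  shows "z \<in> X \<Longrightarrow> \<delta> \<le> Re (W z)"
    and "h \<in> H \<Longrightarrow> (\<lambda>z. h z / W z) \<in> H"
    and "h \<in> H \<Longrightarrow> hnorm ip (\<lambda>z. h z / W z) \<le> hnorm ip h / \<delta>"
proof -
  show Re_W: "\<delta> \<le> Re (W z)" if z: "z \<in> X" for z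
  proof -
    have "ip (W * K z) (K z) = W z * of_real ((hnorm ip (K z))\<^sup>2)"
      using W z by (simp add: reproducing kernel_diag)
    then have "\<delta> * (hnorm ip (K z))\<^sup>2 \<le> Re (W z) * (hnorm ip (K z))\<^sup>2"
      using acc[of "K z"] z by (simp del: of_real_power)
    then show ?thesis using hnorm_kernel_pos[OF z] by simp
  qed
  assume h: "h \<in> H"
  let ?F = "\<lambda>z. h z / W z"
  have F: "vanishes_off X ?F" using off_X[OF h] by (simp add: vanishes_off_def)
  have bound: "cmod (\<Sum>w\<in>A. c w * cnj (?F w)) \<le> hnorm ip h / \<delta> * hnorm ip (kernel_comb A c)"
    if A: "finite A" "A \<subseteq> X" for A c
  proof -
    \<comment> \<open>The preimage of \<open>kernel_comb A c\<close> under that adjoint; hence its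
      inner product with the combination is \<open>ip (W * x) x\<close>.\<close>
    define x where "x = kernel_comb A (\<lambda>w. c w * cnj (1 / W w))"
    have x: "x \<in> H" using A by (simp add: x_def)
    have y: "kernel_comb A c \<in> H" using A by simp
    have "ip x (kernel_comb A c) = ip (W * x) x"
      using A x W Re_W \<delta> by (simp add: ip_kernel_comb x_def[symmetric])
        (simp add: x_def ip_kernel_comb W, force intro!: sum.cong)
    then have *: "\<delta> * (hnorm ip x)\<^sup>2 \<le> hnorm ip x * hnorm ip (kernel_comb A c)"
      using acc[OF x] Re_ip_le[OF x y] by simp
    have "\<delta> * hnorm ip x \<le> hnorm ip (kernel_comb A c)"
    proof (cases "hnorm ip x = 0")
      case False
      then have "0 < hnorm ip x" using x by (simp add: less_le)
      moreover have "(\<delta> * hnorm ip x) * hnorm ip x \<le> hnorm ip (kernel_comb A c) * hnorm ip x"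
        using * by (simp add: power2_eq_square mult_ac)
      ultimately show ?thesis by (rule mult_right_le_imp_le[rotated])
    qed (use y in simp)
    then have x_le: "hnorm ip x \<le> hnorm ip (kernel_comb A c) / \<delta>"
      using \<delta> by (simp add: field_simps)
    have "(\<Sum>w\<in>A. c w * cnj (?F w)) = cnj (ip h x)"
      unfolding x_def using h A by (simp add: ip_kernel_comb mult_ac)
    then have "cmod (\<Sum>w\<in>A. c w * cnj (?F w)) \<le> hnorm ip h * hnorm ip x"
      using cauchy_schwarz[OF h x] by simp
    also have "\<dots> \<le> hnorm ip h * (hnorm ip (kernel_comb A c) / \<delta>)"
      using x_le h by (intro mult_left_mono) auto
    finally show ?thesis by simp
  qed
  show "?F \<in> H" by (rule kernel_criterion(1)[OF F _ bound]) (use h \<delta> in auto)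
  show "hnorm ip ?F \<le> hnorm ip h / \<delta>"
    by (rule kernel_criterion(2)[OF F _ bound]) (use h \<delta> in auto)
qed

text \<open>The norm bound is part of the notion, so that no closed graph argument is required to
  extract it from \<open>Mult X H\<close>.\<close>

definition bounded_multiplier :: "('x \<Rightarrow> complex) \<Rightarrow> bool" where
  "bounded_multiplier \<phi> \<longleftrightarrow> (\<exists>C\<ge>0. \<forall>h\<in>H. \<phi> * h \<in> H \<and> hnorm ip (\<phi> * h) \<le> C * hnorm ip h)"

lemma bounded_multiplier_mem: "\<lbrakk>bounded_multiplier \<phi>; h \<in> H\<rbrakk> \<Longrightarrow> \<phi> * h \<in> H"
  by (auto simp: bounded_multiplier_def)

lemma bounded_multiplier_zero: "bounded_multiplier 0"
  by (auto simp: bounded_multiplier_def intro!: exI[of _ 0])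

lemma bounded_multiplier_add:
  assumes "bounded_multiplier \<phi>" "bounded_multiplier \<psi>"
  shows "bounded_multiplier (\<phi> + \<psi>)"
proof -
  obtain C D where "C \<ge> 0" "D \<ge> 0" and
    C: "\<And>h. h \<in> H \<Longrightarrow> \<phi> * h \<in> H" "\<And>h. h \<in> H \<Longrightarrow> hnorm ip (\<phi> * h) \<le> C * hnorm ip h" and
    D: "\<And>h. h \<in> H \<Longrightarrow> \<psi> * h \<in> H" "\<And>h. h \<in> H \<Longrightarrow> hnorm ip (\<psi> * h) \<le> D * hnorm ip h"
    using assms unfolding bounded_multiplier_def by blast
  have "hnorm ip ((\<phi> + \<psi>) * h) \<le> (C + D) * hnorm ip h" if "h \<in> H" for h
    using hnorm_triangle[of "\<phi> * h" "\<psi> * h"] C(1)[OF that] D(1)[OF that] C(2)[OF that] D(2)[OF that]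
    by (simp add: distrib_right)
  moreover have "(\<phi> + \<psi>) * h \<in> H" if "h \<in> H" for h
    using C(1)[OF that] D(1)[OF that] by (simp add: distrib_right)
  ultimately show ?thesis
    unfolding bounded_multiplier_def using \<open>C \<ge> 0\<close> \<open>D \<ge> 0\<close> by (intro exI[of _ "C + D"]) auto
qed

lemma bounded_multiplier_scale:
  assumes "bounded_multiplier \<phi>"
  shows "bounded_multiplier (cscale a \<phi>)"
proof -
  obtain C where "C \<ge> 0" and
    C: "\<And>h. h \<in> H \<Longrightarrow> \<phi> * h \<in> H" "\<And>h. h \<in> H \<Longrightarrow> hnorm ip (\<phi> * h) \<le> C * hnorm ip h"
    using assms unfolding bounded_multiplier_def by blast
  have "hnorm ip (cscale a \<phi> * h) \<le> (cmod a * C) * hnorm ip h" if "h \<in> H" for h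
    using mult_left_mono[OF C(2)[OF that], of "cmod a"] C(1)[OF that] that
    by (simp add: times_cscale mult.assoc)
  then show ?thesis
    unfolding bounded_multiplier_def using \<open>C \<ge> 0\<close> C(1)
    by (intro exI[of _ "cmod a * C"]) (auto simp: times_cscale)
qed

lemma bounded_multiplier_sum:
  "(\<And>i. i \<in> A \<Longrightarrow> bounded_multiplier (f i)) \<Longrightarrow> bounded_multiplier (sum f A)"
  by (induction A rule: infinite_finite_induct)
    (auto simp: bounded_multiplier_zero bounded_multiplier_add)

text \<open>The gap below 1 is the reciprocal of the squared norm of \<open>K z\<close>; it is what
  makes \<open>1 - u z w\<close> accretive for a fixed \<open>w\<close>.\<close>

lemma u_diag:
  assumes z: "z \<in> X"
  shows "u z z = of_real (Re (u z z))" "0 \<le> Re (u z z)" "Re (u z z) < 1"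
proof -
  have "u z z = of_real (1 - 1 / (hnorm ip (K z))\<^sup>2)"
    using z by (simp add: u_eq kernel_diag)
  moreover have "0 < 1 / (hnorm ip (K z))\<^sup>2" using hnorm_kernel_pos[OF z] by simp
  ultimately show "u z z = of_real (Re (u z z))" "Re (u z z) < 1" by (simp_all del: of_real_power)
  show "0 \<le> Re (u z z)" using u_psd[of "{z}" "\<lambda>_. 1"] z by simp
qed

text \<open>By \<open>row_contraction\<close> for the single point \<open>w\<close>, multiplication
  by \<open>u z w\<close> in \<open>z\<close> has norm at most \<open>sqrt (Re (u w w))\<close>,
  which is less than 1. So \<open>1 - u z w\<close> is accretive, and \<open>K w\<close> is its
  reciprocal.\<close>

lemma bounded_multiplier_kernel:
  assumes w: "w \<in> X"
  shows "bounded_multiplier (K w)"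
proof -
  define r where "r = sqrt (Re (u w w))"
  have r: "0 \<le> r" "r < 1" "r\<^sup>2 = Re (u w w)"
    using u_diag[OF w] by (auto simp: r_def intro: real_less_lsqrt)
  have S: "(\<lambda>z. u z w * g z) \<in> H" "hnorm ip (\<lambda>z. u z w * g z) \<le> r * hnorm ip g" if g: "g \<in> H" for g
  proof -
    have "(\<lambda>z. \<Sum>w\<in>{w}. u z w * g z) \<in> H" by (rule row_contraction) (use w g in auto)
    then show *: "(\<lambda>z. u z w * g z) \<in> H" by simp
    have "(hnorm ip (\<lambda>z. \<Sum>w\<in>{w}. u z w * g z))\<^sup>2 \<le> Re (\<Sum>w\<in>{w}. \<Sum>z\<in>{w}. u z w * ip g g)"
      using row_contraction(2)[of "{w}" "\<lambda>_. g"] w g by simp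
    also have "\<dots> = (r * hnorm ip g)\<^sup>2"
      using u_diag(1)[OF w] r ip_self[OF g] by (simp add: power_mult_distrib del: of_real_power)
    finally show "hnorm ip (\<lambda>z. u z w * g z) \<le> r * hnorm ip g"
      using r g * by (simp add: power2_le_iff_abs_le)
  qed
  let ?W = "\<lambda>z. 1 - u z w"
  have Wg: "?W * g = g - (\<lambda>z. u z w * g z)" for g by (auto simp: fun_eq_iff algebra_simps)
  have acc: "(1 - r) * (hnorm ip g)\<^sup>2 \<le> Re (ip (?W * g) g)" if g: "g \<in> H" for g
  proof -
    have "Re (ip (\<lambda>z. u z w * g z) g) \<le> r * hnorm ip g * hnorm ip g"
      using Re_ip_le[OF S(1)[OF g] g] mult_right_mono[OF S(2)[OF g], of "hnorm ip g"] g by simp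
    then show ?thesis
      using g S(1)[OF g] by (simp add: Wg ip_diff_left hnorm_sq[symmetric] algebra_simps power2_eq_square)
  qed
  have mem: "?W * g \<in> H" if "g \<in> H" for g using that S(1) by (simp add: Wg)
  have eq: "K w * h = (\<lambda>z. h z / ?W z)" if h: "h \<in> H" for h
  proof
    fix z show "(K w * h) z = h z / ?W z"
      using w off_X[OF h, of z] by (cases "z \<in> X") (auto simp: kernel_eq)
  qed
  show ?thesis
    unfolding bounded_multiplier_def
  proof (intro exI conjI ballI)
    show "0 \<le> 1 / (1 - r)" using r by simp
    fix h assume h: "h \<in> H"
    show "K w * h \<in> H" unfolding eq[OF h] by (rule inverse_multiplier(2)[OF mem acc]) (use r h in auto)
    have "hnorm ip (K w * h) \<le> hnorm ip h / (1 - r)"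
      unfolding eq[OF h] by (rule inverse_multiplier(3)[OF mem acc]) (use r h in auto)
    then show "hnorm ip (K w * h) \<le> 1 / (1 - r) * hnorm ip h" by simp
  qed
qed

lemma bounded_multiplier_span: "x \<in> kernel_span \<Longrightarrow> bounded_multiplier x"
  unfolding kernel_span_def kernel_comb_def
  by (auto intro!: bounded_multiplier_sum bounded_multiplier_scale bounded_multiplier_kernel)

lemma kernel_mult_mem [simp]: "\<lbrakk>w \<in> X; h \<in> H\<rbrakk> \<Longrightarrow> K w * h \<in> H"
  using bounded_multiplier_kernel bounded_multiplier_mem by blast

text \<open>With \<open>kernel_span_dense\<close> this provides multipliers arbitrarily close to any
  vector of \<open>H\<close>.\<close>

lemma kernel_span_Mult: "x \<in> kernel_span \<Longrightarrow> x \<in> Mult X H"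
  using bounded_multiplier_mem[OF bounded_multiplier_span] kernel_span_mem vanishes
  by (auto simp: Mult_def)

text \<open>
  After a Schur product with \<open>k\<close> the inequality reduces to \<open>row_contraction\<close>, because
  \<open>u\<^sub>w k\<^sub>w = k\<^sub>w - 1\<close>. The function \<open>z \<mapsto> 2 ip a (K z * a) - \<parallel>a\<parallel>\<^sup>2\<close> is the Sarason function of \<open>a\<close>.
\<close>

lemma sarason_inequality:
  assumes a: "a \<in> H" and A: "finite A" "A \<subseteq> X"
  shows "(hnorm ip (a * kernel_comb A c))\<^sup>2
    \<le> Re (\<Sum>w\<in>A. \<Sum>z\<in>A. c w * cnj (c z) * (2 * ip a (K z * a) - ip a a) * k z w)"
proof -
  define x where "x w = K w * a" for w
  have xH: "x w \<in> H" if "w \<in> A" for w using that A a by (auto simp: x_def)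
  \<comment> \<open>The row of coordinates of \<open>u\<close> sends the data \<open>x w\<close> to
    \<open>x w - a\<close>, because \<open>u\<close> times the kernel is the kernel minus 1.
    \<open>B\<close> is the defect of this contraction.\<close>
  define B where "B z w = u z w * ip (x w) (x z) - ip (x w - a) (x z - a)" for z w
  have B_herm: "B w z = cnj (B z w)" if "z \<in> A" "w \<in> A" for z w
    using that A u_herm[of z w] ip_commute[of "x w" "x z"] ip_commute[of "x w - a" "x z - a"] xH a
    by (simp add: B_def subset_iff)
  have B_psd: "0 \<le> Re (\<Sum>z\<in>A. \<Sum>w\<in>A. d z * cnj (d w) * B z w)" for d
  proof -
    define y where "y w = cscale (cnj (d w)) (x w)" for w
    define e where "e w = cscale (cnj (d w)) (x w - a)" for w
    have yH: "y w \<in> H" and eH: "e w \<in> H" if "w \<in> A" for w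
      using that xH a by (auto simp: y_def e_def)
    have eq: "(\<lambda>z. \<Sum>w\<in>A. u z w * y w z) = (\<Sum>w\<in>A. e w)"
    proof
      fix z
      have "u z w * y w z = e w z" if w: "w \<in> A" for w
      proof (cases "z \<in> X")
        case True
        have "u z w * y w z = cnj (d w) * ((u z w * k z w) * a z)" by (simp add: y_def x_def)
        also have "u z w * k z w = k z w - 1" using True w A u_mult_kernel by blast
        finally show ?thesis by (simp add: e_def x_def left_diff_distrib)
      next
        case False
        then show ?thesis using off_X[OF yH[OF w]] off_X[OF eH[OF w]] by simp
      qed
      then show "(\<Sum>w\<in>A. u z w * y w z) = (\<Sum>w\<in>A. e w) z" by (simp add: sum_fun_apply)
    qed
    have "(hnorm ip (\<Sum>w\<in>A. e w))\<^sup>2 \<le> Re (\<Sum>w\<in>A. \<Sum>z\<in>A. u z w * ip (y w) (y z))"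
      using row_contraction(2)[OF A, of y] yH unfolding eq by blast
    moreover have "(hnorm ip (\<Sum>w\<in>A. e w))\<^sup>2 = Re (\<Sum>w\<in>A. \<Sum>z\<in>A. ip (e w) (e z))"
    proof -
      have "ip (\<Sum>w\<in>A. e w) (\<Sum>w\<in>A. e w) = (\<Sum>w\<in>A. \<Sum>z\<in>A. ip (e w) (e z))"
        using eH by (simp add: ip_sum_left ip_sum_right) (rule sum.swap)
      then show ?thesis using eH by (simp only: hnorm_sq sum_mem)
    qed
    ultimately have "0 \<le> Re ((\<Sum>w\<in>A. \<Sum>z\<in>A. u z w * ip (y w) (y z)) - (\<Sum>w\<in>A. \<Sum>z\<in>A. ip (e w) (e z)))"
      by (simp only: minus_complex.sel)
    also have "(\<Sum>w\<in>A. \<Sum>z\<in>A. u z w * ip (y w) (y z)) - (\<Sum>w\<in>A. \<Sum>z\<in>A. ip (e w) (e z))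
        = (\<Sum>w\<in>A. \<Sum>z\<in>A. d z * cnj (d w) * B z w)"
      unfolding sum_subtractf[symmetric]
    proof (intro sum.cong refl)
      fix w z assume wz: "w \<in> A" "z \<in> A"
      have "ip (y w) (y z) = d z * cnj (d w) * ip (x w) (x z)"
        using wz xH by (simp add: y_def ip_scale_left ip_scale_right)
      moreover have "ip (e w) (e z) = d z * cnj (d w) * ip (x w - a) (x z - a)"
        using wz xH a by (simp add: e_def ip_scale_left ip_scale_right)
      ultimately show "u z w * ip (y w) (y z) - ip (e w) (e z) = d z * cnj (d w) * B z w"
        by (simp add: B_def right_diff_distrib)
    qed
    also have "\<dots> = (\<Sum>z\<in>A. \<Sum>w\<in>A. d z * cnj (d w) * B z w)" by (rule sum.swap)
    finally show ?thesis .
  qed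
  have "\<exists>(n::nat) v. \<forall>z\<in>A. \<forall>w\<in>A. B z w = (\<Sum>r<n. v r z * cnj (v r w))"
    by (rule psd_decomposition[OF A(1) B_herm B_psd])
  then obtain n :: nat and v where v: "\<And>z w. \<lbrakk>z \<in> A; w \<in> A\<rbrakk> \<Longrightarrow> B z w = (\<Sum>r<n. v r z * cnj (v r w))"
    by blast
  \<comment> \<open>The Schur product of \<open>B\<close> with \<open>k\<close> is positive: each
    rank one term of \<open>B\<close> contributes the squared norm of a kernel combination.\<close>
  have "0 \<le> (\<Sum>r<n. (hnorm ip (\<Sum>w\<in>A. cscale (cnj (v r w)) (cscale (c w) (K w))))\<^sup>2)"
    by (intro sum_nonneg zero_le_power2)
  also have "\<dots> = Re (\<Sum>w\<in>A. \<Sum>z\<in>A. B z w * ip (cscale (c w) (K w)) (cscale (c z) (K z)))"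
    by (rule gram_decomposition_Re) (use v A in auto)
  also have "(\<Sum>w\<in>A. \<Sum>z\<in>A. B z w * ip (cscale (c w) (K w)) (cscale (c z) (K z)))
      = (\<Sum>w\<in>A. \<Sum>z\<in>A. c w * cnj (c z) * (ip (x w) a * k z w)) +
        (\<Sum>w\<in>A. \<Sum>z\<in>A. c w * cnj (c z) * ((ip a (x z) - ip a a) * k z w)) -
        (\<Sum>w\<in>A. \<Sum>z\<in>A. c w * cnj (c z) * ip (x w) (x z))"
    unfolding sum.distrib[symmetric] sum_subtractf[symmetric]
  proof (intro sum.cong refl)
    fix w z assume wz: "w \<in> A" "z \<in> A"
    then have X: "z \<in> X" "w \<in> X" using A by auto
    have ip: "ip (cscale (c w) (K w)) (cscale (c z) (K z)) = c w * cnj (c z) * k z w"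
      using X by (simp add: ip_scale_right reproducing)
    have "B z w * k z w = u z w * k z w * ip (x w) (x z) - k z w * ip (x w - a) (x z - a)"
      by (simp add: B_def algebra_simps)
    also have "\<dots> = ip (x w) a * k z w + (ip a (x z) - ip a a) * k z w - ip (x w) (x z)"
      unfolding u_mult_kernel[OF X] using wz xH a by (simp add: ip_diff_left ip_diff_right algebra_simps)
    finally have Bk: "B z w * k z w = ip (x w) a * k z w + (ip a (x z) - ip a a) * k z w - ip (x w) (x z)" .
    have "B z w * ip (cscale (c w) (K w)) (cscale (c z) (K z)) = c w * cnj (c z) * (B z w * k z w)"
      by (simp add: ip)
    also have "\<dots> = c w * cnj (c z) * (ip (x w) a * k z w) + c w * cnj (c z) * ((ip a (x z) - ip a a) * k z w)
        - c w * cnj (c z) * ip (x w) (x z)"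
      unfolding Bk by (simp only: distrib_left right_diff_distrib)
    finally show "B z w * ip (cscale (c w) (K w)) (cscale (c z) (K z)) = \<dots>" .
  qed
  \<comment> \<open>Exchanging the indices conjugates the sum. The two mixed terms thus have equal
    real parts of their \<open>ip a (x z)\<close> contributions, which is the origin of the factor 2
    in the Sarason function.\<close>
  also have "(\<Sum>w\<in>A. \<Sum>z\<in>A. c w * cnj (c z) * (ip (x w) a * k z w))
      = cnj (\<Sum>w\<in>A. \<Sum>z\<in>A. c w * cnj (c z) * (ip a (x z) * k z w))"
  proof -
    have "c w * cnj (c z) * (ip (x w) a * k z w) = cnj (c z * cnj (c w) * (ip a (x w) * k w z))"
      if "w \<in> A" "z \<in> A" for w z
      using kernel_herm[of w z] ip_commute[OF a xH[OF that(1)]] that A by (auto simp: subset_iff)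
    then have "(\<Sum>w\<in>A. \<Sum>z\<in>A. c w * cnj (c z) * (ip (x w) a * k z w))
        = (\<Sum>w\<in>A. \<Sum>z\<in>A. cnj (c z * cnj (c w) * (ip a (x w) * k w z)))"
      by (intro sum.cong refl)
    also have "\<dots> = (\<Sum>z\<in>A. \<Sum>w\<in>A. cnj (c z * cnj (c w) * (ip a (x w) * k w z)))"
      by (rule sum.swap)
    finally show ?thesis by (simp only: cnj_sum)
  qed
  also have "(\<Sum>w\<in>A. \<Sum>z\<in>A. c w * cnj (c z) * ip (x w) (x z))
      = ip (a * kernel_comb A c) (a * kernel_comb A c)"
  proof -
    have "a * kernel_comb A c = (\<Sum>w\<in>A. cscale (c w) (x w))"
      by (simp add: fun_eq_iff kernel_comb_def sum_fun_apply x_def sum_distrib_left mult_ac)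
    then show ?thesis
      using xH by (simp add: ip_sum_left ip_sum_right ip_scale_left ip_scale_right sum_distrib_left mult_ac)
        (rule sum.swap)
  qed
  finally have "Re (ip (a * kernel_comb A c) (a * kernel_comb A c))
      \<le> Re (\<Sum>w\<in>A. \<Sum>z\<in>A. c w * cnj (c z) * (ip a (x z) * k z w))
        + Re (\<Sum>w\<in>A. \<Sum>z\<in>A. c w * cnj (c z) * ((ip a (x z) - ip a a) * k z w))"
    by (simp only: plus_complex.sel minus_complex.sel cnj.sel)
  also have "\<dots> = Re (\<Sum>w\<in>A. \<Sum>z\<in>A. c w * cnj (c z) * (2 * ip a (K z * a) - ip a a) * k z w)"
    unfolding plus_complex.sel(1)[symmetric] sum.distrib[symmetric] x_def
    by (intro arg_cong[of _ _ Re] sum.cong refl) (simp add: algebra_simps)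
  also have "Re (ip (a * kernel_comb A c) (a * kernel_comb A c)) = (hnorm ip (a * kernel_comb A c))\<^sup>2"
  proof -
    have "a * kernel_comb A c = (\<Sum>w\<in>A. cscale (c w) (x w))"
      by (simp add: fun_eq_iff kernel_comb_def sum_fun_apply x_def sum_distrib_left mult_ac)
    then show ?thesis using xH by (simp add: hnorm_sq)
  qed
  finally show ?thesis .
qed

end

section \<open>Bounded rows and columns\<close>

context hilbert_function_space
begin

lemma hlim_ip_both:
  assumes F: "\<And>n. F n \<in> H" "f \<in> H" "hlim ip F f" and G: "\<And>n. G n \<in> H" "g \<in> H" "hlim ip G g"
  shows "(\<lambda>n. ip (F n) (G n)) \<longlonglongrightarrow> ip f g"
proof -
  have "(\<lambda>n. hnorm ip (F n - f) * hnorm ip (G n) + hnorm ip f * hnorm ip (G n - g))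
      \<longlonglongrightarrow> 0 * hnorm ip g + hnorm ip f * 0"
    by (intro tendsto_intros hlim_hnorm G F(3)[unfolded hlim_def] G(3)[unfolded hlim_def])
  then have "(\<lambda>n. hnorm ip (F n - f) * hnorm ip (G n) + hnorm ip f * hnorm ip (G n - g)) \<longlonglongrightarrow> 0"
    by simp
  then have "(\<lambda>n. ip (F n) (G n) - ip f g) \<longlonglongrightarrow> 0"
  proof (rule Lim_null_comparison[rotated], intro always_eventually allI)
    fix n
    have "ip (F n) (G n) - ip f g = ip (F n - f) (G n) + ip f (G n - g)"
      using F G by (simp add: ip_diff_left ip_diff_right)
    then show "norm (ip (F n) (G n) - ip f g)
        \<le> hnorm ip (F n - f) * hnorm ip (G n) + hnorm ip f * hnorm ip (G n - g)"
      using F G cauchy_schwarz by (auto intro!: order.trans[OF norm_triangle_ineq] add_mono)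
  qed
  then show ?thesis by (simp add: LIM_zero_iff)
qed

lemma Mult_mem: "\<lbrakk>\<phi> \<in> Mult X H; f \<in> H\<rbrakk> \<Longrightarrow> \<phi> * f \<in> H"
  by (auto simp: Mult_def)

lemma Mult_zero: "0 \<in> Mult X H"
  by (auto simp: Mult_def vanishes_off_def)

lemma Mult_scale: "\<phi> \<in> Mult X H \<Longrightarrow> cscale c \<phi> \<in> Mult X H"
  by (auto simp: Mult_def vanishes_off_def times_cscale)

text \<open>
  The inclusion of \<open>M_C\<close> in \<open>M_R\<close> carries no constant; one is obtained by gluing a sequence of
  bad columns, scaled by \<open>2\<^sup>-\<^sup>j\<close>, into a single bounded column.
\<close>

lemma uniform_row_bound:
  assumes incl: "M_C X H ip \<subseteq> M_R X H ip"
  obtains C where "0 \<le> C"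
    "\<And>(N::nat) \<phi> h. \<lbrakk>\<And>n. n < N \<Longrightarrow> \<phi> n \<in> Mult X H;
        \<And>x. x \<in> H \<Longrightarrow> (\<Sum>n<N. (hnorm ip (\<phi> n * x))\<^sup>2) \<le> (hnorm ip x)\<^sup>2; \<And>n. n < N \<Longrightarrow> h n \<in> H\<rbrakk>
      \<Longrightarrow> (hnorm ip (\<Sum>n<N. \<phi> n * h n))\<^sup>2 \<le> C * (\<Sum>n<N. (hnorm ip (h n))\<^sup>2)"
proof -
  define good where "good N \<phi> h \<longleftrightarrow> (\<forall>n<N. \<phi> n \<in> Mult X H \<and> h n \<in> H) \<and>
      (\<forall>x\<in>H. (\<Sum>n<N. (hnorm ip (\<phi> n * x))\<^sup>2) \<le> (hnorm ip x)\<^sup>2)" for N :: nat and \<phi> h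
  have "\<exists>C\<ge>0. \<forall>N \<phi> h. good N \<phi> h \<longrightarrow>
      (hnorm ip (\<Sum>n<N. \<phi> n * h n))\<^sup>2 \<le> C * (\<Sum>n<N. (hnorm ip (h n))\<^sup>2)"
  proof (rule ccontr)
    assume neg: "\<not> ?thesis"
    \<comment> \<open>Scaling block \<open>j\<close> by \<open>(1/2) ^ j\<close> costs a factor
      \<open>4 ^ j\<close> in squared norms; a failure by \<open>16 ^ j\<close> still leaves the
      unbounded factor \<open>4 ^ j\<close>.\<close>
    have ex: "\<exists>N \<phi> h. good N \<phi> h \<and>
        16 ^ j * (\<Sum>n<N. (hnorm ip (h n))\<^sup>2) < (hnorm ip (\<Sum>n<N. \<phi> n * h n))\<^sup>2" for j :: nat
    proof -
      have "0 \<le> (16 :: real) ^ j" by simp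
      then have "\<not> (\<forall>N \<phi> h. good N \<phi> h \<longrightarrow>
          (hnorm ip (\<Sum>n<N. \<phi> n * h n))\<^sup>2 \<le> 16 ^ j * (\<Sum>n<N. (hnorm ip (h n))\<^sup>2))"
        using neg by blast
      then show ?thesis unfolding not_all not_imp not_le .
    qed
    define bad where "bad j N \<phi> h \<longleftrightarrow> good N \<phi> h \<and>
        16 ^ j * (\<Sum>n<N. (hnorm ip (h n))\<^sup>2) < (hnorm ip (\<Sum>n<N. \<phi> n * h n))\<^sup>2" for j N \<phi> h
    have "\<forall>j. \<exists>N \<phi> h. bad j N \<phi> h" using ex unfolding bad_def by blast
    from choice[OF this] obtain N where "\<forall>j. \<exists>\<phi> h. bad j (N j) \<phi> h" by blast
    from choice[OF this] obtain \<phi> where "\<forall>j. \<exists>h. bad j (N j) (\<phi> j) h" by blast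
    from choice[OF this] obtain h where "\<forall>j. bad j (N j) (\<phi> j) (h j)" by blast
    then have good: "\<And>j. good (N j) (\<phi> j) (h j)" and
      bad: "\<And>j. 16 ^ j * (\<Sum>n<N j. (hnorm ip (h j n))\<^sup>2) < (hnorm ip (\<Sum>n<N j. \<phi> j n * h j n))\<^sup>2"
      unfolding bad_def by blast+
    have \<phi>: "\<phi> j n \<in> Mult X H" and h: "h j n \<in> H" if "n < N j" for j n
      using good[of j] that by (auto simp: good_def)
    have col: "(\<Sum>n<N j. (hnorm ip (\<phi> j n * x))\<^sup>2) \<le> (hnorm ip x)\<^sup>2" if "x \<in> H" for j x
      using good[of j] that by (auto simp: good_def)
    define \<Phi> where "\<Phi> i = (case prod_decode i of (j, n) \<Rightarrow>
        if n < N j then cscale ((1/2) ^ j) (\<phi> j n) else 0)" for i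
    have \<Phi>_Mult: "\<Phi> i \<in> Mult X H" for i
      by (auto simp: \<Phi>_def Mult_zero Mult_scale \<phi> split: prod.split)
    have partial: "(\<Sum>i<I. (hnorm ip (\<Phi> i * x))\<^sup>2) \<le> 2 * (hnorm ip x)\<^sup>2" if x: "x \<in> H" for I x
    proof -
      define q where "q = (\<lambda>(j, n). if n < N j then (1/4) ^ j * (hnorm ip (\<phi> j n * x))\<^sup>2 else 0)"
      have q_nonneg: "0 \<le> q p" for p by (auto simp: q_def split: prod.split)
      have "(hnorm ip (\<Phi> i * x))\<^sup>2 = q (prod_decode i)" for i
        using Mult_mem[OF \<phi> x]
        by (auto simp: q_def \<Phi>_def times_cscale norm_power power_mult_distrib power2_eq_square
            split: prod.split simp flip: power_mult_distrib)
      then have "(\<Sum>i<I. (hnorm ip (\<Phi> i * x))\<^sup>2) = (\<Sum>p\<in>prod_decode ` {..<I}. q p)"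
        by (subst sum.reindex) (auto simp: inj_on_def)
      \<comment> \<open>A code is at least as large as both entries of its pair, so the first
        \<open>I\<close> codes fit into a square.\<close>
      also have "\<dots> \<le> (\<Sum>p\<in>{..<I} \<times> {..<I}. q p)"
      proof (rule sum_mono2)
        show "prod_decode ` {..<I} \<subseteq> {..<I} \<times> {..<I}"
        proof
          fix p assume "p \<in> prod_decode ` {..<I}"
          then obtain i where i: "i < I" "p = prod_decode i" by auto
          then have "prod_encode (fst p, snd p) < I" by simp
          then show "p \<in> {..<I} \<times> {..<I}"
            using le_prod_encode_1[of "fst p" "snd p"] le_prod_encode_2[of "snd p" "fst p"]
            by (simp add: mem_Times_iff)
        qed
      qed (auto simp: q_nonneg)
      also have "\<dots> = (\<Sum>j<I. \<Sum>n<I. q (j, n))"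
        by (simp add: sum.cartesian_product)
      also have "\<dots> \<le> (\<Sum>j<I. (1/4) ^ j * (hnorm ip x)\<^sup>2)"
      proof (rule sum_mono)
        fix j
        have "(\<Sum>n<I. q (j, n)) = (\<Sum>n\<in>{..<I} \<inter> {..<N j}. (1/4) ^ j * (hnorm ip (\<phi> j n * x))\<^sup>2)"
          by (subst sum.inter_restrict) (auto simp: q_def intro!: sum.cong)
        also have "\<dots> \<le> (\<Sum>n<N j. (1/4) ^ j * (hnorm ip (\<phi> j n * x))\<^sup>2)"
          by (rule sum_mono2) auto
        also have "\<dots> \<le> (1/4) ^ j * (hnorm ip x)\<^sup>2"
          unfolding sum_distrib_left[symmetric] using col[OF x] by (intro mult_left_mono) auto
        finally show "(\<Sum>n<I. q (j, n)) \<le> (1/4) ^ j * (hnorm ip x)\<^sup>2" .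
      qed
      also have "\<dots> = (\<Sum>j<I. (1/4) ^ j) * (hnorm ip x)\<^sup>2" by (simp add: sum_distrib_right)
      also have "\<dots> \<le> 2 * (hnorm ip x)\<^sup>2"
      proof (rule mult_right_mono)
        show "(\<Sum>j<I. (1/4) ^ j) \<le> (2::real)"
          by (simp add: sum_gp_strict) (rule order.trans[of _ 0], auto)
      qed simp
      finally show ?thesis .
    qed
    have "\<Phi> \<in> M_C X H ip"
      unfolding M_C_def
    proof (intro CollectI conjI allI ballI \<Phi>_Mult exI)
      fix x assume x: "x \<in> H"
      have summ: "summable (\<lambda>i. (hnorm ip (\<Phi> i * x))\<^sup>2)"
      proof (rule bounded_imp_summable)
        show "(\<Sum>i\<le>n. (hnorm ip (\<Phi> i * x))\<^sup>2) \<le> 2 * (hnorm ip x)\<^sup>2" for n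
          using partial[OF x, of "Suc n"] by (simp only: lessThan_Suc_atMost)
      qed simp
      then show "column_op \<Phi> x \<in> dsum H ip"
        using Mult_mem[OF \<Phi>_Mult x] by (simp add: dsum_def column_op_def)
      have "(\<Sum>i. (hnorm ip (\<Phi> i * x))\<^sup>2) \<le> 2 * (hnorm ip x)\<^sup>2"
        by (rule suminf_le_const[OF summ partial[OF x]])
      then have "dsum_norm ip (column_op \<Phi> x) \<le> sqrt (2 * (hnorm ip x)\<^sup>2)"
        by (simp add: dsum_norm_def column_op_def)
      then show "dsum_norm ip (column_op \<Phi> x) \<le> sqrt 2 * hnorm ip x"
        using x by (simp add: real_sqrt_mult)
    qed
    then obtain C where C: "\<And>v. v \<in> dsum H ip \<Longrightarrow>
        \<exists>g. row_op_value H ip \<Phi> v g \<and> hnorm ip g \<le> C * dsum_norm ip v"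
      using incl unfolding M_R_def by blast
    have block: "4 ^ j < C\<^sup>2" for j :: nat
    proof -
      define S where "S = (\<Sum>n<N j. (hnorm ip (h j n))\<^sup>2)"
      define r where "r = (\<Sum>n<N j. \<phi> j n * h j n)"
      have r: "r \<in> H" unfolding r_def by (intro sum_mem Mult_mem \<phi> h) auto
      \<comment> \<open>An input supported on the codes of block \<open>j\<close>: the row series is
        eventually constant, so its limit must be the scaled bad row.\<close>
      define v where "v i = (case prod_decode i of (j', n) \<Rightarrow> if j' = j \<and> n < N j then h j n else 0)" for i
      define E where "E = (\<lambda>n. prod_encode (j, n)) ` {..<N j}"
      have E: "finite E" by (simp add: E_def)
      have inj: "inj_on (\<lambda>n. prod_encode (j, n)) {..<N j}" by (auto simp: inj_on_def)
      have v_off: "v i = 0" if "i \<notin> E" for i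
        using that by (auto simp: v_def E_def image_iff split: prod.split) (metis lessThan_iff prod_decode_inverse)
      have v_on: "v (prod_encode (j, n)) = h j n" if "n < N j" for n using that by (simp add: v_def)
      have v_sum: "(\<lambda>i. (hnorm ip (v i))\<^sup>2) sums S"
      proof -
        have "(\<lambda>i. (hnorm ip (v i))\<^sup>2) sums (\<Sum>i\<in>E. (hnorm ip (v i))\<^sup>2)"
          by (rule sums_finite) (use E v_off in auto)
        also have "(\<Sum>i\<in>E. (hnorm ip (v i))\<^sup>2) = S"
          unfolding E_def S_def by (subst sum.reindex[OF inj]) (auto simp: v_on)
        finally show ?thesis .
      qed
      have v_dsum: "v \<in> dsum H ip"
        using v_sum h by (auto simp: dsum_def sums_iff v_def split: prod.split)
      have v_norm: "dsum_norm ip v = sqrt S"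
        using v_sum by (simp add: dsum_norm_def sums_iff)
      have row: "(\<Sum>i<M. \<Phi> i * v i) = cscale ((1/2) ^ j) r" if M: "\<forall>i\<in>E. i < M" for M
      proof -
        have "(\<Sum>i<M. \<Phi> i * v i) = (\<Sum>i\<in>E. \<Phi> i * v i)"
          by (rule sum.mono_neutral_right) (use M v_off in auto)
        also have "\<dots> = (\<Sum>n<N j. cscale ((1/2) ^ j) (\<phi> j n * h j n))"
          unfolding E_def by (subst sum.reindex[OF inj]) (auto simp: v_on \<Phi>_def times_cscale)
        finally show ?thesis by (simp add: r_def cfun.scale_sum_right)
      qed
      obtain g where g: "g \<in> H" "hlim ip (\<lambda>M. \<Sum>i<M. \<Phi> i * v i) g" "hnorm ip g \<le> C * sqrt S"
        using C[OF v_dsum] v_norm by (auto simp: row_op_value_def)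
      have ev: "\<forall>\<^sub>F M in sequentially. hnorm ip ((\<Sum>i<M. \<Phi> i * v i) - g) = hnorm ip (cscale ((1/2) ^ j) r - g)"
      proof -
        obtain M0 where "\<forall>i\<in>E. i < M0" using E finite_nat_set_iff_bounded by blast
        then show ?thesis
          unfolding eventually_sequentially using row by (metis order_less_le_trans)
      qed
      have "hnorm ip (cscale ((1/2) ^ j) r - g) = 0"
        using g(2) unfolding hlim_def tendsto_cong[OF ev] by (simp only: LIMSEQ_const_iff)
      then have "g = cscale ((1/2) ^ j) r" using g r by (simp add: hnorm_eq_0)
      then have "(1/2) ^ j * hnorm ip r \<le> C * sqrt S" using g r by (simp add: norm_power)
      then have "((1/2) ^ j * hnorm ip r)\<^sup>2 \<le> (C * sqrt S)\<^sup>2"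
        using r by (intro power_mono) auto
      have "0 \<le> S" unfolding S_def by (intro sum_nonneg) auto
      have "(1/4) ^ j * (hnorm ip r)\<^sup>2 \<le> C\<^sup>2 * S"
      proof -
        have "((1/2 :: real) ^ j)\<^sup>2 = (1/4) ^ j"
          by (simp add: power2_eq_square flip: power_mult_distrib)
        then show ?thesis
          using \<open>((1/2) ^ j * hnorm ip r)\<^sup>2 \<le> (C * sqrt S)\<^sup>2\<close> \<open>0 \<le> S\<close>
          by (simp add: power_mult_distrib)
      qed
      moreover have "(1/4) ^ j * (16 ^ j * S) < (1/4) ^ j * (hnorm ip r)\<^sup>2"
        using bad[of j] by (intro mult_strict_left_mono) (auto simp: S_def r_def)
      moreover have "(1/4) ^ j * (16 ^ j * S) = 4 ^ j * S"
        by (simp add: mult.assoc[symmetric] flip: power_mult_distrib)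
      ultimately have "4 ^ j * S < C\<^sup>2 * S" by simp
      then show ?thesis using \<open>0 \<le> S\<close> by (simp add: mult_less_cancel_right)
    qed
    obtain j where "C\<^sup>2 < 4 ^ j" using real_arch_pow[of 4 "C\<^sup>2"] by auto
    then show False using block[of j] by simp
  qed
  then obtain C where C: "0 \<le> C" "\<And>N \<phi> h. good N \<phi> h \<Longrightarrow>
      (hnorm ip (\<Sum>n<N. \<phi> n * h n))\<^sup>2 \<le> C * (\<Sum>n<N. (hnorm ip (h n))\<^sup>2)"
    by blast
  show ?thesis
  proof (rule that)
    show "0 \<le> C" by (rule C(1))
    fix N :: nat and \<phi> h
    assume "\<And>n. n < N \<Longrightarrow> \<phi> n \<in> Mult X H" "\<And>n. n < N \<Longrightarrow> h n \<in> H"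
      and "\<And>x. x \<in> H \<Longrightarrow> (\<Sum>n<N. (hnorm ip (\<phi> n * x))\<^sup>2) \<le> (hnorm ip x)\<^sup>2"
    then have "good N \<phi> h" by (simp add: good_def)
    then show "(hnorm ip (\<Sum>n<N. \<phi> n * h n))\<^sup>2 \<le> C * (\<Sum>n<N. (hnorm ip (h n))\<^sup>2)"
      by (rule C(2))
  qed
qed

end

context complete_pick_space
begin

section \<open>Sarason functions of kernel combinations and the multiplier built from them\<close>

lemma hlim_bounded_multiplier:
  assumes "bounded_multiplier \<phi>" "\<And>n. F n \<in> H" "f \<in> H" "hlim ip F f"
  shows "hlim ip (\<lambda>n. \<phi> * F n) (\<phi> * f)"
proof -
  obtain C where C: "\<And>h. h \<in> H \<Longrightarrow> \<phi> * h \<in> H" "\<And>h. h \<in> H \<Longrightarrow> hnorm ip (\<phi> * h) \<le> C * hnorm ip h"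
    using assms(1) unfolding bounded_multiplier_def by blast
  have "(\<lambda>n. C * hnorm ip (F n - f)) \<longlonglongrightarrow> 0"
    using assms(4) tendsto_mult_right_zero unfolding hlim_def by blast
  then show ?thesis
    unfolding hlim_def
    by (rule Lim_null_comparison[rotated])
      (use assms C in \<open>auto simp flip: right_diff_distrib\<close>)
qed

text \<open>Expanding one copy of \<open>a\<close> in kernels evaluates the other copy at finitely
  many points. So for a kernel combination \<open>a\<close> the function is again a kernel
  combination, in particular a bounded multiplier.\<close>

lemma sarason_function:
  assumes "a \<in> kernel_span"
  obtains D where "D \<in> kernel_span" "\<And>z. z \<in> X \<Longrightarrow> D z = ip a (K z * a)"
proof -
  obtain A d where A: "finite A" "A \<subseteq> X" "a = kernel_comb A d"
    using assms by (auto simp: kernel_span_def)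
  define D where "D = kernel_comb A (\<lambda>v. d v * cnj (a v))"
  have "D z = ip a (K z * a)" if z: "z \<in> X" for z
  proof -
    have a: "a \<in> H" using A by simp
    have "ip a (K z * a) = cnj (ip (K z * a) (kernel_comb A d))"
      using ip_commute[of "K z * a" a] z a A by simp
    also have "\<dots> = (\<Sum>v\<in>A. d v * (cnj (k v z) * cnj (a v)))"
      using z a A by (simp add: ip_kernel_comb)
    also have "\<dots> = (\<Sum>v\<in>A. d v * cnj (a v) * k z v)"
      using kernel_herm[of _ z] z A by (intro sum.cong) (auto simp: subset_iff mult_ac)
    finally show ?thesis by (simp add: D_def kernel_comb_def sum_fun_apply)
  qed
  moreover have "D \<in> kernel_span" using A by (auto simp: D_def kernel_span_def)
  ultimately show ?thesis using that by blast
qed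

text \<open>For a kernel combination \<open>g\<close> the double sum of
  \<open>sarason_inequality\<close> is the quadratic form of multiplication by the Sarason function.
  Both sides are continuous in \<open>g\<close> because \<open>a\<close> and \<open>D\<close> are
  bounded multipliers, so density finishes.\<close>

lemma sarason_operator_inequality:
  assumes a: "a \<in> kernel_span" and D: "D \<in> kernel_span" "\<And>z. z \<in> X \<Longrightarrow> D z = ip a (K z * a)"
    and g: "g \<in> H"
  shows "(hnorm ip (a * g))\<^sup>2 \<le> 2 * Re (ip (D * g) g) - (hnorm ip a)\<^sup>2 * (hnorm ip g)\<^sup>2"
proof -
  have aH: "a \<in> H" using a kernel_span_mem by blast
  note mult = bounded_multiplier_span[OF a] bounded_multiplier_span[OF D(1)]
  have on_span: "(hnorm ip (a * g))\<^sup>2 \<le> 2 * Re (ip (D * g) g) - (hnorm ip a)\<^sup>2 * (hnorm ip g)\<^sup>2"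
    if span: "g \<in> kernel_span" for g
  proof -
    obtain A c where A: "finite A" "A \<subseteq> X" and g: "g = kernel_comb A c"
      using span unfolding kernel_span_def by blast
    have gH: "g \<in> H" using A g by simp
    have "(\<Sum>w\<in>A. \<Sum>z\<in>A. c w * cnj (c z) * (2 * ip a (K z * a) - ip a a) * k z w)
        = (\<Sum>z\<in>A. cnj (c z) * ((2 * D z - ip a a) * (\<Sum>w\<in>A. c w * k z w)))"
    proof (subst sum.swap, rule sum.cong[OF refl])
      fix z assume "z \<in> A"
      then have "D z = ip a (K z * a)" using D(2) A by blast
      then show "(\<Sum>w\<in>A. c w * cnj (c z) * (2 * ip a (K z * a) - ip a a) * k z w)
          = cnj (c z) * ((2 * D z - ip a a) * (\<Sum>w\<in>A. c w * k z w))"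
        by (simp only: sum_distrib_left) (intro sum.cong refl, simp only: mult_ac)
    qed
    also have "\<dots> = (\<Sum>z\<in>A. cnj (c z) * ((2 * D z - ip a a) * g z))"
      by (simp add: g kernel_comb_def sum_fun_apply)
    also have "\<dots> = 2 * ip (D * g) g - ip a a * ip g g"
    proof -
      have "ip (D * g) g = (\<Sum>z\<in>A. cnj (c z) * (D z * g z))"
        using ip_kernel_comb[OF bounded_multiplier_mem[OF mult(2) gH] A(2), of c] by (simp add: g)
      moreover have "ip g g = (\<Sum>z\<in>A. cnj (c z) * g z)"
        using ip_kernel_comb[OF gH A(2), of c] by (simp add: g)
      ultimately show ?thesis
        by (simp add: sum_distrib_left sum_subtractf algebra_simps)
    qed
    finally show ?thesis
      using sarason_inequality[OF aH A, of c] gH aH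
      by (simp add: g[symmetric] ip_self del: of_real_power)
  qed
  obtain F where F: "\<And>n. F n \<in> kernel_span" "hlim ip F g" using kernel_span_dense g by blast
  have FH: "F n \<in> H" for n using F(1) kernel_span_mem by blast
  have lims: "hlim ip (\<lambda>n. a * F n) (a * g)" "hlim ip (\<lambda>n. D * F n) (D * g)"
    using hlim_bounded_multiplier mult FH F(2) g by blast+
  have mem: "a * F n \<in> H" "D * F n \<in> H" "a * g \<in> H" "D * g \<in> H" for n
    using bounded_multiplier_mem mult FH g by blast+
  have "(\<lambda>n. (hnorm ip (a * F n))\<^sup>2) \<longlonglongrightarrow> (hnorm ip (a * g))\<^sup>2"
    by (intro tendsto_power hlim_hnorm mem lims)
  moreover have "(\<lambda>n. 2 * Re (ip (D * F n) (F n)) - (hnorm ip a)\<^sup>2 * (hnorm ip (F n))\<^sup>2)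
      \<longlonglongrightarrow> 2 * Re (ip (D * g) g) - (hnorm ip a)\<^sup>2 * (hnorm ip g)\<^sup>2"
    by (intro tendsto_intros hlim_hnorm hlim_ip_both mem lims F FH g)
  ultimately show ?thesis by (rule LIMSEQ_le) (use on_span F in blast)
qed

text \<open>
  With the Sarason function \<open>V = 2 D - s\<close> of the column \<open>a\<close>, the factor is \<open>\<theta> = 1 / (1 + V / 2)\<close>.
\<close>

lemma column_factor:
  assumes a: "\<And>n. n < N \<Longrightarrow> a n \<in> kernel_span"
    and C: "\<And>w h. \<lbrakk>w \<in> X; h \<in> H\<rbrakk> \<Longrightarrow> hnorm ip (K w * h) \<le> C w * hnorm ip h"
  obtains \<theta> where "\<theta> \<in> Mult X H"
    "\<And>h. h \<in> H \<Longrightarrow> (hnorm ip (\<theta> * h))\<^sup>2 + (\<Sum>n<N. (hnorm ip (a n * \<theta> * h))\<^sup>2) \<le> (hnorm ip h)\<^sup>2"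
    "\<And>z. z \<in> X \<Longrightarrow> cmod (\<theta> z) \<le> 1"
    "\<And>z. z \<in> X \<Longrightarrow> cmod (1 - \<theta> z) \<le> (C z + 1/2) * (\<Sum>n<N. (hnorm ip (a n))\<^sup>2)"
proof -
  define s where "s = (\<Sum>n<N. (hnorm ip (a n))\<^sup>2)"
  have aH: "a n \<in> H" if "n < N" for n using a[OF that] kernel_span_mem by blast
  have "\<exists>D. \<forall>n<N. D n \<in> kernel_span \<and> (\<forall>z\<in>X. D n z = ip (a n) (K z * a n))"
    using sarason_function[OF a] by (intro choice) metis
  then obtain D where D: "\<And>n. n < N \<Longrightarrow> D n \<in> kernel_span"
    "\<And>n z. \<lbrakk>n < N; z \<in> X\<rbrakk> \<Longrightarrow> D n z = ip (a n) (K z * a n)" by blast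
  define W where "W z = of_real (1 - s / 2) + (\<Sum>n<N. D n z)" for z
  have W_mult: "W * g = cscale (of_real (1 - s / 2)) g + (\<Sum>n<N. D n * g)" for g
    by (simp add: fun_eq_iff W_def sum_fun_apply distrib_right sum_distrib_right)
  have Dg: "D n * g \<in> H" if "g \<in> H" "n < N" for g n
    using bounded_multiplier_mem[OF bounded_multiplier_span[OF D(1)]] that by blast
  have WH: "W * g \<in> H" if "g \<in> H" for g
    unfolding W_mult using that Dg by (intro mem_closed sum_mem) auto
  have acc: "(hnorm ip g)\<^sup>2 + (\<Sum>n<N. (hnorm ip (a n * g))\<^sup>2) / 2 \<le> Re (ip (W * g) g)" if g: "g \<in> H" for g
  proof -
    have "(\<Sum>n<N. (hnorm ip (a n * g))\<^sup>2)
        \<le> (\<Sum>n<N. 2 * Re (ip (D n * g) g) - (hnorm ip (a n))\<^sup>2 * (hnorm ip g)\<^sup>2)"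
      by (intro sum_mono sarason_operator_inequality a D g) auto
    also have "\<dots> = 2 * (\<Sum>n<N. Re (ip (D n * g) g)) - s * (hnorm ip g)\<^sup>2"
      by (simp add: sum_subtractf sum_distrib_left sum_distrib_right s_def)
    finally have "(\<Sum>n<N. (hnorm ip (a n * g))\<^sup>2) \<le> 2 * (\<Sum>n<N. Re (ip (D n * g) g)) - s * (hnorm ip g)\<^sup>2" .
    moreover have "ip (W * g) g = of_real (1 - s / 2) * ip g g + (\<Sum>n<N. ip (D n * g) g)"
    proof -
      have "(\<Sum>n<N. D n * g) \<in> H" by (intro sum_mem Dg g) simp
      moreover have "ip (\<Sum>n<N. D n * g) g = (\<Sum>n<N. ip (D n * g) g)"
        by (intro ip_sum_left Dg g) simp
      ultimately show ?thesis
        unfolding W_mult using g by (simp only: ip_add_left ip_scale_left mem_closed)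
    qed
    then have "Re (ip (W * g) g) = (1 - s / 2) * (hnorm ip g)\<^sup>2 + (\<Sum>n<N. Re (ip (D n * g) g))"
      using g by (simp add: ip_self del: of_real_power)
    ultimately show ?thesis by (simp add: algebra_simps)
  qed
  have acc1: "1 * (hnorm ip g)\<^sup>2 \<le> Re (ip (W * g) g)" if "g \<in> H" for g
    using acc[OF that] sum_nonneg[of "{..<N}" "\<lambda>n. (hnorm ip (a n * g))\<^sup>2"] by simp
  have Re_W: "1 \<le> Re (W z)" if "z \<in> X" for z
    by (rule inverse_multiplier(1)[OF WH acc1]) (use that in auto)
  define \<theta> where "\<theta> z = indicator X z / W z" for z
  have \<theta>_mult: "\<theta> * h = (\<lambda>z. h z / W z)" if "h \<in> H" for h
    using off_X[OF that] by (auto simp: fun_eq_iff \<theta>_def indicator_def)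
  have \<theta>H: "\<theta> * h \<in> H" if "h \<in> H" for h
    unfolding \<theta>_mult[OF that] by (rule inverse_multiplier(2)[OF WH acc1]) (use that in auto)
  have \<theta>_bound: "(hnorm ip (\<theta> * h))\<^sup>2 + (\<Sum>n<N. (hnorm ip (a n * \<theta> * h))\<^sup>2) \<le> (hnorm ip h)\<^sup>2"
    if h: "h \<in> H" for h
  proof -
    define g where "g = \<theta> * h"
    have g: "g \<in> H" using \<theta>H h by (simp add: g_def)
    have "W z * g z = h z" for z
      using Re_W[of z] off_X[OF h, of z] by (cases "z \<in> X") (auto simp: g_def \<theta>_def)
    then have Wg: "W * g = h" by auto
    \<comment> \<open>The cross term of this splitting doubles the column term of \<open>acc\<close>
      to its full size; this is why the Sarason function enters \<open>W\<close> with weight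
      1/2.\<close>
    have "h = g + (h - g)" by simp
    then have "(hnorm ip h)\<^sup>2 = (hnorm ip g)\<^sup>2 + (hnorm ip (h - g))\<^sup>2 + 2 * Re (ip g (h - g))"
      using hnorm_add_sq[of g "h - g"] g h by simp
    moreover have "Re (ip g (h - g)) = Re (ip h g) - (hnorm ip g)\<^sup>2"
      using g h ip_commute[of h g] by (simp add: ip_diff_right hnorm_sq)
    moreover have "(hnorm ip g)\<^sup>2 + (\<Sum>n<N. (hnorm ip (a n * g))\<^sup>2) / 2 \<le> Re (ip h g)"
      using acc[OF g] Wg by simp
    moreover have "0 \<le> (hnorm ip (h - g))\<^sup>2" by simp
    ultimately have "(hnorm ip g)\<^sup>2 + (\<Sum>n<N. (hnorm ip (a n * g))\<^sup>2) \<le> (hnorm ip h)\<^sup>2"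
      by linarith
    then show ?thesis by (simp only: g_def mult.assoc)
  qed
  have W_ge: "1 \<le> cmod (W z)" if "z \<in> X" for z
    using Re_W[OF that] complex_Re_le_cmod[of "W z"] by linarith
  have \<theta>_le: "cmod (\<theta> z) \<le> 1" if "z \<in> X" for z
    using W_ge[OF that] that by (simp add: \<theta>_def norm_divide divide_le_eq_1)
  have "cmod (1 - \<theta> z) \<le> (C z + 1/2) * s" if z: "z \<in> X" for z
  proof -
    \<comment> \<open>Since \<open>\<theta>\<close> is bounded by 1, closeness to 1 is governed by
      \<open>W - 1\<close>, whose size is at most a multiple of \<open>s\<close>.\<close>
    have "1 - \<theta> z = (W z - 1) * \<theta> z"
    proof -
      have "W z \<noteq> 0" using W_ge[OF z] by auto
      then show ?thesis using z by (simp add: \<theta>_def field_simps)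
    qed
    then have "cmod (1 - \<theta> z) \<le> cmod (W z - 1)"
      using \<theta>_le[OF z] by (simp add: norm_mult mult_left_le)
    also have "W z - 1 = (\<Sum>n<N. D n z) - of_real (s / 2)" by (simp add: W_def)
    also have "cmod \<dots> \<le> (\<Sum>n<N. cmod (D n z)) + cmod (of_real (s / 2))"
      by (rule order.trans[OF norm_triangle_ineq4]) (intro add_mono norm_sum order.refl)
    also have "(\<Sum>n<N. cmod (D n z)) \<le> (\<Sum>n<N. C z * (hnorm ip (a n))\<^sup>2)"
    proof (rule sum_mono)
      fix n assume "n \<in> {..<N}"
      then have n: "n < N" by simp
      have "cmod (D n z) \<le> hnorm ip (a n) * hnorm ip (K z * a n)"
        using D(2)[OF n z] cauchy_schwarz[of "a n" "K z * a n"] aH[OF n] z by simp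
      also have "\<dots> \<le> hnorm ip (a n) * (C z * hnorm ip (a n))"
        by (intro mult_left_mono C z aH n hnorm_nonneg)
      finally show "cmod (D n z) \<le> C z * (hnorm ip (a n))\<^sup>2" by (simp add: power2_eq_square mult_ac)
    qed
    also have "(\<Sum>n<N. C z * (hnorm ip (a n))\<^sup>2) + cmod (of_real (s / 2)) = (C z + 1/2) * s"
    proof -
      have "0 \<le> s" unfolding s_def by (intro sum_nonneg) auto
      then show ?thesis by (simp add: s_def[symmetric] sum_distrib_left[symmetric] distrib_right norm_divide)
    qed
    finally show ?thesis by simp
  qed
  moreover have "\<theta> \<in> Mult X H" using \<theta>H by (simp add: Mult_def vanishes_off_def \<theta>_def)
  ultimately show ?thesis
    by (intro that[of \<theta>] \<theta>_bound \<theta>_le) (simp_all only: s_def)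
qed

end

section \<open>Weak products\<close>

context hilbert_function_space
begin

text \<open>Moving a scalar from one factor to the other keeps the product and distributes its cost
  as \<open>l\<close> to \<open>1 / l\<close>. The new second factor is a multiple of
  \<open>b\<close>, so membership in a subspace survives.\<close>

lemma balance_product:
  assumes a: "a \<in> H" and b: "b \<in> H" and l: "0 < l"
  obtains \<alpha> \<beta> c where "\<alpha> \<in> H" "\<beta> = cscale c b" "\<alpha> * \<beta> = a * b"
    "(hnorm ip \<alpha>)\<^sup>2 \<le> l * (hnorm ip a * hnorm ip b)"
    "(hnorm ip \<beta>)\<^sup>2 \<le> hnorm ip a * hnorm ip b / l"
proof (cases "hnorm ip a = 0 \<or> hnorm ip b = 0")
  case True
  then have "a * b = 0" using a b hnorm_eq_0 by auto
  then show ?thesis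
    using that[of 0 "cscale 0 b" 0] True by (auto simp: cfun.scale_zero_left)
next
  case False
  define r where "r = sqrt (l * hnorm ip b / hnorm ip a)"
  have pos: "0 < hnorm ip a" "0 < hnorm ip b" using False a b by (auto simp: less_le)
  then have r2: "r\<^sup>2 = l * hnorm ip b / hnorm ip a" and r: "0 < r" using l by (auto simp: r_def)
  show ?thesis
  proof (rule that)
    show "cscale (of_real r) a \<in> H" using a by simp
    show "cscale (of_real (1/r)) b = cscale (of_real (1/r)) b" ..
    show "cscale (of_real r) a * cscale (of_real (1/r)) b = a * b"
      using r by (auto simp: fun_eq_iff)
    show "(hnorm ip (cscale (of_real r) a))\<^sup>2 \<le> l * (hnorm ip a * hnorm ip b)"
      using a pos by (simp add: power_mult_distrib r2) (simp add: power2_eq_square)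
    show "(hnorm ip (cscale (of_real (1/r)) b))\<^sup>2 \<le> hnorm ip a * hnorm ip b / l"
      using b pos l by (simp add: power_mult_distrib power_divide norm_divide r2)
        (simp add: power2_eq_square mult.commute)
  qed
qed

text \<open>
  Quotient seminorm of the weak product \<open>H \<odot> H\<close> by the closure of \<open>M \<odot> H\<close>: the terms whose
  second factor lies in \<open>M\<close> are free of charge.
\<close>

definition weak_rep :: "('x \<Rightarrow> complex) set \<Rightarrow> ('x \<Rightarrow> complex) \<Rightarrow> real \<Rightarrow> bool" where
  "weak_rep M h s \<longleftrightarrow> vanishes_off X h \<and> (\<exists>a b. (\<forall>n::nat. a n \<in> H \<and> b n \<in> H) \<and>
     summable (\<lambda>n. hnorm ip (a n) * hnorm ip (b n)) \<and>
     (\<forall>z\<in>X. (\<lambda>n. a n z * b n z) sums h z) \<and>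
     (\<Sum>n. if b n \<in> M then 0 else hnorm ip (a n) * hnorm ip (b n)) \<le> s)"

end

context complete_pick_space
begin

text \<open>Pointwise convergence is convergence against kernels; boundedness extends it from their
  dense span to all of \<open>H\<close>.\<close>

lemma bounded_pointwise_null_imp_weakly_null:
  assumes r: "\<And>n::nat. r n \<in> H" "\<And>n. hnorm ip (r n) \<le> B" "\<And>z. z \<in> X \<Longrightarrow> (\<lambda>n. r n z) \<longlonglongrightarrow> 0"
    and y: "y \<in> H"
  shows "(\<lambda>n. ip (r n) y) \<longlonglongrightarrow> 0"
proof (rule LIMSEQ_I)
  fix e :: real assume e: "0 < e"
  have B: "0 \<le> B" using r hnorm_nonneg order.trans by blast
  obtain x where x: "x \<in> kernel_span" "hnorm ip (x - y) < e / (2 * (B + 1))"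
    by (rule kernel_span_approx[OF y, of "e / (2 * (B + 1))"]) (use e B in auto)
  have xH: "x \<in> H" using x kernel_span_mem by blast
  obtain A c where A: "finite A" "A \<subseteq> X" "x = kernel_comb A c"
    using x(1) unfolding kernel_span_def by blast
  have "(\<lambda>n. \<Sum>w\<in>A. cnj (c w) * r n w) \<longlonglongrightarrow> (\<Sum>w\<in>A. cnj (c w) * 0)"
    by (intro tendsto_sum tendsto_mult tendsto_const r) (use A in auto)
  then have "(\<lambda>n. ip (r n) x) \<longlonglongrightarrow> 0"
    using A r(1) by (simp add: ip_kernel_comb)
  then obtain N where N: "\<And>n. n \<ge> N \<Longrightarrow> cmod (ip (r n) x) < e / 2"
    using LIMSEQ_D[of _ 0 "e / 2"] e by force
  have "cmod (ip (r n) y) < e" if n: "n \<ge> N" for n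
  proof -
    have "hnorm ip (r n) * hnorm ip (x - y) \<le> B * (e / (2 * (B + 1)))"
      using r(1,2)[of n] x(2) xH y B by (intro mult_mono) auto
    also have "\<dots> \<le> e / 2" using B e by (simp add: field_simps)
    finally have "cmod (ip (r n) (x - y)) \<le> e / 2"
      using cauchy_schwarz[of "r n" "x - y"] r(1)[of n] xH y by simp
    moreover have "ip (r n) y = ip (r n) x - ip (r n) (x - y)"
      using r(1)[of n] xH y by (simp add: ip_diff_right)
    ultimately show ?thesis
      using N[OF n] norm_triangle_ineq4[of "ip (r n) x" "ip (r n) (x - y)"] by simp
  qed
  then show "\<exists>N. \<forall>n\<ge>N. norm (ip (r n) y - 0) < e" by auto
qed

text \<open>The truncation index is chosen last. The remainder of \<open>\<theta> N * f\<close>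
  after \<open>N\<close> terms is bounded and tends to 0 pointwise, hence weakly, and only its inner
  product with \<open>e\<close> matters. The truncated sum is a row applied to second factors, of
  which \<open>e\<close> sees only those outside \<open>M\<close>.\<close>

lemma weak_rep_approximation:
  assumes M: "multiplier_invariant_subspace X H ip M"
    and C0: "0 \<le> C"
    and C: "\<And>(N::nat) \<phi> h. \<lbrakk>\<And>n. n < N \<Longrightarrow> \<phi> n \<in> Mult X H;
        \<And>x. x \<in> H \<Longrightarrow> (\<Sum>n<N. (hnorm ip (\<phi> n * x))\<^sup>2) \<le> (hnorm ip x)\<^sup>2; \<And>n. n < N \<Longrightarrow> h n \<in> H\<rbrakk>
      \<Longrightarrow> (hnorm ip (\<Sum>n<N. \<phi> n * h n))\<^sup>2 \<le> C * (\<Sum>n<N. (hnorm ip (h n))\<^sup>2)"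
    and Ck: "\<And>w h. \<lbrakk>w \<in> X; h \<in> H\<rbrakk> \<Longrightarrow> hnorm ip (K w * h) \<le> Ck w * hnorm ip h"
    and \<epsilon>: "0 < \<epsilon>" and f: "f \<in> H" and rep: "weak_rep M f \<epsilon>"
    and e: "e \<in> H" and perp: "\<And>x. x \<in> M \<Longrightarrow> ip x e = 0"
  shows "\<exists>\<theta>. (\<forall>h\<in>H. \<theta> * h \<in> H \<and> hnorm ip (\<theta> * h) \<le> hnorm ip h) \<and>
    (\<forall>z\<in>X. cmod (1 - \<theta> z) \<le> (Ck z + 1/2) * (5 * \<epsilon>)) \<and>
    cmod (ip (\<theta> * f) e) \<le> sqrt \<epsilon> + sqrt (C * \<epsilon>) * hnorm ip e"
proof -
  have MH: "M \<subseteq> H" and M_sub: "cfun.subspace M"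
    and M_mult: "\<And>\<phi> g. \<lbrakk>\<phi> \<in> Mult X H; g \<in> M\<rbrakk> \<Longrightarrow> \<phi> * g \<in> M"
    using M by (auto simp: multiplier_invariant_subspace_def)
  obtain a b where aH: "\<And>n::nat. a n \<in> H" and bH: "\<And>n. b n \<in> H"
    and summ: "summable (\<lambda>n. hnorm ip (a n) * hnorm ip (b n))"
    and sums: "\<And>z. z \<in> X \<Longrightarrow> (\<lambda>n. a n z * b n z) sums f z"
    and cost: "(\<Sum>n. if b n \<in> M then 0 else hnorm ip (a n) * hnorm ip (b n)) \<le> \<epsilon>"
    using rep unfolding weak_rep_def by blast
  define t where "t n = hnorm ip (a n) * hnorm ip (b n)" for n
  define t' where "t' n = (if b n \<in> M then 0 else t n)" for n
  define T where "T = (\<Sum>n. t n)"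
  have t0: "0 \<le> t n" and t'0: "0 \<le> t' n" for n using aH bH by (auto simp: t_def t'_def)
  have summ_t: "summable t" using summ by (simp add: t_def[abs_def])
  have summ_t': "summable t'"
    by (rule summable_comparison_test'[OF summ_t, of 0]) (use t0 in \<open>auto simp: t'_def\<close>)
  have T_partial: "(\<Sum>n<N. t n) \<le> T" for N
    unfolding T_def by (rule sum_le_suminf[OF summ_t]) (use t0 in auto)
  have t'_partial: "(\<Sum>n<N. t' n) \<le> \<epsilon>" for N
  proof -
    have "(\<Sum>n<N. t' n) \<le> suminf t'" by (rule sum_le_suminf[OF summ_t']) (use t'0 in auto)
    also have "suminf t' \<le> \<epsilon>" using cost by (simp add: t'_def[abs_def] t_def cong: if_cong)
    finally show ?thesis .
  qed
  have T0: "0 \<le> T" using T_partial[of 0] by simp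
  \<comment> \<open>The weight of the free terms: their total cost may be as large as
    \<open>T\<close>, yet their share of the column becomes at most \<open>\<epsilon>\<close>. The
    summand 1 guards against \<open>T = 0\<close>.\<close>
  define \<delta> where "\<delta> = \<epsilon> / (T + 1)"
  have \<delta>: "0 < \<delta>" "\<delta> * T \<le> \<epsilon>" using \<epsilon> T0 by (auto simp: \<delta>_def field_simps)
  define l where "l n = (if b n \<in> M then \<delta> else 1)" for n
  have "\<exists>\<alpha> \<beta> c. \<alpha> \<in> H \<and> \<beta> = cscale c (b n) \<and> \<alpha> * \<beta> = a n * b n \<and>
      (hnorm ip \<alpha>)\<^sup>2 \<le> l n * t n \<and> (hnorm ip \<beta>)\<^sup>2 \<le> t n / l n" for n
  proof -
    have "0 < l n" using \<delta> by (simp add: l_def)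
    from balance_product[OF aH[of n] bH[of n] this] show ?thesis unfolding t_def by metis
  qed
  then obtain \<alpha> \<beta> c where \<alpha>H: "\<And>n. \<alpha> n \<in> H" and \<beta>: "\<And>n. \<beta> n = cscale (c n) (b n)"
    and \<alpha>\<beta>: "\<And>n. \<alpha> n * \<beta> n = a n * b n"
    and \<alpha>_le: "\<And>n. (hnorm ip (\<alpha> n))\<^sup>2 \<le> l n * t n" and \<beta>_le: "\<And>n. (hnorm ip (\<beta> n))\<^sup>2 \<le> t n / l n"
    by metis
  have \<beta>H: "\<beta> n \<in> H" for n using bH by (simp add: \<beta>)
  have \<alpha>_sum: "(\<Sum>n<N. (hnorm ip (\<alpha> n))\<^sup>2) \<le> 2 * \<epsilon>" for N
  proof -
    have "(hnorm ip (\<alpha> n))\<^sup>2 \<le> \<delta> * t n + t' n" for n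
      using \<alpha>_le[of n] \<delta> t0[of n] by (auto simp: l_def t'_def split: if_splits intro: order.trans)
    then have "(\<Sum>n<N. (hnorm ip (\<alpha> n))\<^sup>2) \<le> \<delta> * (\<Sum>n<N. t n) + (\<Sum>n<N. t' n)"
      unfolding sum_distrib_left sum.distrib[symmetric] by (intro sum_mono)
    also have "\<dots> \<le> \<delta> * T + \<epsilon>"
      using \<delta> T_partial t'_partial by (intro add_mono mult_left_mono) auto
    finally show ?thesis using \<delta> by simp
  qed
  \<comment> \<open>This bound grows as \<open>\<delta>\<close> shrinks. It controls the second
    factors and the remainder uniformly in \<open>N\<close> and is absent from the final
    estimate.\<close>
  define B where "B = T / \<delta> + T"
  have \<beta>_le': "(hnorm ip (\<beta> n))\<^sup>2 \<le> t n / \<delta> + t n" for n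
    using \<beta>_le[of n] \<delta> t0[of n] by (auto simp: l_def split: if_splits intro: order.trans)
  have \<beta>_sum: "(\<Sum>n<N. (hnorm ip (\<beta> n))\<^sup>2) \<le> B" for N
  proof -
    have "(\<Sum>n<N. (hnorm ip (\<beta> n))\<^sup>2) \<le> (\<Sum>n<N. t n) / \<delta> + (\<Sum>n<N. t n)"
      unfolding sum_divide_distrib sum.distrib[symmetric] by (intro sum_mono \<beta>_le')
    also have "\<dots> \<le> B"
      unfolding B_def using \<delta> T_partial by (intro add_mono divide_right_mono) auto
    finally show ?thesis .
  qed
  have \<beta>_B: "hnorm ip (\<beta> n) \<le> sqrt B" for n
  proof (rule real_le_rsqrt)
    show "(hnorm ip (\<beta> n))\<^sup>2 \<le> B"
      using \<beta>_sum[of "Suc n"] sum_nonneg[of "{..<n}" "\<lambda>n. (hnorm ip (\<beta> n))\<^sup>2"] by simp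
  qed
  \<comment> \<open>The second factors with those in \<open>M\<close> deleted. Their weight is 1, so
    their square sum is at most the cost \<open>\<epsilon>\<close>.\<close>
  define \<gamma> where "\<gamma> n = (if b n \<in> M then 0 else \<beta> n)" for n
  have \<gamma>H: "\<gamma> n \<in> H" for n using \<beta>H by (simp add: \<gamma>_def)
  have \<gamma>_sum: "(\<Sum>n<N. (hnorm ip (\<gamma> n))\<^sup>2) \<le> \<epsilon>" for N
  proof -
    have "(hnorm ip (\<gamma> n))\<^sup>2 \<le> t' n" for n
      using \<beta>_le[of n] by (auto simp: l_def t'_def \<gamma>_def split: if_splits)
    then show ?thesis using t'_partial[of N] by (meson order.trans sum_mono)
  qed
  \<comment> \<open>The rate serves two purposes: \<open>2 * real N * (d N)\<close> times
    \<open>d N\<close> stays below \<open>\<epsilon>\<close> in the column estimate, and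
    \<open>real N * d N\<close> tends to 0 in the pointwise estimate.\<close>
  define d where "d N = sqrt \<epsilon> / (real N + 1)\<^sup>2" for N :: nat
  have d: "0 < d N" for N using \<epsilon> by (simp add: d_def)
  have ex: "\<exists>x. x \<in> kernel_span \<and> hnorm ip (x - \<alpha> n) < d N" for N n
    using kernel_span_approx[OF \<alpha>H d] by metis
  define \<kappa> where "\<kappa> N n = (SOME x. x \<in> kernel_span \<and> hnorm ip (x - \<alpha> n) < d N)" for N n
  have \<kappa>: "\<kappa> N n \<in> kernel_span" "hnorm ip (\<kappa> N n - \<alpha> n) < d N" for N n
    using someI_ex[OF ex[of n N]] by (auto simp: \<kappa>_def)
  have \<kappa>H: "\<kappa> N n \<in> H" for N n using \<kappa>(1) kernel_span_mem by blast
  \<comment> \<open>Twice the bound \<open>2 * \<epsilon>\<close> for the \<open>\<alpha> n\<close>,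
    plus \<open>\<epsilon>\<close> for the approximation errors.\<close>
  have \<kappa>_sum: "(\<Sum>n<N. (hnorm ip (\<kappa> N n))\<^sup>2) \<le> 5 * \<epsilon>" for N
  proof -
    have "(hnorm ip (\<kappa> N n))\<^sup>2 \<le> 2 * (hnorm ip (\<alpha> n))\<^sup>2 + 2 * (d N)\<^sup>2" for n
    proof -
      have "hnorm ip (\<kappa> N n) \<le> hnorm ip (\<alpha> n) + d N"
        using hnorm_triangle[of "\<alpha> n" "\<kappa> N n - \<alpha> n"] \<kappa>(2)[of N n] \<alpha>H \<kappa>H by simp
      then have "(hnorm ip (\<kappa> N n))\<^sup>2 \<le> (hnorm ip (\<alpha> n) + d N)\<^sup>2"
        using \<kappa>H by (intro power_mono) auto
      also have "\<dots> \<le> 2 * (hnorm ip (\<alpha> n))\<^sup>2 + 2 * (d N)\<^sup>2"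
        using zero_le_power2[of "hnorm ip (\<alpha> n) - d N"] by (simp add: power2_sum power2_diff)
      finally show ?thesis .
    qed
    then have "(\<Sum>n<N. (hnorm ip (\<kappa> N n))\<^sup>2) \<le> (\<Sum>n<N. 2 * (hnorm ip (\<alpha> n))\<^sup>2 + 2 * (d N)\<^sup>2)"
      by (intro sum_mono)
    also have "\<dots> = 2 * (\<Sum>n<N. (hnorm ip (\<alpha> n))\<^sup>2) + 2 * real N * (d N)\<^sup>2"
      by (simp add: sum.distrib sum_distrib_left)
    also have "2 * real N * (d N)\<^sup>2 \<le> \<epsilon>"
    proof -
      have "1 + real 4 * real N \<le> (1 + real N) ^ 4" by (rule Bernoulli_inequality) simp
      then have "2 * real N \<le> (real N + 1) ^ 4" by (simp add: add.commute)
      then have "\<epsilon> * (2 * real N) / (real N + 1) ^ 4 \<le> \<epsilon>"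
        using \<epsilon> by (simp add: pos_divide_le_eq)
      moreover have "(d N)\<^sup>2 = \<epsilon> / (real N + 1) ^ 4"
        using \<epsilon> by (simp add: d_def power_divide flip: power_mult)
      ultimately show ?thesis by (simp add: mult_ac)
    qed
    finally show ?thesis using \<alpha>_sum[of N] by simp
  qed
  have "\<exists>\<theta>. \<theta> \<in> Mult X H \<and>
      (\<forall>h\<in>H. (hnorm ip (\<theta> * h))\<^sup>2 + (\<Sum>n<N. (hnorm ip (\<kappa> N n * \<theta> * h))\<^sup>2) \<le> (hnorm ip h)\<^sup>2) \<and>
      (\<forall>z\<in>X. cmod (\<theta> z) \<le> 1) \<and>
      (\<forall>z\<in>X. cmod (1 - \<theta> z) \<le> (Ck z + 1/2) * (\<Sum>n<N. (hnorm ip (\<kappa> N n))\<^sup>2))" for N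
    by (rule column_factor[of N "\<kappa> N" Ck, OF \<kappa>(1) Ck]) blast+
  then obtain \<theta> where \<theta>_Mult: "\<And>N. \<theta> N \<in> Mult X H"
    and \<theta>_col: "\<And>N h. h \<in> H \<Longrightarrow>
      (hnorm ip (\<theta> N * h))\<^sup>2 + (\<Sum>n<N. (hnorm ip (\<kappa> N n * \<theta> N * h))\<^sup>2) \<le> (hnorm ip h)\<^sup>2"
    and \<theta>_le: "\<And>N z. z \<in> X \<Longrightarrow> cmod (\<theta> N z) \<le> 1"
    and \<theta>_near: "\<And>N z. z \<in> X \<Longrightarrow>
      cmod (1 - \<theta> N z) \<le> (Ck z + 1/2) * (\<Sum>n<N. (hnorm ip (\<kappa> N n))\<^sup>2)"
    by metis
  define \<phi> where "\<phi> N n = \<kappa> N n * \<theta> N" for N n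
  have \<phi>_Mult: "\<phi> N n \<in> Mult X H" for N n
    using kernel_span_Mult[OF \<kappa>(1)[of N n]] \<theta>_Mult[of N]
    by (auto simp: Mult_def \<phi>_def vanishes_off_def mult.assoc)
  have \<phi>_col: "(\<Sum>n<N. (hnorm ip (\<phi> N n * x))\<^sup>2) \<le> (hnorm ip x)\<^sup>2" if "x \<in> H" for N x
    using \<theta>_col[OF that, of N] by (simp add: \<phi>_def) (smt (verit) zero_le_power2)
  have \<theta>H: "\<theta> N * h \<in> H" if "h \<in> H" for N h using Mult_mem[OF \<theta>_Mult that] .
  have \<theta>_contr: "hnorm ip (\<theta> N * h) \<le> hnorm ip h" if h: "h \<in> H" for N h
  proof -
    have "0 \<le> (\<Sum>n<N. (hnorm ip (\<kappa> N n * \<theta> N * h))\<^sup>2)" by (intro sum_nonneg) auto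
    then have "(hnorm ip (\<theta> N * h))\<^sup>2 \<le> (hnorm ip h)\<^sup>2" using \<theta>_col[OF h, of N] by linarith
    then show ?thesis using h \<theta>H[OF h] by (simp add: power2_le_iff_abs_le)
  qed
  have row: "hnorm ip (\<Sum>n<N. \<phi> N n * h n) \<le> sqrt (C * R)"
    if "\<And>n. h n \<in> H" "(\<Sum>n<N. (hnorm ip (h n))\<^sup>2) \<le> R" for N h R
  proof (rule real_le_rsqrt)
    have "(hnorm ip (\<Sum>n<N. \<phi> N n * h n))\<^sup>2 \<le> C * (\<Sum>n<N. (hnorm ip (h n))\<^sup>2)"
      by (rule C) (use \<phi>_Mult \<phi>_col that in auto)
    also have "\<dots> \<le> C * R" using C0 that by (intro mult_left_mono)
    finally show "(hnorm ip (\<Sum>n<N. \<phi> N n * h n))\<^sup>2 \<le> C * R" .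
  qed
  define r where "r N = \<theta> N * f - (\<Sum>n<N. \<phi> N n * \<beta> n)" for N
  have \<phi>\<beta>H: "(\<Sum>n<N. \<phi> N n * \<beta> n) \<in> H" for N using Mult_mem[OF \<phi>_Mult \<beta>H] by simp
  have rH: "r N \<in> H" for N using \<theta>H[OF f] \<phi>\<beta>H by (simp add: r_def)
  have r_le: "hnorm ip (r N) \<le> hnorm ip f + sqrt (C * B)" for N
    using hnorm_triangle_diff[OF \<theta>H[OF f, of N] \<phi>\<beta>H[of N]] \<theta>_contr[OF f, of N] row[OF \<beta>H \<beta>_sum, of N]
    by (simp add: r_def)
  have r_null: "(\<lambda>N. r N z) \<longlonglongrightarrow> 0" if z: "z \<in> X" for z
  proof -
    define L where "L = hnorm ip (K z) * (sqrt B * hnorm ip (K z))"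
    have "(\<lambda>N. f z - (\<Sum>n<N. a n z * b n z)) \<longlonglongrightarrow> f z - f z"
      by (intro tendsto_diff tendsto_const sums[OF z, unfolded sums_def])
    then have "(\<lambda>N. cmod (f z - (\<Sum>n<N. a n z * b n z))) \<longlonglongrightarrow> 0"
      by (simp add: tendsto_norm_zero)
    moreover have "(\<lambda>N. sqrt \<epsilon> * L * inverse (real (Suc N))) \<longlonglongrightarrow> sqrt \<epsilon> * L * 0"
      by (intro tendsto_mult tendsto_const LIMSEQ_inverse_real_of_nat)
    ultimately have "(\<lambda>N. cmod (f z - (\<Sum>n<N. a n z * b n z)) + sqrt \<epsilon> * L * inverse (real (Suc N)))
        \<longlonglongrightarrow> 0 + sqrt \<epsilon> * L * 0" by (rule tendsto_add)
    then have lim: "(\<lambda>N. cmod (f z - (\<Sum>n<N. a n z * b n z)) + sqrt \<epsilon> * L * inverse (real (Suc N)))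
        \<longlonglongrightarrow> 0" by simp
    show ?thesis
    proof (rule Lim_null_comparison[OF _ lim], intro always_eventually allI)
      fix N
      have L0: "0 \<le> L" using z B_def T0 \<delta> by (auto simp: L_def)
      have "r N z = \<theta> N z * (f z - (\<Sum>n<N. \<kappa> N n z * \<beta> n z))"
        by (simp add: r_def sum_fun_apply \<phi>_def right_diff_distrib sum_distrib_left mult_ac)
      then have "cmod (r N z) \<le> cmod (f z - (\<Sum>n<N. \<kappa> N n z * \<beta> n z))"
        using \<theta>_le[OF z, of N] by (simp add: norm_mult mult_left_le_one_le)
      also have "f z - (\<Sum>n<N. \<kappa> N n z * \<beta> n z)
          = (f z - (\<Sum>n<N. a n z * b n z)) - (\<Sum>n<N. (\<kappa> N n z - \<alpha> n z) * \<beta> n z)"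
      proof -
        have "a n z * b n z = \<alpha> n z * \<beta> n z" for n using fun_cong[OF \<alpha>\<beta>[of n], of z] by simp
        then show ?thesis by (simp add: left_diff_distrib sum_subtractf)
      qed
      also have "cmod \<dots> \<le> cmod (f z - (\<Sum>n<N. a n z * b n z)) + (\<Sum>n<N. cmod ((\<kappa> N n z - \<alpha> n z) * \<beta> n z))"
        by (rule order.trans[OF norm_triangle_ineq4]) (intro add_mono norm_sum order.refl)
      also have "(\<Sum>n<N. cmod ((\<kappa> N n z - \<alpha> n z) * \<beta> n z)) \<le> (\<Sum>n<N. d N * L)"
      proof (rule sum_mono)
        fix n
        have "cmod (\<kappa> N n z - \<alpha> n z) \<le> d N * hnorm ip (K z)"
          using cmod_eval_le[of "\<kappa> N n - \<alpha> n" z] \<kappa>H \<alpha>H z \<kappa>(2)[of N n]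
            mult_right_mono[of "hnorm ip (\<kappa> N n - \<alpha> n)" "d N" "hnorm ip (K z)"] by simp
        moreover have "cmod (\<beta> n z) \<le> sqrt B * hnorm ip (K z)"
          by (rule order.trans[OF cmod_eval_le[OF \<beta>H z]])
            (intro mult_right_mono \<beta>_B hnorm_nonneg kernel_mem z)
        ultimately have "cmod (\<kappa> N n z - \<alpha> n z) * cmod (\<beta> n z)
            \<le> d N * hnorm ip (K z) * (sqrt B * hnorm ip (K z))"
          using d[of N] z by (intro mult_mono) auto
        then show "cmod ((\<kappa> N n z - \<alpha> n z) * \<beta> n z) \<le> d N * L"
          by (simp add: norm_mult L_def mult_ac)
      qed
      also have "(\<Sum>n<N. d N * L) = real N * d N * L" by simp
      also have "\<dots> \<le> sqrt \<epsilon> * inverse (real (Suc N)) * L"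
      proof (rule mult_right_mono[OF _ L0])
        have "real N * d N = sqrt \<epsilon> * (real N / (real N + 1)\<^sup>2)" by (simp add: d_def)
        also have "\<dots> \<le> sqrt \<epsilon> * inverse (real (Suc N))"
        proof (rule mult_left_mono)
          have "real N / (real N + 1)\<^sup>2 \<le> (real N + 1) / (real N + 1)\<^sup>2"
            by (intro divide_right_mono) auto
          also have "\<dots> = inverse (real (Suc N))"
          proof -
            have "x / x\<^sup>2 = inverse x" if "x \<noteq> 0" for x :: real
              using that by (simp add: power2_eq_square field_simps)
            from this[of "real N + 1"] show ?thesis by (simp add: add.commute)
          qed
          finally show "real N / (real N + 1)\<^sup>2 \<le> inverse (real (Suc N))" .
        qed (use \<epsilon> in auto)
        finally show "real N * d N \<le> sqrt \<epsilon> * inverse (real (Suc N))" .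
      qed
      finally show "norm (r N z) \<le> cmod (f z - (\<Sum>n<N. a n z * b n z)) + sqrt \<epsilon> * L * inverse (real (Suc N))"
        by (simp add: mult_ac)
    qed
  qed
  have "(\<lambda>N. ip (r N) e) \<longlonglongrightarrow> 0"
    by (rule bounded_pointwise_null_imp_weakly_null[OF rH r_le r_null e])
  then obtain N where N: "cmod (ip (r N) e) < sqrt \<epsilon>"
    using LIMSEQ_D[of "\<lambda>N. ip (r N) e" 0 "sqrt \<epsilon>"] \<epsilon> by fastforce
  \<comment> \<open>A term with \<open>b n\<close> in \<open>M\<close> remains in \<open>M\<close>
    under the multiplier \<open>\<phi> N n\<close> and is therefore orthogonal to
    \<open>e\<close>.\<close>
  have "ip (\<phi> N n * \<beta> n) e = ip (\<phi> N n * \<gamma> n) e" for n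
  proof (cases "b n \<in> M")
    case True
    then have "\<beta> n \<in> M" using M_sub by (simp add: \<beta> cfun.subspace_scale)
    then show ?thesis using True perp[OF M_mult[OF \<phi>_Mult]] e by (simp add: \<gamma>_def)
  qed (simp add: \<gamma>_def)
  then have "ip (\<Sum>n<N. \<phi> N n * \<beta> n) e = ip (\<Sum>n<N. \<phi> N n * \<gamma> n) e"
    using Mult_mem[OF \<phi>_Mult] \<beta>H \<gamma>H e by (simp add: ip_sum_left)
  moreover have "\<theta> N * f = r N + (\<Sum>n<N. \<phi> N n * \<beta> n)" by (simp add: r_def)
  ultimately have "ip (\<theta> N * f) e = ip (r N) e + ip (\<Sum>n<N. \<phi> N n * \<gamma> n) e"
    using rH \<phi>\<beta>H e by (simp add: ip_add_left)
  moreover have "cmod (ip (\<Sum>n<N. \<phi> N n * \<gamma> n) e) \<le> sqrt (C * \<epsilon>) * hnorm ip e"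
  proof -
    have "(\<Sum>n<N. \<phi> N n * \<gamma> n) \<in> H" using Mult_mem[OF \<phi>_Mult \<gamma>H] by simp
    then show ?thesis
      using cauchy_schwarz[OF _ e] mult_right_mono[OF row[OF \<gamma>H \<gamma>_sum, of N], of "hnorm ip e"] e
      by (meson hnorm_nonneg order.trans)
  qed
  ultimately have "cmod (ip (\<theta> N * f) e) \<le> sqrt \<epsilon> + sqrt (C * \<epsilon>) * hnorm ip e"
    using N norm_triangle_ineq[of "ip (r N) e" "ip (\<Sum>n<N. \<phi> N n * \<gamma> n) e"] by simp
  moreover have "cmod (1 - \<theta> N z) \<le> (Ck z + 1/2) * (5 * \<epsilon>)" if z: "z \<in> X" for z
  proof -
    have "0 \<le> Ck z * hnorm ip (K z)"
      using Ck[OF z kernel_mem[OF z]] hnorm_nonneg[OF kernel_mult_mem[OF z kernel_mem[OF z]]] by linarith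
    then have "0 \<le> Ck z" using hnorm_kernel_pos[OF z] by (simp add: zero_le_mult_iff)
    then show ?thesis
      by (intro order.trans[OF \<theta>_near[OF z, of N]] mult_left_mono \<kappa>_sum) simp
  qed
  ultimately show ?thesis using \<theta>H \<theta>_contr by blast
qed

text \<open>For \<open>e\<close> the component of \<open>f\<close> orthogonal to \<open>M\<close>,
  both \<open>ip (\<theta> j * f) e\<close> and \<open>ip (f - \<theta> j * f) e\<close> tend to 0.
  Their sum is the constant \<open>ip f e\<close>, which is thus 0, and \<open>e\<close>
  vanishes.\<close>

lemma weak_rep_null_imp_mem:
  assumes incl: "M_C X H ip \<subseteq> M_R X H ip" and M: "multiplier_invariant_subspace X H ip M"
    and f: "f \<in> H" and rep: "\<And>\<epsilon>. 0 < \<epsilon> \<Longrightarrow> weak_rep M f \<epsilon>"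
  shows "f \<in> M"
proof -
  obtain y where y: "y \<in> M" "\<And>x. x \<in> M \<Longrightarrow> ip x (f - y) = 0"
    using orthogonal_projection[of M f] M f by (auto simp: multiplier_invariant_subspace_def)
  have yH: "y \<in> H" using y(1) M by (auto simp: multiplier_invariant_subspace_def)
  define e where "e = f - y"
  have e: "e \<in> H" using f yH by (simp add: e_def)
  obtain C where C: "0 \<le> C" "\<And>(N::nat) \<phi> h. \<lbrakk>\<And>n. n < N \<Longrightarrow> \<phi> n \<in> Mult X H;
        \<And>x. x \<in> H \<Longrightarrow> (\<Sum>n<N. (hnorm ip (\<phi> n * x))\<^sup>2) \<le> (hnorm ip x)\<^sup>2; \<And>n. n < N \<Longrightarrow> h n \<in> H\<rbrakk>
      \<Longrightarrow> (hnorm ip (\<Sum>n<N. \<phi> n * h n))\<^sup>2 \<le> C * (\<Sum>n<N. (hnorm ip (h n))\<^sup>2)"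
    by (rule uniform_row_bound[OF incl]) blast
  have "\<forall>w\<in>X. \<exists>c. \<forall>h\<in>H. hnorm ip (K w * h) \<le> c * hnorm ip h"
    using bounded_multiplier_kernel unfolding bounded_multiplier_def by blast
  then obtain Ck where Ck: "\<And>w h. \<lbrakk>w \<in> X; h \<in> H\<rbrakk> \<Longrightarrow> hnorm ip (K w * h) \<le> Ck w * hnorm ip h"
    using bchoice[of X] by metis
  define \<epsilon> where "\<epsilon> j = inverse (real (Suc j))" for j
  have \<epsilon>: "0 < \<epsilon> j" for j by (simp add: \<epsilon>_def)
  have \<epsilon>_lim: "\<epsilon> \<longlonglongrightarrow> 0" using LIMSEQ_inverse_real_of_nat by (simp add: \<epsilon>_def[abs_def])
  have "\<exists>\<theta>. (\<forall>h\<in>H. \<theta> * h \<in> H \<and> hnorm ip (\<theta> * h) \<le> hnorm ip h) \<and>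
    (\<forall>z\<in>X. cmod (1 - \<theta> z) \<le> (Ck z + 1/2) * (5 * \<epsilon> j)) \<and>
    cmod (ip (\<theta> * f) e) \<le> sqrt (\<epsilon> j) + sqrt (C * \<epsilon> j) * hnorm ip e" for j
    by (rule weak_rep_approximation[OF M C Ck \<epsilon> f rep[OF \<epsilon>] e]) (use y(2) in \<open>auto simp: e_def\<close>)
  then obtain \<theta> where \<theta>: "\<And>j h. h \<in> H \<Longrightarrow> \<theta> j * h \<in> H" "\<And>j h. h \<in> H \<Longrightarrow> hnorm ip (\<theta> j * h) \<le> hnorm ip h"
    "\<And>j z. z \<in> X \<Longrightarrow> cmod (1 - \<theta> j z) \<le> (Ck z + 1/2) * (5 * \<epsilon> j)"
    "\<And>j. cmod (ip (\<theta> j * f) e) \<le> sqrt (\<epsilon> j) + sqrt (C * \<epsilon> j) * hnorm ip e"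
    by metis
  have "(\<lambda>j. sqrt (\<epsilon> j) + sqrt (C * \<epsilon> j) * hnorm ip e) \<longlonglongrightarrow> sqrt 0 + sqrt (C * 0) * hnorm ip e"
    by (intro tendsto_intros \<epsilon>_lim)
  then have lim: "(\<lambda>j. sqrt (\<epsilon> j) + sqrt (C * \<epsilon> j) * hnorm ip e) \<longlonglongrightarrow> 0" by simp
  have "(\<lambda>j. ip (\<theta> j * f) e) \<longlonglongrightarrow> 0"
    by (rule Lim_null_comparison[OF always_eventually[OF allI[OF \<theta>(4)]] lim])
  moreover have "(\<lambda>j. ip (f - \<theta> j * f) e) \<longlonglongrightarrow> 0"
  proof (rule bounded_pointwise_null_imp_weakly_null)
    show "f - \<theta> j * f \<in> H" for j using f \<theta>(1) by simp
    show "hnorm ip (f - \<theta> j * f) \<le> hnorm ip f + hnorm ip f" for j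
      using hnorm_triangle_diff[OF f \<theta>(1)[OF f, of j]] \<theta>(2)[OF f, of j] by linarith
    fix z assume z: "z \<in> X"
    have "(\<lambda>j. (Ck z + 1/2) * (5 * \<epsilon> j) * cmod (f z)) \<longlonglongrightarrow> (Ck z + 1/2) * (5 * 0) * cmod (f z)"
      by (intro tendsto_intros \<epsilon>_lim)
    then have lim: "(\<lambda>j. (Ck z + 1/2) * (5 * \<epsilon> j) * cmod (f z)) \<longlonglongrightarrow> 0" by simp
    show "(\<lambda>j. (f - \<theta> j * f) z) \<longlonglongrightarrow> 0"
    proof (rule Lim_null_comparison[OF _ lim], intro always_eventually allI)
      fix j
      have "(f - \<theta> j * f) z = (1 - \<theta> j z) * f z" by (simp add: left_diff_distrib)
      then show "norm ((f - \<theta> j * f) z) \<le> (Ck z + 1/2) * (5 * \<epsilon> j) * cmod (f z)"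
        unfolding norm_mult using \<theta>(3)[OF z, of j] by (simp only: norm_mult) (intro mult_right_mono, auto)
    qed
  qed (rule e)
  ultimately have "(\<lambda>j. ip (f - \<theta> j * f) e + ip (\<theta> j * f) e) \<longlonglongrightarrow> 0 + 0"
    by (intro tendsto_add)
  moreover have "ip (f - \<theta> j * f) e + ip (\<theta> j * f) e = ip f e" for j
    using f e \<theta>(1) by (simp add: ip_diff_left)
  ultimately have "ip f e = 0" by (simp add: LIMSEQ_const_iff)
  then have "ip e e = 0" using y f yH e by (simp add: e_def ip_diff_left)
  then have "e = 0" using ip_definite e by blast
  then show ?thesis using y(1) by (simp add: e_def)
qed

end

section \<open>The Hahn-Banach theorem\<close>

text \<open>The real scalar multiplication is a parameter because the vectors are complex functions
  with \<open>cscale\<close>; it is instantiated by \<open>cscale\<close> restricted to real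
  scalars.\<close>

locale sublinear_on =
  fixes scale :: "real \<Rightarrow> 'v::ab_group_add \<Rightarrow> 'v" and V :: "'v set" and p :: "'v \<Rightarrow> real"
  assumes vector_space: "vector_space scale"
    and sub_V: "module.subspace scale V"
    and add_le: "\<lbrakk>x \<in> V; y \<in> V\<rbrakk> \<Longrightarrow> p (x + y) \<le> p x + p y"
    and pos_scale: "\<lbrakk>x \<in> V; 0 < t\<rbrakk> \<Longrightarrow> p (scale t x) = t * p x"
begin

sublocale vs: vector_space scale by (rule vector_space)

lemma V_closed [simp, intro]:
  "0 \<in> V" "\<lbrakk>x \<in> V; y \<in> V\<rbrakk> \<Longrightarrow> x + y \<in> V" "x \<in> V \<Longrightarrow> scale t x \<in> V" "x \<in> V \<Longrightarrow> - x \<in> V"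
  using sub_V by (auto simp: vs.subspace_0 vs.subspace_add vs.subspace_scale vs.subspace_neg)

lemma zero [simp]: "p 0 = 0"
  using pos_scale[of 0 2] by simp

lemma nonneg_scale: "\<lbrakk>x \<in> V; 0 \<le> t\<rbrakk> \<Longrightarrow> p (scale t x) = t * p x"
  using pos_scale[of x t] by (cases "t = 0") auto

lemma neg_le: "x \<in> V \<Longrightarrow> - p (- x) \<le> p x"
  using add_le[of x "- x"] by simp

text \<open>A sublinear functional below \<open>p\<close> whose value at \<open>- a\<close> is at
  most \<open>- p a\<close>, so anything linear below it takes at least the value \<open>p a\<close>
  at \<open>a\<close>. The value 0 off \<open>V\<close> makes it a determined total
  function.\<close>

definition shrink :: "'v \<Rightarrow> 'v \<Rightarrow> real" where
  "shrink a y = (if y \<in> V then INF t\<in>{0..}. p (y + scale t a) - t * p a else 0)"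

context
  fixes a assumes a: "a \<in> V"
begin

lemma shrink_bdd: "y \<in> V \<Longrightarrow> bdd_below ((\<lambda>t. p (y + scale t a) - t * p a) ` {0..})"
proof (rule bdd_belowI2)
  fix t :: real assume y: "y \<in> V" and "t \<in> {0..}"
  then have "t * p a = p ((y + scale t a) + - y)" using a by (simp add: nonneg_scale)
  also have "\<dots> \<le> p (y + scale t a) + p (- y)" using a y by (intro add_le) auto
  finally show "- p (- y) \<le> p (y + scale t a) - t * p a" by simp
qed

lemma shrink_le: "\<lbrakk>y \<in> V; 0 \<le> t\<rbrakk> \<Longrightarrow> shrink a y \<le> p (y + scale t a) - t * p a"
  using cINF_lower[OF shrink_bdd, of y t] by (simp add: shrink_def)

lemma le_shrink: "\<lbrakk>y \<in> V; \<And>t. 0 \<le> t \<Longrightarrow> c \<le> p (y + scale t a) - t * p a\<rbrakk> \<Longrightarrow> c \<le> shrink a y"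
  by (auto simp: shrink_def intro: cINF_greatest)

lemma shrink_le_p: "y \<in> V \<Longrightarrow> shrink a y \<le> p y"
  using shrink_le[of y 0] by simp

lemma shrink_neg: "shrink a (- a) \<le> - p a"
  using shrink_le[of "- a" 1] a by simp

text \<open>Parameters \<open>t\<close> for \<open>x\<close> and \<open>s\<close> for
  \<open>y\<close> combine to \<open>t + s\<close> for \<open>x + y\<close>; scaling a vector by
  \<open>r\<close> rescales the parameter by \<open>r\<close>.\<close>

lemma shrink_sublinear: "sublinear_on scale V (shrink a)"
proof (unfold_locales)
  fix x y assume x: "x \<in> V" and y: "y \<in> V"
  have "shrink a (x + y) - shrink a y \<le> shrink a x"
  proof (rule le_shrink[OF x])
    fix t :: real assume t: "0 \<le> t"
    have "shrink a (x + y) - (p (x + scale t a) - t * p a) \<le> shrink a y"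
    proof (rule le_shrink[OF y])
      fix s :: real assume s: "0 \<le> s"
      have "shrink a (x + y) \<le> p ((x + scale t a) + (y + scale s a)) - (t + s) * p a"
        using shrink_le[of "x + y" "t + s"] x y t s by (simp add: vs.scale_left_distrib add_ac)
      also have "p ((x + scale t a) + (y + scale s a)) \<le> p (x + scale t a) + p (y + scale s a)"
        using x y a by (intro add_le) auto
      finally show "shrink a (x + y) - (p (x + scale t a) - t * p a) \<le> p (y + scale s a) - s * p a"
        by (simp add: algebra_simps)
    qed
    then show "shrink a (x + y) - shrink a y \<le> p (x + scale t a) - t * p a" by simp
  qed
  then show "shrink a (x + y) \<le> shrink a x + shrink a y" by simp
next
  have le: "shrink a (scale r y) \<le> r * shrink a y" if y: "y \<in> V" and r: "0 < r" for r y
  proof -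
    have "shrink a (scale r y) / r \<le> shrink a y"
    proof (rule le_shrink[OF y])
      fix t :: real assume t: "0 \<le> t"
      have "shrink a (scale r y) \<le> p (scale r (y + scale t a)) - r * t * p a"
        using shrink_le[of "scale r y" "r * t"] y r t by (simp add: vs.scale_right_distrib)
      also have "p (scale r (y + scale t a)) = r * p (y + scale t a)"
        using y r a by (intro pos_scale) auto
      finally show "shrink a (scale r y) / r \<le> p (y + scale t a) - t * p a"
        using r by (simp add: field_simps)
    qed
    then show ?thesis using r by (simp add: field_simps)
  qed
  fix y and r :: real assume y: "y \<in> V" and r: "0 < r"
  have "shrink a y \<le> 1 / r * shrink a (scale r y)"
    using le[of "scale r y" "1 / r"] y r by simp
  then show "shrink a (scale r y) = r * shrink a y"
    using le[OF y r] r by (simp add: field_simps)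
qed (use vector_space sub_V in \<open>auto simp: vector_space_def\<close>)

end

end

text \<open>
  A minimal sublinear functional \<open>q\<close> is linear, because minimality forces \<open>shrink a = q\<close> and hence
  \<open>q (- a) = - q a\<close>.
\<close>

lemma (in sublinear_on) hahn_banach:
  assumes x0: "x0 \<in> V"
  obtains l where "\<And>x y. \<lbrakk>x \<in> V; y \<in> V\<rbrakk> \<Longrightarrow> l (x + y) = l x + l y"
    "\<And>x t. x \<in> V \<Longrightarrow> l (scale t x) = t * l x" "\<And>x. x \<in> V \<Longrightarrow> l x \<le> p x" "l x0 = p x0"
proof -
  \<comment> \<open>Minimisation starts below \<open>shrink x0\<close> instead of \<open>p\<close>.
    Any linear functional found there satisfies \<open>l (- x0) \<le> - p x0\<close>, hence attains
    \<open>p\<close> at \<open>x0\<close>.\<close>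
  define q0 where "q0 = shrink x0"
  interpret q0: sublinear_on scale V q0 unfolding q0_def by (rule shrink_sublinear[OF x0])
  \<comment> \<open>Prescribing 0 off \<open>V\<close> lets minimality yield an equality of total
    functions.\<close>
  define A where "A = {q. sublinear_on scale V q \<and> (\<forall>x\<in>V. q x \<le> q0 x) \<and> (\<forall>x. x \<notin> V \<longrightarrow> q x = 0)}"
  define P where "P q q' \<longleftrightarrow> (\<forall>x. q' x \<le> q x)" for q q' :: "'v \<Rightarrow> real"
  have q0A: "q0 \<in> A" using q0.sublinear_on_axioms by (auto simp: A_def q0_def shrink_def)
  have "\<exists>m\<in>A. \<forall>q\<in>A. P m q \<longrightarrow> q = m"
  proof (rule predicate_Zorn)
    show "partial_order_on A (relation_of P A)"
      by (rule partial_order_on_relation_ofI) (auto simp: P_def fun_eq_iff intro: order.trans antisym)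
  next
    fix C assume C: "C \<in> Chains (relation_of P A)"
    then have CA: "q \<in> A" if "q \<in> C" for q using that by (auto simp: Chains_def relation_of_def)
    have chain: "P q q' \<or> P q' q" if "q \<in> C" "q' \<in> C" for q q'
      using C that by (auto simp: Chains_def relation_of_def)
    show "\<exists>u\<in>A. \<forall>q\<in>C. P q u"
    proof (cases "C = {}")
      case True
      then show ?thesis using q0A by blast
    next
      case False
      define u where "u x = (INF q\<in>C. q x)" for x
      have bdd: "bdd_below ((\<lambda>q. q x) ` C)" for x
      proof (cases "x \<in> V")
        case True
        have "- q0 (- x) \<le> q x" if "q \<in> C" for q
        proof -
          interpret q: sublinear_on scale V q using CA[OF that] by (simp add: A_def)
          have "q (- x) \<le> q0 (- x)" using CA[OF that] True by (simp add: A_def)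
          then show ?thesis using q.neg_le[OF True] by simp
        qed
        then show ?thesis by (rule bdd_belowI2)
      next
        case False
        then have "0 \<le> q x" if "q \<in> C" for q using CA[OF that] by (simp add: A_def)
        then show ?thesis by (rule bdd_belowI2)
      qed
      have u_le: "u x \<le> q x" if "q \<in> C" for q x
        unfolding u_def by (rule cINF_lower[OF bdd that])
      have le_u: "c \<le> u x" if "\<And>q. q \<in> C \<Longrightarrow> c \<le> q x" for c x
        unfolding u_def using False that by (rule cINF_greatest)
      have "sublinear_on scale V u"
      proof (unfold_locales)
        fix x y assume x: "x \<in> V" and y: "y \<in> V"
        \<comment> \<open>The chain property is essential here: the smaller of \<open>q1\<close> and
          \<open>q2\<close> serves both vectors at once.\<close>
        have both: "u (x + y) \<le> q1 x + q2 y" if q12: "q1 \<in> C" "q2 \<in> C" for q1 q2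
        proof -
          obtain q where q: "q \<in> C" "q x \<le> q1 x" "q y \<le> q2 y"
            using chain[OF q12] q12 by (auto simp: P_def)
          have "u (x + y) \<le> q (x + y)" by (rule u_le[OF q(1)])
          also have "\<dots> \<le> q x + q y"
            using CA[OF q(1)] x y by (auto simp: A_def sublinear_on.add_le)
          finally show ?thesis using q by simp
        qed
        have "u (x + y) - q1 x \<le> u y" if "q1 \<in> C" for q1
          by (rule le_u) (use both[OF that] in \<open>simp add: diff_le_eq add.commute\<close>)
        then have "u (x + y) - u y \<le> u x"
          by (intro le_u) (simp add: diff_le_eq add.commute)
        then show "u (x + y) \<le> u x + u y" by simp
      next
        have le: "u (scale t x) \<le> t * u x" if x: "x \<in> V" and t: "0 < t" for t x
        proof -
          have "u (scale t x) / t \<le> u x"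
          proof (rule le_u)
            fix q assume q: "q \<in> C"
            have "u (scale t x) \<le> t * q x"
              using u_le[OF q, of "scale t x"] CA[OF q] x t by (auto simp: A_def sublinear_on.pos_scale)
            then show "u (scale t x) / t \<le> q x" using t by (simp add: field_simps)
          qed
          then show ?thesis using t by (simp add: field_simps)
        qed
        fix x and t :: real assume x: "x \<in> V" and t: "0 < t"
        have "u x \<le> 1 / t * u (scale t x)" using le[of "scale t x" "1 / t"] x t by simp
        then show "u (scale t x) = t * u x" using le[OF x t] t by (simp add: field_simps)
      qed (use vector_space sub_V in \<open>auto simp: vector_space_def\<close>)
      moreover obtain q where q: "q \<in> C" using False by blast
      have "u x \<le> q0 x" if "x \<in> V" for x
        using u_le[OF q, of x] CA[OF q] that by (force simp: A_def)
      moreover have "u x = 0" if "x \<notin> V" for x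
      proof (rule antisym)
        have *: "q' x = 0" if "q' \<in> C" for q' using CA[OF that] \<open>x \<notin> V\<close> by (simp add: A_def)
        show "u x \<le> 0" using u_le[OF q, of x] *[OF q] by simp
        show "0 \<le> u x" by (rule le_u) (simp add: *)
      qed
      ultimately have "u \<in> A" by (simp add: A_def)
      then show ?thesis using u_le by (auto simp: P_def)
    qed
  qed
  then obtain l where l: "l \<in> A" and min: "\<And>q. \<lbrakk>q \<in> A; P l q\<rbrakk> \<Longrightarrow> q = l" by blast
  interpret l: sublinear_on scale V l using l by (simp add: A_def)
  have neg: "l (- a) = - l a" if a: "a \<in> V" for a
  proof -
    have "l.shrink a = l"
    proof (rule min)
      have le: "l.shrink a x \<le> l x" if "x \<in> V" for x using l.shrink_le_p[OF a that] .
      moreover have "l x \<le> q0 x" if "x \<in> V" for x using l that by (simp add: A_def)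
      ultimately show "l.shrink a \<in> A"
        using l.shrink_sublinear[OF a] by (fastforce simp: A_def l.shrink_def)
      show "P l (l.shrink a)" using le l by (auto simp: P_def A_def l.shrink_def)
    qed
    then have "l (- a) \<le> - l a" using l.shrink_neg[OF a] by simp
    then show ?thesis using l.neg_le[OF a] by simp
  qed
  show ?thesis
  proof (rule that)
    show "l (x + y) = l x + l y" if "x \<in> V" "y \<in> V" for x y
      using l.add_le[OF that] l.add_le[of "- x" "- y"] neg[of "x + y"] neg[OF that(1)] neg[OF that(2)] that
      by simp
    show "l (scale t x) = t * l x" if x: "x \<in> V" for x t
      using l.nonneg_scale[OF x, of t] l.nonneg_scale[OF x, of "- t"] neg[of "scale t x"] x
      by (cases "0 \<le> t") auto
    show l_le: "l x \<le> p x" if "x \<in> V" for x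
      using l that shrink_le_p[OF x0 that] by (force simp: A_def q0_def)
    have "- x0 \<in> V" using x0 by simp
    then have "l (- x0) \<le> q0 (- x0)" using l unfolding A_def by blast
    then have "l (- x0) \<le> - p x0" using shrink_neg[OF x0] by (simp add: q0_def)
    then show "l x0 = p x0" using neg[OF x0] l_le[OF x0] by simp
  qed
qed

section \<open>Hankel operators\<close>

lemma hnorm_conj_ip: "hnorm (conj_ip ip) (cnj \<circ> y) = hnorm ip y"
  by (simp add: hnorm_def conj_ip_def comp_def)

lemma cnj_comp_cnj_comp [simp]: "cnj \<circ> (cnj \<circ> f) = f"
  by (simp add: comp_def)

lemma cnj_comp_eq_iff: "cnj \<circ> f = cnj \<circ> g \<longleftrightarrow> f = g"
  by (simp add: fun_eq_iff)

lemma cnj_comp_zero: "cnj \<circ> 0 = (0 :: 'x \<Rightarrow> complex)"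
  by (simp add: fun_eq_iff)

context hilbert_function_space
begin

lemma ip_minus_right: "\<lbrakk>f \<in> H; g \<in> H\<rbrakk> \<Longrightarrow> ip g (- f) = - ip g f"
  using ip_diff_right[of 0 f g] by simp

section \<open>Sums, multiples and products in the weak product\<close>

lemma weak_repI:
  assumes "vanishes_off X h" "\<And>n::nat. a n \<in> H" "\<And>n. b n \<in> H"
    and "summable (\<lambda>n. hnorm ip (a n) * hnorm ip (b n))" "\<And>z. z \<in> X \<Longrightarrow> (\<lambda>n. a n z * b n z) sums h z"
    and "(\<Sum>n. if b n \<in> M then 0 else hnorm ip (a n) * hnorm ip (b n)) \<le> s"
  shows "weak_rep M h s"
  unfolding weak_rep_def using assms by (intro conjI exI[of _ a] exI[of _ b]) auto

lemma weak_rep_nonneg: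
  assumes "weak_rep M h s" shows "0 \<le> s"
proof -
  obtain a b where ab: "\<And>n::nat. a n \<in> H" "\<And>n. b n \<in> H" "summable (\<lambda>n. hnorm ip (a n) * hnorm ip (b n))"
    "(\<Sum>n. if b n \<in> M then 0 else hnorm ip (a n) * hnorm ip (b n)) \<le> s"
    using assms unfolding weak_rep_def by blast
  have "summable (\<lambda>n. if b n \<in> M then 0 else hnorm ip (a n) * hnorm ip (b n))"
    by (rule summable_comparison_test'[OF ab(3), of 0]) (use ab in auto)
  then have "0 \<le> (\<Sum>n. if b n \<in> M then 0 else hnorm ip (a n) * hnorm ip (b n))"
    by (rule suminf_nonneg) (use ab in auto)
  then show ?thesis using ab(4) by simp
qed

lemma weak_rep_mono: "\<lbrakk>weak_rep M h s; s \<le> t\<rbrakk> \<Longrightarrow> weak_rep M h t"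
  unfolding weak_rep_def by (meson order.trans)

text \<open>The two representations are interleaved along even and odd indices, so values, norms and
  costs all add.\<close>

lemma weak_rep_add:
  assumes "weak_rep M h s" "weak_rep M h' s'"
  shows "weak_rep M (h + h') (s + s')"
proof -
  define cost where "cost a b = (if b \<in> M then 0 else hnorm ip a * hnorm ip b)" for a b
  have summ_cost: "summable (\<lambda>n. cost (a n) (b n))"
    if "\<And>n::nat. a n \<in> H \<and> b n \<in> H" "summable (\<lambda>n. hnorm ip (a n) * hnorm ip (b n))" for a b
    by (rule summable_comparison_test'[OF that(2), of 0]) (use that(1) in \<open>auto simp: cost_def\<close>)
  obtain a b where ab: "\<And>n::nat. a n \<in> H \<and> b n \<in> H" "summable (\<lambda>n. hnorm ip (a n) * hnorm ip (b n))"
    "\<And>z. z \<in> X \<Longrightarrow> (\<lambda>n. a n z * b n z) sums h z" "(\<Sum>n. cost (a n) (b n)) \<le> s" "vanishes_off X h"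
    using assms(1) unfolding weak_rep_def cost_def by blast
  obtain a' b' where ab': "\<And>n::nat. a' n \<in> H \<and> b' n \<in> H" "summable (\<lambda>n. hnorm ip (a' n) * hnorm ip (b' n))"
    "\<And>z. z \<in> X \<Longrightarrow> (\<lambda>n. a' n z * b' n z) sums h' z" "(\<Sum>n. cost (a' n) (b' n)) \<le> s'" "vanishes_off X h'"
    using assms(2) unfolding weak_rep_def cost_def by blast
  define \<alpha> where "\<alpha> n = (if even n then a' (n div 2) else a ((n - 1) div 2))" for n
  define \<beta> where "\<beta> n = (if even n then b' (n div 2) else b ((n - 1) div 2))" for n
  have mix_real: "(\<lambda>n. F (\<alpha> n) (\<beta> n)) sums (x + y)"
    if "(\<lambda>n. F (a n) (b n)) sums x" "(\<lambda>n. F (a' n) (b' n)) sums y" for F and x y :: real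
  proof -
    have "(\<lambda>n. F (\<alpha> n) (\<beta> n)) =
        (\<lambda>n. if even n then F (a' (n div 2)) (b' (n div 2)) else F (a ((n - 1) div 2)) (b ((n - 1) div 2)))"
      by (auto simp: \<alpha>_def \<beta>_def)
    then show ?thesis using sums_if[OF that] by simp
  qed
  have mix_complex: "(\<lambda>n. F (\<alpha> n) (\<beta> n)) sums (x + y)"
    if "(\<lambda>n. F (a n) (b n)) sums x" "(\<lambda>n. F (a' n) (b' n)) sums y" for F and x y :: complex
    using that mix_real[where F = "\<lambda>f g. Re (F f g)"] mix_real[where F = "\<lambda>f g. Im (F f g)"]
    by (simp add: sums_complex_iff)
  have "(\<lambda>n. cost (\<alpha> n) (\<beta> n)) sums ((\<Sum>n. cost (a n) (b n)) + (\<Sum>n. cost (a' n) (b' n)))"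
    by (intro mix_real summable_sums summ_cost ab ab')
  then have "(\<Sum>n. cost (\<alpha> n) (\<beta> n)) \<le> s + s'" using ab(4) ab'(4) by (simp add: sums_iff)
  moreover have "summable (\<lambda>n. hnorm ip (\<alpha> n) * hnorm ip (\<beta> n))"
    by (rule sums_summable[OF mix_real[OF summable_sums[OF ab(2)] summable_sums[OF ab'(2)]]])
  moreover have "(\<lambda>n. \<alpha> n z * \<beta> n z) sums (h + h') z" if "z \<in> X" for z
    using mix_complex[where F = "\<lambda>f g. f z * g z", OF ab(3)[OF that] ab'(3)[OF that]] by simp
  moreover have "\<alpha> n \<in> H" "\<beta> n \<in> H" for n using ab ab' by (simp_all add: \<alpha>_def \<beta>_def)
  moreover have "vanishes_off X (h + h')" using ab(5) ab'(5) by (simp add: vanishes_off_def)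
  ultimately show ?thesis
    by (intro weak_repI[where a = \<alpha> and b = \<beta>]) (simp_all only: cost_def)
qed

lemma weak_rep_scale:
  assumes "weak_rep M h s"
  shows "weak_rep M (cscale c h) (cmod c * s)"
proof -
  obtain a b where ab: "\<And>n::nat. a n \<in> H \<and> b n \<in> H" "summable (\<lambda>n. hnorm ip (a n) * hnorm ip (b n))"
    "\<And>z. z \<in> X \<Longrightarrow> (\<lambda>n. a n z * b n z) sums h z" "vanishes_off X h"
    "(\<Sum>n. if b n \<in> M then 0 else hnorm ip (a n) * hnorm ip (b n)) \<le> s"
    using assms unfolding weak_rep_def by blast
  have summ: "summable (\<lambda>n. if b n \<in> M then 0 else hnorm ip (a n) * hnorm ip (b n))"
    by (rule summable_comparison_test'[OF ab(2), of 0]) (use ab(1) in auto)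
  have norm: "hnorm ip (cscale c (a n)) = cmod c * hnorm ip (a n)" for n using ab(1) by simp
  have "(\<Sum>n. if b n \<in> M then 0 else hnorm ip (cscale c (a n)) * hnorm ip (b n))
      = (\<Sum>n. cmod c * (if b n \<in> M then 0 else hnorm ip (a n) * hnorm ip (b n)))"
    by (intro arg_cong[of _ _ suminf]) (auto simp: norm mult.assoc)
  also have "\<dots> = cmod c * (\<Sum>n. if b n \<in> M then 0 else hnorm ip (a n) * hnorm ip (b n))"
    by (rule suminf_mult[OF summ])
  also have "\<dots> \<le> cmod c * s" using ab(5) by (intro mult_left_mono) auto
  finally have "(\<Sum>n. if b n \<in> M then 0 else hnorm ip (cscale c (a n)) * hnorm ip (b n)) \<le> cmod c * s" .
  moreover have "summable (\<lambda>n. hnorm ip (cscale c (a n)) * hnorm ip (b n))"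
    using summable_mult[OF ab(2), of "cmod c"] by (simp add: norm mult.assoc)
  moreover have "(\<lambda>n. cscale c (a n) z * b n z) sums (cscale c h) z" if "z \<in> X" for z
    using sums_mult[OF ab(3)[OF that], of c] by (simp add: mult.assoc)
  moreover have "vanishes_off X (cscale c h)" using ab(4) by (simp add: vanishes_off_def)
  ultimately show ?thesis
    by (intro weak_repI[where a = "\<lambda>n. cscale c (a n)" and b = b]) (use ab(1) in blast)+
qed

lemma weak_rep_product:
  assumes f: "f \<in> H" and g: "g \<in> H"
  shows "weak_rep M (f * g) (if g \<in> M then 0 else hnorm ip f * hnorm ip g)"
proof -
  \<comment> \<open>Only the first factor is padded with 0; the second stays equal to
    \<open>g\<close>, so all terms are free exactly when \<open>g\<close> is in
    \<open>M\<close>.\<close>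
  define a where "a n = (if n = 0 then f else 0)" for n :: nat
  have "(\<lambda>n. if n = 0 then hnorm ip f * hnorm ip g else 0) sums (hnorm ip f * hnorm ip g)"
    using sums_single[of 0 "\<lambda>_. hnorm ip f * hnorm ip g"] by simp
  moreover have "(\<lambda>n. if n = 0 then hnorm ip f * hnorm ip g else 0) = (\<lambda>n. hnorm ip (a n) * hnorm ip g)"
    by (auto simp: a_def)
  ultimately have norms: "(\<lambda>n. hnorm ip (a n) * hnorm ip g) sums (hnorm ip f * hnorm ip g)" by simp
  have vals: "(\<lambda>n. a n z * g z) sums (f * g) z" for z
  proof -
    have "(\<lambda>n. if n = 0 then f z * g z else 0) sums (f z * g z)"
      using sums_single[of 0 "\<lambda>_. f z * g z"] by simp
    moreover have "(\<lambda>n. if n = 0 then f z * g z else 0) = (\<lambda>n. a n z * g z)"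
      by (auto simp: a_def)
    ultimately show ?thesis by simp
  qed
  have "vanishes_off X (f * g)" using vanishes[OF f] by (simp add: vanishes_off_def)
  then show ?thesis
    unfolding weak_rep_def
    by (intro conjI exI[of _ a] exI[of _ "\<lambda>_. g"])
      (use norms vals f g in \<open>auto simp: a_def sums_iff\<close>)
qed

section \<open>The quotient seminorm and its bounded functionals\<close>

definition weak_space :: "('x \<Rightarrow> complex) set \<Rightarrow> ('x \<Rightarrow> complex) set" where
  "weak_space M = {h. \<exists>s. weak_rep M h s}"

definition weak_seminorm :: "('x \<Rightarrow> complex) set \<Rightarrow> ('x \<Rightarrow> complex) \<Rightarrow> real" where
  "weak_seminorm M h = Inf {s. weak_rep M h s}"

lemma weak_seminorm_le: "weak_rep M h s \<Longrightarrow> weak_seminorm M h \<le> s"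
  unfolding weak_seminorm_def
  by (rule cInf_lower) (auto intro!: bdd_belowI[of _ 0] dest: weak_rep_nonneg)

lemma le_weak_seminorm:
  "\<lbrakk>h \<in> weak_space M; \<And>s. weak_rep M h s \<Longrightarrow> c \<le> s\<rbrakk> \<Longrightarrow> c \<le> weak_seminorm M h"
  unfolding weak_seminorm_def by (rule cInf_greatest) (auto simp: weak_space_def)

lemma weak_seminorm_nonneg: "h \<in> weak_space M \<Longrightarrow> 0 \<le> weak_seminorm M h"
  by (rule le_weak_seminorm) (auto dest: weak_rep_nonneg)

lemma weak_space_product: "\<lbrakk>f \<in> H; g \<in> H\<rbrakk> \<Longrightarrow> f * g \<in> weak_space M"
  using weak_rep_product by (auto simp: weak_space_def)

lemma weak_space_add: "\<lbrakk>h \<in> weak_space M; h' \<in> weak_space M\<rbrakk> \<Longrightarrow> h + h' \<in> weak_space M"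
  unfolding weak_space_def using weak_rep_add by blast

lemma weak_space_scale: "h \<in> weak_space M \<Longrightarrow> cscale c h \<in> weak_space M"
  unfolding weak_space_def using weak_rep_scale by blast

lemma weak_space_zero: "0 \<in> weak_space M"
  using weak_space_product[of 0 0] by simp

lemma weak_seminorm_add:
  assumes "h \<in> weak_space M" "h' \<in> weak_space M"
  shows "weak_seminorm M (h + h') \<le> weak_seminorm M h + weak_seminorm M h'"
proof -
  have "weak_seminorm M (h + h') - weak_seminorm M h' \<le> weak_seminorm M h"
  proof (rule le_weak_seminorm[OF assms(1)])
    fix s assume s: "weak_rep M h s"
    have "weak_seminorm M (h + h') - s \<le> weak_seminorm M h'"
    proof (rule le_weak_seminorm[OF assms(2)])
      fix s' assume s': "weak_rep M h' s'"
      show "weak_seminorm M (h + h') - s \<le> s'"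
        using weak_seminorm_le[OF weak_rep_add[OF s s']] by linarith
    qed
    then show "weak_seminorm M (h + h') - weak_seminorm M h' \<le> s" by simp
  qed
  then show ?thesis by simp
qed

lemma weak_seminorm_scale_le:
  assumes "h \<in> weak_space M"
  shows "weak_seminorm M (cscale c h) \<le> cmod c * weak_seminorm M h"
proof (cases "c = 0")
  case True
  have "weak_rep M (cscale 0 h) 0" using assms weak_rep_scale[of M h _ 0] by (auto simp: weak_space_def)
  then show ?thesis using True weak_seminorm_le by simp
next
  case False
  have "weak_seminorm M (cscale c h) / cmod c \<le> weak_seminorm M h"
    using weak_seminorm_le[OF weak_rep_scale] False
    by (intro le_weak_seminorm[OF assms]) (simp add: pos_divide_le_eq mult.commute)
  then show ?thesis using False by (simp add: pos_divide_le_eq mult.commute)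
qed

text \<open>The real Hahn-Banach functional \<open>l\<close> is complexified by
  \<open>l h - \<i> * l (\<i> h)\<close>, which keeps its real part and therefore its value at
  \<open>f\<close>.\<close>

lemma weak_functional:
  assumes f: "f \<in> weak_space M"
  obtains L where "\<And>h h'. \<lbrakk>h \<in> weak_space M; h' \<in> weak_space M\<rbrakk> \<Longrightarrow> L (h + h') = L h + L h'"
    "\<And>h c. h \<in> weak_space M \<Longrightarrow> L (cscale c h) = c * L h"
    "\<And>h. h \<in> weak_space M \<Longrightarrow> cmod (L h) \<le> weak_seminorm M h"
    "Re (L f) = weak_seminorm M f"
proof -
  define scale where "scale r = (cscale (of_real r) :: ('x \<Rightarrow> complex) \<Rightarrow> _)" for r :: real
  have vs: "vector_space scale"
    by unfold_locales (auto simp: scale_def fun_eq_iff algebra_simps)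
  interpret vs: vector_space scale by (rule vs)
  interpret sublinear_on scale "weak_space M" "weak_seminorm M"
  proof (unfold_locales)
    show "vs.subspace (weak_space M)"
      by (rule vs.subspaceI) (simp_all add: weak_space_zero weak_space_add weak_space_scale scale_def)
  next
    fix h and t :: real assume h: "h \<in> weak_space M" and t: "0 < t"
    have "weak_seminorm M h = weak_seminorm M (cscale (of_real (1 / t)) (scale t h))"
      using t by (simp add: scale_def cfun.scale_scale)
    also have "\<dots> \<le> 1 / t * weak_seminorm M (scale t h)"
      using weak_seminorm_scale_le[of "scale t h" M "of_real (1 / t)"] h t
      by (simp add: scale_def weak_space_scale norm_divide)
    finally have "t * weak_seminorm M h \<le> weak_seminorm M (scale t h)"
      using t by (simp add: field_simps)
    moreover have "weak_seminorm M (scale t h) \<le> t * weak_seminorm M h"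
      using weak_seminorm_scale_le[OF h, of "of_real t"] t by (simp add: scale_def)
    ultimately show "weak_seminorm M (scale t h) = t * weak_seminorm M h" by simp
  qed (simp add: weak_seminorm_add)
  obtain l where l_add: "\<And>x y. \<lbrakk>x \<in> weak_space M; y \<in> weak_space M\<rbrakk> \<Longrightarrow> l (x + y) = l x + l y"
    and l_scale: "\<And>x t. x \<in> weak_space M \<Longrightarrow> l (scale t x) = t * l x"
    and l_le: "\<And>x. x \<in> weak_space M \<Longrightarrow> l x \<le> weak_seminorm M x" and l_f: "l f = weak_seminorm M f"
    using hahn_banach[OF f] by metis
  define L where "L h = Complex (l h) (- l (cscale \<i> h))" for h
  have L_scale: "L (cscale c h) = c * L h" if h: "h \<in> weak_space M" for h c
  proof -
    have l_c: "l (cscale c h) = Re c * l h + Im c * l (cscale \<i> h)" for c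
    proof -
      have "cscale c h = scale (Re c) h + scale (Im c) (cscale \<i> h)"
        by (simp add: scale_def fun_eq_iff) (metis complex_eq distrib_right mult.assoc mult.commute)
      then show ?thesis
        using h by (simp add: l_add l_scale weak_space_scale)
    qed
    have "cscale \<i> (cscale c h) = cscale (\<i> * c) h" by (simp add: cfun.scale_scale)
    then show ?thesis
      using l_c[of c] l_c[of "\<i> * c"] by (simp add: L_def complex_eq_iff)
  qed
  show ?thesis
  proof (rule that)
    show "L (h + h') = L h + L h'" if "h \<in> weak_space M" "h' \<in> weak_space M" for h h'
      using that by (simp add: L_def l_add weak_space_scale cfun.scale_right_distrib complex_eq_iff)
    show "L (cscale c h) = c * L h" if "h \<in> weak_space M" for h c by (rule L_scale[OF that])
    show "cmod (L h) \<le> weak_seminorm M h" if h: "h \<in> weak_space M" for h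
    proof (cases "L h = 0")
      case True
      then show ?thesis using weak_seminorm_nonneg[OF h] by simp
    next
      case False
      \<comment> \<open>The unimodular factor that rotates \<open>L h\<close> onto its modulus;
        there \<open>L\<close> agrees with the real functional \<open>l\<close>, for which the bound
        is known.\<close>
      define c where "c = cnj (L h) / of_real (cmod (L h))"
      have c: "cmod c = 1" using False by (simp add: c_def norm_divide)
      have "L (cscale c h) = cnj (L h) * L h / of_real (cmod (L h))" by (simp add: L_scale[OF h] c_def)
      moreover have "cnj (L h) * L h = of_real (cmod (L h)) * of_real (cmod (L h))"
        by (simp only: mult.commute[of "cnj (L h)"] complex_norm_square[symmetric] power2_eq_square of_real_mult)
      ultimately have "L (cscale c h) = of_real (cmod (L h)) * of_real (cmod (L h)) / of_real (cmod (L h))"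
        by (simp only:)
      also have "\<dots> = of_real (cmod (L h))" using False by simp
      finally have "L (cscale c h) = of_real (cmod (L h))" .
      then have "cmod (L h) = l (cscale c h)" by (simp add: L_def complex_eq_iff)
      also have "\<dots> \<le> weak_seminorm M (cscale c h)" by (rule l_le[OF weak_space_scale[OF h]])
      also have "\<dots> \<le> weak_seminorm M h" using weak_seminorm_scale_le[OF h, of c] c by simp
      finally show ?thesis .
    qed
    show "Re (L f) = weak_seminorm M f" by (simp add: L_def l_f)
  qed
qed

lemma ip_eq_imp_eq:
  assumes "y \<in> H" "y' \<in> H" "\<And>g. g \<in> H \<Longrightarrow> ip g y = ip g y'"
  shows "y = y'"
  using ip_definite[of "y - y'"] assms by (simp add: ip_diff_right)

text \<open>\<open>T f\<close> is the conjugate of the vector representing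
  \<open>g \<mapsto> L (f * g)\<close>. The bound by the seminorm lets \<open>L\<close>, which is
  only finitely additive by hypothesis, annihilate infinite relations as well.\<close>

lemma functional_Hankel:
  assumes add: "\<And>h h'. \<lbrakk>h \<in> weak_space M; h' \<in> weak_space M\<rbrakk> \<Longrightarrow> L (h + h') = L h + L h'"
    and scale: "\<And>h c. h \<in> weak_space M \<Longrightarrow> L (cscale c h) = c * L h"
    and bound: "\<And>h. h \<in> weak_space M \<Longrightarrow> cmod (L h) \<le> weak_seminorm M h"
  obtains T where "T \<in> ker_rho_perp X H ip"
    "\<And>f g. \<lbrakk>f \<in> H; g \<in> H\<rbrakk> \<Longrightarrow> ip g (cnj \<circ> T f) = L (f * g)"
proof -
  have prod_bound: "cmod (L (f * g)) \<le> hnorm ip f * hnorm ip g" if f: "f \<in> H" and g: "g \<in> H" for f g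
  proof -
    have "cmod (L (f * g)) \<le> weak_seminorm M (f * g)" by (rule bound[OF weak_space_product[OF f g]])
    also have "\<dots> \<le> (if g \<in> M then 0 else hnorm ip f * hnorm ip g)"
      by (rule weak_seminorm_le[OF weak_rep_product[OF f g]])
    also have "\<dots> \<le> hnorm ip f * hnorm ip g" using f g by simp
    finally show ?thesis .
  qed
  have "\<exists>y\<in>H. (\<forall>g\<in>H. L (f * g) = ip g y) \<and> hnorm ip y \<le> hnorm ip f" if f: "f \<in> H" for f
  proof -
    define G where "G = (\<lambda>g. (g, L (f * g))) ` H"
    have G: "(x, v) \<in> G \<longleftrightarrow> x \<in> H \<and> v = L (f * x)" for x v by (auto simp: G_def)
    have L0: "L 0 = 0" using scale[OF weak_space_zero, of 0] by simp
    obtain y where "y \<in> H" "\<And>x v. (x, v) \<in> G \<Longrightarrow> v = ip x y" "hnorm ip y \<le> hnorm ip f"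
    proof (rule riesz_graph[of G "hnorm ip f"])
      show "cmod v \<le> hnorm ip f * hnorm ip x" if "(x, v) \<in> G" for x v
        using that prod_bound[OF f] by (auto simp: G)
    qed (use f in \<open>auto simp: G L0 add scale weak_space_product distrib_left times_cscale\<close>)
    then show ?thesis by (auto simp: G)
  qed
  then obtain y where yH: "\<And>f. f \<in> H \<Longrightarrow> y f \<in> H"
    and y: "\<And>f g. \<lbrakk>f \<in> H; g \<in> H\<rbrakk> \<Longrightarrow> L (f * g) = ip g (y f)"
    and y_le: "\<And>f. f \<in> H \<Longrightarrow> hnorm ip (y f) \<le> hnorm ip f"
    by metis
  \<comment> \<open>The representing vector depends conjugate linearly on \<open>f\<close>;
    conjugation restores linearity and moves it into \<open>conj_space H\<close>.\<close>
  define T where "T = (\<lambda>f\<in>H. cnj \<circ> y f)"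
  have T: "T f = cnj \<circ> y f" if "f \<in> H" for f using that by (simp add: T_def)
  have y_add: "y (f + g) = y f + y g" if fg: "f \<in> H" "g \<in> H" for f g
    by (rule ip_eq_imp_eq)
      (use fg in \<open>auto simp: yH ip_add_right y[symmetric] distrib_right add weak_space_product\<close>)
  have y_scale: "y (cscale c f) = cscale (cnj c) (y f)" if f: "f \<in> H" for c f
    by (rule ip_eq_imp_eq)
      (use f in \<open>auto simp: yH ip_scale_right y[symmetric] times_cscale scale weak_space_product\<close>)
  have "T \<in> bounded_ops_to_conj H ip"
    unfolding bounded_ops_to_conj_def
  proof (intro CollectI conjI ballI allI)
    show "T \<in> H \<rightarrow>\<^sub>E conj_space H" using yH by (auto simp: T_def conj_space_def)
    show "T (f + g) = T f + T g" if "f \<in> H" "g \<in> H" for f g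
      using that by (simp add: T y_add fun_eq_iff)
    show "T (cscale c f) = cscale c (T f)" if "f \<in> H" for c f
      using that by (simp add: T y_scale fun_eq_iff)
    show "\<exists>C. \<forall>f\<in>H. hnorm (conj_ip ip) (T f) \<le> C * hnorm ip f"
      by (rule exI[of _ 1]) (simp add: T hnorm_conj_ip y_le)
  qed
  moreover have "(\<lambda>n. ip (g n) (cnj \<circ> T (f n))) sums 0"
    if fg: "\<And>n::nat. f n \<in> H \<and> g n \<in> H" and summ: "summable (\<lambda>n. hnorm ip (f n) * hnorm ip (g n))"
      and zero: "\<And>z. z \<in> X \<Longrightarrow> (\<lambda>n. f n z * g n z) sums 0" for f g
  proof -
    define h where "h N = (\<Sum>n<N. f n * g n)" for N
    have hW: "h N \<in> weak_space M" for N
      unfolding h_def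
      by (induction N) (simp_all only: lessThan_0 sum.empty sum.lessThan_Suc weak_space_zero
          weak_space_add weak_space_product fg)
    have Lh: "(\<Sum>n<N. ip (g n) (cnj \<circ> T (f n))) = L (h N)" for N
    proof (induction N)
      case 0
      have "L 0 = 0" using scale[OF weak_space_zero, of 0] by simp
      then show ?case by (simp only: h_def lessThan_0 sum.empty)
    next
      case (Suc N)
      have "L (h (Suc N)) = L (h N) + L (f N * g N)"
        using hW[of N] fg[of N] by (simp only: h_def sum.lessThan_Suc add weak_space_product)
      then show ?case using Suc fg[of N] by (simp add: T y)
    qed
    \<comment> \<open>As the whole series vanishes pointwise, a partial sum equals minus its tail,
      and the tail is a representation of small cost.\<close>
    have rep: "weak_rep M (h N) (\<Sum>n. hnorm ip (f (n + N)) * hnorm ip (g (n + N)))" for N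
    proof -
      have summN: "summable (\<lambda>n. hnorm ip (f (n + N)) * hnorm ip (g (n + N)))"
        using summ by (rule summable_ignore_initial_segment)
      have "(\<lambda>n. (- f (n + N)) z * g (n + N) z) sums h N z" if z: "z \<in> X" for z
        using sums_minus[OF sums_split_initial_segment[OF zero[OF z], of N]]
        by (simp add: h_def sum_fun_apply)
      moreover have "(\<Sum>n. if g (n + N) \<in> M then 0 else hnorm ip (- f (n + N)) * hnorm ip (g (n + N)))
          \<le> (\<Sum>n. hnorm ip (f (n + N)) * hnorm ip (g (n + N)))"
      proof (rule suminf_le)
        show "summable (\<lambda>n. if g (n + N) \<in> M then 0 else hnorm ip (- f (n + N)) * hnorm ip (g (n + N)))"
          by (rule summable_comparison_test'[OF summN, of 0]) (use fg in auto)
      qed (use fg summN in auto)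
      moreover have "vanishes_off X (h N)"
        using fg vanishes by (auto simp: h_def vanishes_off_def sum_fun_apply intro!: sum.neutral)
      ultimately show ?thesis
        unfolding weak_rep_def using fg summN
        by (intro conjI exI[of _ "\<lambda>n. - f (n + N)"] exI[of _ "\<lambda>n. g (n + N)"]) auto
    qed
    have "(\<lambda>N. \<Sum>n. hnorm ip (f (n + N)) * hnorm ip (g (n + N))) \<longlonglongrightarrow> 0"
      using summ by (rule suminf_exist_split2)
    then have "(\<lambda>N. L (h N)) \<longlonglongrightarrow> 0"
      by (rule Lim_null_comparison[rotated])
        (use order.trans[OF bound[OF hW] weak_seminorm_le[OF rep]] in auto)
    then show ?thesis by (simp add: sums_def Lh)
  qed
  ultimately have "T \<in> ker_rho_perp X H ip" unfolding ker_rho_perp_def by blast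
  then show ?thesis using that y T by simp
qed

section \<open>Operators in \<open>ker_rho_perp\<close> and their symbols\<close>

lemma bounded_op_conj:
  assumes T: "T \<in> bounded_ops_to_conj H ip"
  shows "f \<in> H \<Longrightarrow> cnj \<circ> T f \<in> H"
    and "\<lbrakk>f \<in> H; g \<in> H\<rbrakk> \<Longrightarrow> cnj \<circ> T (f - g) = (cnj \<circ> T f) - (cnj \<circ> T g)"
    and "f \<in> H \<Longrightarrow> T (cscale c f) = cscale c (T f)"
    and "\<exists>C\<ge>0. \<forall>f\<in>H. hnorm ip (cnj \<circ> T f) \<le> C * hnorm ip f"
proof -
  have T_add: "T (f + g) = T f + T g" if "f \<in> H" "g \<in> H" for f g
    using T that by (auto simp: bounded_ops_to_conj_def)
  show mem: "cnj \<circ> T f \<in> H" if "f \<in> H" for f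
    using T that by (auto simp: bounded_ops_to_conj_def conj_space_def dest!: PiE_mem)
  show "cnj \<circ> T (f - g) = (cnj \<circ> T f) - (cnj \<circ> T g)" if "f \<in> H" "g \<in> H" for f g
    using T_add[of "f - g" g] that by (simp add: fun_eq_iff)
  show "T (cscale c f) = cscale c (T f)" if "f \<in> H"
    using T that by (auto simp: bounded_ops_to_conj_def)
  obtain C where C: "\<And>f. f \<in> H \<Longrightarrow> hnorm (conj_ip ip) (T f) \<le> C * hnorm ip f"
    using T unfolding bounded_ops_to_conj_def by blast
  have "hnorm ip (cnj \<circ> T f) \<le> \<bar>C\<bar> * hnorm ip f" if f: "f \<in> H" for f
  proof -
    have "hnorm ip (cnj \<circ> T f) = hnorm (conj_ip ip) (T f)"
      using hnorm_conj_ip[of ip "cnj \<circ> T f"] by simp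
    also have "\<dots> \<le> \<bar>C\<bar> * hnorm ip f"
      by (rule order.trans[OF C[OF f]]) (use f in \<open>auto intro: mult_right_mono\<close>)
    finally show ?thesis .
  qed
  then show "\<exists>C\<ge>0. \<forall>f\<in>H. hnorm ip (cnj \<circ> T f) \<le> C * hnorm ip f" by (intro exI[of _ "\<bar>C\<bar>"]) auto
qed

end

context complete_pick_space
begin

text \<open>The relation \<open>\<phi> * g - 1 * (\<phi> * g) = 0\<close> has two terms in
  \<open>H\<close> because \<open>\<phi>\<close> is a multiplier; annihilating it moves
  \<open>\<phi>\<close> across.\<close>

lemma ker_rho_perp_determined:
  assumes T: "T \<in> ker_rho_perp X H ip" and \<phi>: "\<phi> \<in> kernel_span" and g: "g \<in> H"
  shows "ip g (cnj \<circ> T \<phi>) = ip (\<phi> * g) (cnj \<circ> T (indicator X))"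
proof -
  have Tb: "T \<in> bounded_ops_to_conj H ip" using T by (simp add: ker_rho_perp_def)
  have \<phi>H: "\<phi> \<in> H" and \<phi>g: "\<phi> * g \<in> H"
    using \<phi> g kernel_span_mem bounded_multiplier_mem[OF bounded_multiplier_span] by blast+
  define F where "F n = (if n = 0 then \<phi> else if n = 1 then cscale (-1) (indicator X) else 0)" for n :: nat
  define G where "G n = (if n = 0 then g else if n = 1 then \<phi> * g else 0)" for n :: nat
  have FG: "F n \<in> H \<and> G n \<in> H" for n using \<phi>H \<phi>g g by (simp add: F_def G_def)
  have two: "(\<lambda>n. E n) sums (E 0 + E 1)" if "\<And>n. n \<ge> 2 \<Longrightarrow> E n = 0" for E :: "nat \<Rightarrow> complex"
    using sums_finite[of "{0, 1}" E] that by force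
  have two_real: "(\<lambda>n. E n) sums (E 0 + E 1)" if "\<And>n. n \<ge> 2 \<Longrightarrow> E n = 0" for E :: "nat \<Rightarrow> real"
    using sums_finite[of "{0, 1}" E] that by force
  have "summable (\<lambda>n. hnorm ip (F n) * hnorm ip (G n))"
    by (rule sums_summable[OF two_real]) (simp add: G_def)
  moreover have "(\<lambda>n. F n z * G n z) sums 0" if "z \<in> X" for z
    using two[of "\<lambda>n. F n z * G n z"] that by (simp add: F_def G_def)
  ultimately have "(\<lambda>n. ip (G n) (cnj \<circ> T (F n))) sums 0"
    using T FG unfolding ker_rho_perp_def by blast
  moreover have "(\<lambda>n. ip (G n) (cnj \<circ> T (F n))) sums (ip (G 0) (cnj \<circ> T (F 0)) + ip (G 1) (cnj \<circ> T (F 1)))"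
    by (rule two) (use bounded_op_conj(1)[OF Tb] FG in \<open>simp add: G_def\<close>)
  ultimately have "ip (G 0) (cnj \<circ> T (F 0)) + ip (G 1) (cnj \<circ> T (F 1)) = 0"
    using sums_unique2 by blast
  then have "ip g (cnj \<circ> T \<phi>) + ip (\<phi> * g) (cnj \<circ> T (cscale (-1) (indicator X))) = 0"
    by (simp add: F_def G_def)
  moreover have "cnj \<circ> T (cscale (-1) (indicator X)) = cscale (-1) (cnj \<circ> T (indicator X))"
    using bounded_op_conj(3)[OF Tb one_mem, of "-1"] by (simp add: fun_eq_iff)
  ultimately show ?thesis
    using bounded_op_conj(1)[OF Tb one_mem] \<phi>g by (simp add: ip_minus_right)
qed

text \<open>The value at 1 determines the operator on the kernel span, boundedness extends this to
  \<open>H\<close>, and off \<open>H\<close> extensionality leaves no choice.\<close>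

lemma ker_rho_perp_unique:
  assumes T: "T \<in> ker_rho_perp X H ip" and S: "S \<in> ker_rho_perp X H ip"
    and eq: "T (indicator X) = S (indicator X)"
  shows "T = S"
proof
  fix f
  have Tb: "T \<in> bounded_ops_to_conj H ip" and Sb: "S \<in> bounded_ops_to_conj H ip"
    using T S by (simp_all add: ker_rho_perp_def)
  show "T f = S f"
  proof (cases "f \<in> H")
    case False
    then show ?thesis using Tb Sb by (auto simp: bounded_ops_to_conj_def dest!: PiE_arb)
  next
    case f: True
    obtain C where C: "0 \<le> C" "\<And>f. f \<in> H \<Longrightarrow> hnorm ip (cnj \<circ> T f) \<le> C * hnorm ip f"
      using bounded_op_conj(4)[OF Tb] by blast
    obtain D where D: "0 \<le> D" "\<And>f. f \<in> H \<Longrightarrow> hnorm ip (cnj \<circ> S f) \<le> D * hnorm ip f"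
      using bounded_op_conj(4)[OF Sb] by blast
    note mem = bounded_op_conj(1)[OF Tb] bounded_op_conj(1)[OF Sb]
    have "hnorm ip ((cnj \<circ> T f) - (cnj \<circ> S f)) \<le> 0"
    proof (rule field_le_epsilon)
      fix e :: real assume e: "0 < e"
      obtain x where x: "x \<in> kernel_span" "hnorm ip (x - f) < e / (C + D + 1)"
        by (rule kernel_span_approx[OF f, of "e / (C + D + 1)"]) (use e C D in auto)
      have xH: "x \<in> H" using x kernel_span_mem by blast
      have "cnj \<circ> T x = cnj \<circ> S x"
        by (rule ip_eq_imp_eq[OF mem(1)[OF xH] mem(2)[OF xH]])
          (simp add: ker_rho_perp_determined[OF T x(1)] ker_rho_perp_determined[OF S x(1)] eq)
      \<comment> \<open>The common value at \<open>x\<close> cancels, so only the small vector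
        \<open>x - f\<close> is fed to the two bounded operators.\<close>
      then have "(cnj \<circ> T f) - (cnj \<circ> S f) = (cnj \<circ> S (x - f)) - (cnj \<circ> T (x - f))"
        using bounded_op_conj(2)[OF Tb xH f] bounded_op_conj(2)[OF Sb xH f] by simp
      then have "hnorm ip ((cnj \<circ> T f) - (cnj \<circ> S f)) \<le> D * hnorm ip (x - f) + C * hnorm ip (x - f)"
        using hnorm_triangle_diff[of "cnj \<circ> S (x - f)" "cnj \<circ> T (x - f)"] mem[of "x - f"]
          C(2)[of "x - f"] D(2)[of "x - f"] xH f by simp
      also have "\<dots> \<le> (C + D + 1) * hnorm ip (x - f)"
        using hnorm_nonneg[of "x - f"] xH f by (simp add: algebra_simps)
      also have "\<dots> \<le> e" using x(2) C D by (simp add: field_simps)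
      finally show "hnorm ip ((cnj \<circ> T f) - (cnj \<circ> S f)) \<le> 0 + e" by simp
    qed
    then have "hnorm ip ((cnj \<circ> T f) - (cnj \<circ> S f)) = 0"
      using hnorm_nonneg[of "(cnj \<circ> T f) - (cnj \<circ> S f)"] mem[OF f] by (intro antisym) auto
    then have "(cnj \<circ> T f) - (cnj \<circ> S f) = 0"
      using hnorm_eq_0[of "(cnj \<circ> T f) - (cnj \<circ> S f)"] mem[OF f] by auto
    then show ?thesis by (simp add: cnj_comp_eq_iff)
  qed
qed

lemma hankel_eq:
  assumes "T \<in> ker_rho_perp X H ip"
  shows "hankel X H ip (cnj \<circ> T (indicator X)) = T"
  unfolding hankel_def cnj_comp_cnj_comp
  by (rule the_equality) (use assms ker_rho_perp_unique in auto)

text \<open>\<open>T\<close> comes from a functional \<open>L\<close> norming \<open>d\<close>.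
  Products with a factor in \<open>M\<close> have seminorm 0, so \<open>T\<close> kills
  \<open>M\<close>. If \<open>T f = 0\<close> then \<open>L f = 0\<close>, so the seminorm of
  \<open>d\<close> is at most the distance to \<open>f\<close>; a second such distance for passing
  from \<open>d\<close> to \<open>f\<close> gives the factor 2.\<close>

lemma Hankel_separation:
  assumes M: "cfun.subspace M" "M \<subseteq> H" and d: "d \<in> H"
  obtains T where "T \<in> ker_rho_perp X H ip" "\<And>m. m \<in> M \<Longrightarrow> T m = 0"
    "\<And>f. f \<in> H \<Longrightarrow> T f = 0 \<Longrightarrow> weak_seminorm M f \<le> 2 * hnorm ip (f - d)"
proof -
  have one: "indicator X * f = f" if "f \<in> H" for f
    using off_X[OF that] by (auto simp: fun_eq_iff indicator_def)
  have H_sub: "f \<in> weak_space M" if "f \<in> H" for f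
    using weak_space_product[OF one_mem that, of M] one[OF that] by simp
  have p_le: "weak_seminorm M f \<le> hnorm ip f" if f: "f \<in> H" for f
    using weak_seminorm_le[OF weak_rep_product[OF one_mem f, of M]] one[OF f] f by (auto split: if_splits intro: order.trans)
  obtain L where L_add: "\<And>h h'. \<lbrakk>h \<in> weak_space M; h' \<in> weak_space M\<rbrakk> \<Longrightarrow> L (h + h') = L h + L h'"
    and L_scale: "\<And>h c. h \<in> weak_space M \<Longrightarrow> L (cscale c h) = c * L h"
    and L_le: "\<And>h. h \<in> weak_space M \<Longrightarrow> cmod (L h) \<le> weak_seminorm M h"
    and L_d: "Re (L d) = weak_seminorm M d"
    by (rule weak_functional[OF H_sub[OF d]]) blast
  obtain T where T: "T \<in> ker_rho_perp X H ip"
    "\<And>f g. \<lbrakk>f \<in> H; g \<in> H\<rbrakk> \<Longrightarrow> ip g (cnj \<circ> T f) = L (f * g)"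
    by (rule functional_Hankel[OF L_add L_scale L_le]) auto
  show ?thesis
  proof (rule that[OF T(1)])
    fix m assume m: "m \<in> M"
    then have mH: "m \<in> H" using M by blast
    have mem: "cnj \<circ> T m \<in> H" using bounded_op_conj(1) T(1) mH by (auto simp: ker_rho_perp_def)
    have "L (g * m) = 0" if g: "g \<in> H" for g
    proof -
      have "cmod (L (g * m)) \<le> 0"
      proof (rule order.trans[OF L_le[OF weak_space_product[OF g mH]]])
        show "weak_seminorm M (g * m) \<le> 0"
          using weak_seminorm_le[OF weak_rep_product[OF g mH, of M]] m by simp
      qed
      then show ?thesis by simp
    qed
    then have "ip g (cnj \<circ> T m) = ip g 0" if "g \<in> H" for g
      using T(2)[OF mH that] that by (simp add: mult.commute)
    then have "cnj \<circ> T m = 0" by (intro ip_eq_imp_eq mem) auto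
    then show "T m = 0" by (simp add: fun_eq_iff)
  next
    fix f assume f: "f \<in> H" and Tf: "T f = 0"
    \<comment> \<open>Testing against the constant function 1 recovers \<open>L\<close> on
      \<open>H\<close> from the operator.\<close>
    have L_H: "L f = ip (indicator X) (cnj \<circ> T f)" using T(2)[OF f one_mem] one[OF f] by (simp add: mult.commute)
    have "L f = 0" unfolding L_H Tf cnj_comp_zero by simp
    moreover have "L d = L (d - f) + L f" using L_add[of "d - f" f] H_sub d f by simp
    ultimately have "weak_seminorm M d = Re (L (d - f))" using L_d by simp
    also have "\<dots> \<le> hnorm ip (d - f)"
      using L_le[OF H_sub[of "d - f"]] p_le[of "d - f"] complex_Re_le_cmod[of "L (d - f)"] d f by simp
    finally have "weak_seminorm M d \<le> hnorm ip (f - d)" using hnorm_minus_commute[OF f d] by simp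
    moreover have "weak_seminorm M f \<le> weak_seminorm M (f - d) + weak_seminorm M d"
      using weak_seminorm_add[of "f - d" M d] H_sub f d by simp
    moreover have "weak_seminorm M (f - d) \<le> hnorm ip (f - d)" using p_le f d by simp
    ultimately show "weak_seminorm M f \<le> 2 * hnorm ip (f - d)" by simp
  qed
qed

text \<open>One separating operator is taken for each point of a countable dense set. A vector
  killed by all of them has seminorm at most twice its distance to every dense point, hence seminorm
  0, and \<open>weak_rep_null_imp_mem\<close> puts it in \<open>M\<close>.\<close>

lemma invariant_subspace_Hankel_kernels:
  assumes sep: "hseparable H ip" and incl: "M_C X H ip \<subseteq> M_R X H ip"
    and M: "multiplier_invariant_subspace X H ip M"
  shows "\<exists>b :: nat \<Rightarrow> 'x \<Rightarrow> complex. (\<forall>n. b n \<in> Han X H ip) \<and> M = (\<Inter>n. hankel_ker X H ip (b n))"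
proof -
  have M_sub: "cfun.subspace M" and MH: "M \<subseteq> H" using M by (auto simp: multiplier_invariant_subspace_def)
  obtain D where D: "countable D" "D \<subseteq> H" "\<And>f e. \<lbrakk>f \<in> H; 0 < e\<rbrakk> \<Longrightarrow> \<exists>d\<in>D. hnorm ip (f - d) < e"
    using sep unfolding hseparable_def by blast
  have "D \<noteq> {}" using D(3)[of 0 1] by auto
  define q where "q = from_nat_into D"
  have q_range: "range q = D" unfolding q_def using \<open>D \<noteq> {}\<close> D(1) by (rule range_from_nat_into)
  then have qH: "q n \<in> H" for n using D(2) by blast
  have "\<exists>T. T \<in> ker_rho_perp X H ip \<and> (\<forall>m\<in>M. T m = 0) \<and>
      (\<forall>f\<in>H. T f = 0 \<longrightarrow> weak_seminorm M f \<le> 2 * hnorm ip (f - q n))" for n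
    by (rule Hankel_separation[OF M_sub MH qH]) blast
  then obtain T where T: "\<And>n. T n \<in> ker_rho_perp X H ip" "\<And>n m. m \<in> M \<Longrightarrow> T n m = 0"
    "\<And>n f. \<lbrakk>f \<in> H; T n f = 0\<rbrakk> \<Longrightarrow> weak_seminorm M f \<le> 2 * hnorm ip (f - q n)"
    by metis
  define b where "b n = cnj \<circ> T n (indicator X)" for n
  have "b n \<in> Han X H ip" for n using T(1) by (auto simp: b_def Han_def)
  moreover have ker: "hankel_ker X H ip (b n) = {f \<in> H. T n f = 0}" for n
    by (simp add: hankel_ker_def b_def hankel_eq[OF T(1)])
  have "M = (\<Inter>n. hankel_ker X H ip (b n))"
  proof
    show "M \<subseteq> (\<Inter>n. hankel_ker X H ip (b n))" using MH T(2) by (auto simp: ker)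
  next
    show "(\<Inter>n. hankel_ker X H ip (b n)) \<subseteq> M"
    proof
      fix f assume "f \<in> (\<Inter>n. hankel_ker X H ip (b n))"
      then have f: "f \<in> H" and Tf: "T n f = 0" for n by (auto simp: ker)
      show "f \<in> M"
      proof (rule weak_rep_null_imp_mem[OF incl M f])
        fix e :: real assume e: "0 < e"
        obtain d where "d \<in> D" "hnorm ip (f - d) < e / 2" using D(3)[OF f, of "e / 2"] e by auto
        then obtain n where "hnorm ip (f - q n) < e / 2" using q_range by blast
        then have "weak_seminorm M f < e" using T(3)[OF f Tf, of n] by simp
        moreover have "indicator X * f = f"
          using off_X[OF f] by (auto simp: fun_eq_iff indicator_def)
        then have "f \<in> weak_space M" using weak_space_product[OF one_mem f, of M] by simp
        ultimately obtain s where "weak_rep M f s" "s \<le> e"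
          using le_weak_seminorm[of f M e] by (meson le_less_linear less_imp_le not_less)
        then show "weak_rep M f e" by (rule weak_rep_mono)
      qed
    qed
  qed
  ultimately show ?thesis by blast
qed

end

theorem corollary3p8:
  fixes X :: "'x set" and H :: "('x \<Rightarrow> complex) set" and ip :: "'x ip"
    and k :: "'x \<Rightarrow> 'x \<Rightarrow> complex" and z\<^sub>0 :: 'x and M :: "('x \<Rightarrow> complex) set"
  assumes "X \<noteq> {}"
    and "hilbert_function_space X H ip"
    and "hseparable H ip"
    and "reproducing_kernel X H ip k"
    and "complete_pick_normalized_at X k z\<^sub>0"
    and "M_C X H ip \<subseteq> M_R X H ip"
    and "multiplier_invariant_subspace X H ip M"
  shows "\<exists>b :: nat \<Rightarrow> 'x \<Rightarrow> complex.
           (\<forall>n. b n \<in> Han X H ip) \<and> M = (\<Inter>n. hankel_ker X H ip (b n))"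
proof -
  obtain u where "positive_definite_on X u" "\<And>z w. \<lbrakk>z \<in> X; w \<in> X\<rbrakk> \<Longrightarrow> u z w \<noteq> 1 \<and> k z w = 1 / (1 - u z w)"
    using assms(5) unfolding complete_pick_normalized_at_def by blast
  then interpret complete_pick_space X H ip k u z\<^sub>0
    using assms(2,4,5)
    by (auto simp: complete_pick_space_def complete_pick_space_axioms_def complete_pick_normalized_at_def)
  show ?thesis by (rule invariant_subspace_Hankel_kernels[OF assms(3,6,7)])
qed

end
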